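(* Let $R$ be a commutative ring and let $\mathcal{D}$ be a compactly generated $R$-linear triangulated category (with arbitrary coproducts). The following are equivalent for an object $X\in\mathcal{D}$: (i) $\mathrm{pp.dim}\,X\leq1$. (ii) $\mathbf{y}_{X,Y}:\mathcal{D}(X,Y)\to\mathrm{Hom}_{\mathcal{D}^c}(\mathbf{y}X,\mathbf{y}Y)$ is surjective for all $Y\in\mathcal{D}$. In particular, the restriction of $\mathbf{y}$ to a functor $\mathcal{D}_d\to\mathrm{Mod}\text{-}\mathcal{D}^c$ is full and its essential image consists of those $\mathcal{D}^c$-modules of projective dimension less than or equal to $1$.
   Context: $\mathcal{D}^c$ is the full subcategory of compact objects of $\mathcal{D}$; compactly generated means that $\mathcal{D}^c$ is essentially small and $\mathcal{D}(C,X)=0$ for all $C\in\mathcal{D}^c$ implies $X=0$. $\mathrm{Mod}\text{-}\mathcal{D}^c$ is the category of $R$-linear contravariant functors ($\mathcal{D}^c$-modules) $\mathcal{D}^c\to\mathrm{Mod}\text{-}R$, with $\mathrm{Hom}_{\mathcal{D}^c}$ denoting natural transformations, and $\mathbf{y}:\mathcal{D}\to\mathrm{Mod}\text{-}\mathcal{D}^c$ is the restricted Yoneda functor $\mathbf{y}X=\mathcal{D}(-,X)|_{\mathcal{D}^c}$; $\mathbf{y}_{X,Y}$ is its action on morphisms. A triangle $X\to Y\to Z\to X[1]$ in $\mathcal{D}$ is pure if $0\to\mathbf{y}X\to\mathbf{y}Y\to\mathbf{y}Z\to0$ is short exact. An object $P\in\mathcal{D}$ is pure projective if $\mathcal{D}(P,-)$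 sends pure triangles to short exact sequences; the pure projective objects are known to be exactly those in $\mathrm{Add}(\mathcal{D}^c)$, the direct summands of coproducts of compact objects. $\mathrm{pp.dim}\,X\leq1$ means there is a pure triangle $P_1\to P_0\to X\to P_1[1]$ with $P_0,P_1$ pure projective. $\mathcal{D}_d$ is the full subcategory of all $X\in\mathcal{D}$ with $\mathrm{pp.dim}\,X\le1$. *)

theory Defs
  imports "HOL-Algebra.Module"
begin

unbundle cardinal_syntax

text \<open>
  The set/class distinction is made relative to an uncountable regular cardinal \<open>\<kappa>\<close>: a set is
  \<^emph>\<open>small\<close> if it has fewer than \<open>\<kappa>\<close> elements. If \<open>\<kappa>\<close> is inaccessible, the small sets are, up to
  bijection, the members of a Grothendieck universe. Strong limits are not needed, and not asking
  for them keeps the notions instantiable in types that HOL can exhibit (e.g. \<open>\<kappa> = \<aleph>\<^sub>1\<close>).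
  Every small set has a copy inside the type \<open>'k\<close> of \<open>\<kappa>\<close>, so index sets are taken there.
\<close>

definition size_bound :: "'k rel \<Rightarrow> bool" where
  "size_bound \<kappa> \<longleftrightarrow> Card_order \<kappa> \<and> natLeq <o \<kappa> \<and> regularCard \<kappa>"

definition small :: "'k rel \<Rightarrow> 'a set \<Rightarrow> bool" where
  "small \<kappa> A \<longleftrightarrow> |A| <o \<kappa>"

definition linear_map ::
    "('r, 's) ring_scheme \<Rightarrow> ('r, 'a, 'p) module_scheme \<Rightarrow> ('r, 'b, 'q) module_scheme \<Rightarrow> ('a \<Rightarrow> 'b) \<Rightarrow> bool"
  where
  "linear_map R M N f \<longleftrightarrow>
     f \<in> carrier M \<rightarrow> carrier N \<and>
     (\<forall>x\<in>carrier M. \<forall>y\<in>carrier M. f (x \<oplus>\<^bsub>M\<^esub> y) = f x \<oplus>\<^bsub>N\<^esub> f y) \<and>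
     (\<forall>a\<in>carrier R. \<forall>x\<in>carrier M. f (a \<odot>\<^bsub>M\<^esub> x) = a \<odot>\<^bsub>N\<^esub> f x)"

text \<open>Linearity of \<open>f\<close> and \<open>g\<close> is not part of \<open>short_exact\<close>; it holds wherever the predicate is used.\<close>

definition short_exact ::
    "('r, 'a) module \<Rightarrow> ('r, 'a) module \<Rightarrow> ('r, 'a) module \<Rightarrow> ('a \<Rightarrow> 'a) \<Rightarrow> ('a \<Rightarrow> 'a) \<Rightarrow> bool" where
  "short_exact L M N f g \<longleftrightarrow>
     inj_on f (carrier L) \<and>
     f ` carrier L = {x \<in> carrier M. g x = \<zero>\<^bsub>N\<^esub>} \<and>
     g ` carrier M = carrier N"

text \<open>
  A category with objects in \<open>'o\<close> and morphisms in \<open>'m\<close>; \<open>Hom D X Y\<close> is the \<open>R\<close>-module of morphisms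
  from \<open>X\<close> to \<open>Y\<close> (the multiplicative fields of the module record are irrelevant), and
  \<open>g \<cdot> f\<close> is \<open>g\<close> after \<open>f\<close>. Hom-sets may, but need not, be disjoint.
\<close>

record ('r, 'o, 'm) lincat =
  Ob :: "'o set"
  Hom :: "'o \<Rightarrow> 'o \<Rightarrow> ('r, 'm) module"
  Cmp :: "'m \<Rightarrow> 'm \<Rightarrow> 'm"  (infixl \<open>\<cdot>\<index>\<close> 70)
  Idn :: "'o \<Rightarrow> 'm"

abbreviation mor :: "('r, 'o, 'm, 'z) lincat_scheme \<Rightarrow> 'o \<Rightarrow> 'o \<Rightarrow> 'm set" where
  "mor D X Y \<equiv> carrier (Hom D X Y)"

locale linear_category = cring R
  for R :: "('r, 's) ring_scheme" (structure)
  and D :: "('r, 'o, 'm, 'z) lincat_scheme" +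
  assumes Hom_module: "\<lbrakk>X \<in> Ob D; Y \<in> Ob D\<rbrakk> \<Longrightarrow> module R (Hom D X Y)"
    and Idn_closed: "X \<in> Ob D \<Longrightarrow> Idn D X \<in> mor D X X"
    and Idn_left: "\<lbrakk>X \<in> Ob D; Y \<in> Ob D; f \<in> mor D X Y\<rbrakk> \<Longrightarrow> Idn D Y \<cdot>\<^bsub>D\<^esub> f = f"
    and Idn_right: "\<lbrakk>X \<in> Ob D; Y \<in> Ob D; f \<in> mor D X Y\<rbrakk> \<Longrightarrow> f \<cdot>\<^bsub>D\<^esub> Idn D X = f"
    and Cmp_assoc:
      "\<lbrakk>W \<in> Ob D; X \<in> Ob D; Y \<in> Ob D; Z \<in> Ob D; f \<in> mor D W X; g \<in> mor D X Y; h \<in> mor D Y Z\<rbrakk>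
       \<Longrightarrow> h \<cdot>\<^bsub>D\<^esub> (g \<cdot>\<^bsub>D\<^esub> f) = h \<cdot>\<^bsub>D\<^esub> g \<cdot>\<^bsub>D\<^esub> f"
    and Cmp_linear_left:
      "\<lbrakk>X \<in> Ob D; Y \<in> Ob D; Z \<in> Ob D; f \<in> mor D X Y\<rbrakk>
       \<Longrightarrow> linear_map R (Hom D Y Z) (Hom D X Z) (\<lambda>g. g \<cdot>\<^bsub>D\<^esub> f)"
    and Cmp_linear_right:
      "\<lbrakk>X \<in> Ob D; Y \<in> Ob D; Z \<in> Ob D; g \<in> mor D Y Z\<rbrakk>
       \<Longrightarrow> linear_map R (Hom D X Y) (Hom D X Z) (\<lambda>f. g \<cdot>\<^bsub>D\<^esub> f)"

definition is_iso :: "('r, 'o, 'm, 'z) lincat_scheme \<Rightarrow> 'o \<Rightarrow> 'o \<Rightarrow> 'm \<Rightarrow> bool" where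
  "is_iso D X Y f \<longleftrightarrow>
     f \<in> mor D X Y \<and> (\<exists>g\<in>mor D Y X. g \<cdot>\<^bsub>D\<^esub> f = Idn D X \<and> f \<cdot>\<^bsub>D\<^esub> g = Idn D Y)"

definition isomorphic_obj :: "('r, 'o, 'm, 'z) lincat_scheme \<Rightarrow> 'o \<Rightarrow> 'o \<Rightarrow> bool" where
  "isomorphic_obj D X Y \<longleftrightarrow> (\<exists>f. is_iso D X Y f)"

definition is_zero_obj :: "('r, 'o, 'm, 'z) lincat_scheme \<Rightarrow> 'o \<Rightarrow> bool" where
  "is_zero_obj D X \<longleftrightarrow> X \<in> Ob D \<and> Idn D X = \<zero>\<^bsub>Hom D X X\<^esub>"

definition is_coproduct ::
    "('r, 'o, 'm, 'z) lincat_scheme \<Rightarrow> 'i set \<Rightarrow> ('i \<Rightarrow> 'o) \<Rightarrow> 'o \<Rightarrow> ('i \<Rightarrow> 'm) \<Rightarrow> bool" where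
  "is_coproduct D I X S \<iota> \<longleftrightarrow>
     S \<in> Ob D \<and> (\<forall>i\<in>I. \<iota> i \<in> mor D (X i) S) \<and>
     (\<forall>Y\<in>Ob D. \<forall>f. (\<forall>i\<in>I. f i \<in> mor D (X i) Y) \<longrightarrow>
        (\<exists>!g. g \<in> mor D S Y \<and> (\<forall>i\<in>I. g \<cdot>\<^bsub>D\<^esub> \<iota> i = f i)))"

definition has_small_coproducts :: "'k rel \<Rightarrow> ('r, 'o, 'm, 'z) lincat_scheme \<Rightarrow> bool" where
  "has_small_coproducts \<kappa> D \<longleftrightarrow>
     (\<forall>(I :: 'k set) X. small \<kappa> I \<and> (\<forall>i\<in>I. X i \<in> Ob D) \<longrightarrow> (\<exists>S \<iota>. is_coproduct D I X S \<iota>))"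

text \<open>
  \<open>ShO\<close> and \<open>ShM\<close> are the shift \<open>[1]\<close> on objects and morphisms; \<open>Tri D X Y Z f g h\<close> says that
  \<open>X \<rightarrow>f Y \<rightarrow>g Z \<rightarrow>h X[1]\<close> is a distinguished triangle. The shift is an autoequivalence,
  not necessarily an automorphism; accordingly rotation is an equivalence.
\<close>

record ('r, 'o, 'm) tricat = "('r, 'o, 'm) lincat" +
  ShO :: "'o \<Rightarrow> 'o"
  ShM :: "'m \<Rightarrow> 'm"
  Tri :: "'o \<Rightarrow> 'o \<Rightarrow> 'o \<Rightarrow> 'm \<Rightarrow> 'm \<Rightarrow> 'm \<Rightarrow> bool"

locale triangulated_category = linear_category R D
  for R :: "('r, 's) ring_scheme" (structure)
  and D :: "('r, 'o, 'm, 'z) tricat_scheme" +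
  assumes zero_object: "\<exists>Z. is_zero_obj D Z"
    and biproducts:
      "\<lbrakk>X \<in> Ob D; Y \<in> Ob D\<rbrakk> \<Longrightarrow>
       \<exists>S\<in>Ob D. \<exists>i\<in>mor D X S. \<exists>j\<in>mor D Y S. \<exists>p\<in>mor D S X. \<exists>q\<in>mor D S Y.
         p \<cdot>\<^bsub>D\<^esub> i = Idn D X \<and> q \<cdot>\<^bsub>D\<^esub> j = Idn D Y \<and>
         p \<cdot>\<^bsub>D\<^esub> j = \<zero>\<^bsub>Hom D Y X\<^esub> \<and> q \<cdot>\<^bsub>D\<^esub> i = \<zero>\<^bsub>Hom D X Y\<^esub> \<and>
         (i \<cdot>\<^bsub>D\<^esub> p) \<oplus>\<^bsub>Hom D S S\<^esub> (j \<cdot>\<^bsub>D\<^esub> q) = Idn D S"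
    and shift_closed: "X \<in> Ob D \<Longrightarrow> ShO D X \<in> Ob D"
    and shift_linear:
      "\<lbrakk>X \<in> Ob D; Y \<in> Ob D\<rbrakk> \<Longrightarrow> linear_map R (Hom D X Y) (Hom D (ShO D X) (ShO D Y)) (ShM D)"
    and shift_Idn: "X \<in> Ob D \<Longrightarrow> ShM D (Idn D X) = Idn D (ShO D X)"
    and shift_Cmp:
      "\<lbrakk>X \<in> Ob D; Y \<in> Ob D; Z \<in> Ob D; f \<in> mor D X Y; g \<in> mor D Y Z\<rbrakk>
       \<Longrightarrow> ShM D (g \<cdot>\<^bsub>D\<^esub> f) = ShM D g \<cdot>\<^bsub>D\<^esub> ShM D f"
    and shift_fully_faithful:
      "\<lbrakk>X \<in> Ob D; Y \<in> Ob D\<rbrakk> \<Longrightarrow> bij_betw (ShM D) (mor D X Y) (mor D (ShO D X) (ShO D Y))"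
    and shift_ess_surj: "Y \<in> Ob D \<Longrightarrow> \<exists>X\<in>Ob D. isomorphic_obj D (ShO D X) Y"
    and Tri_typed:
      "Tri D X Y Z f g h \<Longrightarrow>
       X \<in> Ob D \<and> Y \<in> Ob D \<and> Z \<in> Ob D \<and> f \<in> mor D X Y \<and> g \<in> mor D Y Z \<and> h \<in> mor D Z (ShO D X)"
    and Tri_iso:
      "\<lbrakk>Tri D X Y Z f g h; X' \<in> Ob D; Y' \<in> Ob D; Z' \<in> Ob D;
        f' \<in> mor D X' Y'; g' \<in> mor D Y' Z'; h' \<in> mor D Z' (ShO D X');
        is_iso D X X' a; is_iso D Y Y' b; is_iso D Z Z' c;
        b \<cdot>\<^bsub>D\<^esub> f = f' \<cdot>\<^bsub>D\<^esub> a; c \<cdot>\<^bsub>D\<^esub> g = g' \<cdot>\<^bsub>D\<^esub> b; ShM D a \<cdot>\<^bsub>D\<^esub> h = h' \<cdot>\<^bsub>D\<^esub> c\<rbrakk>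
       \<Longrightarrow> Tri D X' Y' Z' f' g' h'"
    and Tri_Idn:
      "\<lbrakk>X \<in> Ob D; is_zero_obj D Z\<rbrakk>
       \<Longrightarrow> Tri D X X Z (Idn D X) \<zero>\<^bsub>Hom D X Z\<^esub> \<zero>\<^bsub>Hom D Z (ShO D X)\<^esub>"
    and Tri_cone:
      "\<lbrakk>X \<in> Ob D; Y \<in> Ob D; f \<in> mor D X Y\<rbrakk> \<Longrightarrow> \<exists>Z g h. Tri D X Y Z f g h"
    and Tri_rotate:
      "\<lbrakk>X \<in> Ob D; Y \<in> Ob D; Z \<in> Ob D; f \<in> mor D X Y; g \<in> mor D Y Z; h \<in> mor D Z (ShO D X)\<rbrakk>
       \<Longrightarrow> Tri D X Y Z f g h \<longleftrightarrow>
           Tri D Y Z (ShO D X) g h (\<ominus>\<^bsub>Hom D (ShO D X) (ShO D Y)\<^esub> ShM D f)"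
    and Tri_morphism:
      "\<lbrakk>Tri D X Y Z f g h; Tri D X' Y' Z' f' g' h'; a \<in> mor D X X'; b \<in> mor D Y Y';
        b \<cdot>\<^bsub>D\<^esub> f = f' \<cdot>\<^bsub>D\<^esub> a\<rbrakk>
       \<Longrightarrow> \<exists>c\<in>mor D Z Z'. c \<cdot>\<^bsub>D\<^esub> g = g' \<cdot>\<^bsub>D\<^esub> b \<and> ShM D a \<cdot>\<^bsub>D\<^esub> h = h' \<cdot>\<^bsub>D\<^esub> c"
    and Tri_octahedral:
      "\<lbrakk>Tri D X Y Z' f i i'; Tri D Y Z X' g j j'; Tri D X Z Y' (g \<cdot>\<^bsub>D\<^esub> f) k k'\<rbrakk>
       \<Longrightarrow> \<exists>u v. Tri D Z' Y' X' u v (ShM D i \<cdot>\<^bsub>D\<^esub> j') \<and>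
             u \<cdot>\<^bsub>D\<^esub> i = k \<cdot>\<^bsub>D\<^esub> g \<and> k' \<cdot>\<^bsub>D\<^esub> u = i' \<and>
             v \<cdot>\<^bsub>D\<^esub> k = j \<and> j' \<cdot>\<^bsub>D\<^esub> v = ShM D f \<cdot>\<^bsub>D\<^esub> k'"

text \<open>
  \<open>C\<close> is compact if for all small coproducts the canonical map from the direct sum of the
  \<open>D(C, X i)\<close>, realised as finitely supported families, to \<open>D(C, S)\<close> is bijective.
\<close>

definition compact_objs :: "'k rel \<Rightarrow> ('r, 'o, 'm, 'z) lincat_scheme \<Rightarrow> 'o set" where
  "compact_objs \<kappa> D =
     {C \<in> Ob D. \<forall>(I :: 'k set) X S \<iota>.
        small \<kappa> I \<and> (\<forall>i\<in>I. X i \<in> Ob D) \<and> is_coproduct D I X S \<iota> \<longrightarrow>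
        bij_betw
          (\<lambda>f. finsum (Hom D C S) (\<lambda>i. \<iota> i \<cdot>\<^bsub>D\<^esub> f i) {i \<in> I. f i \<noteq> \<zero>\<^bsub>Hom D C (X i)\<^esub>})
          {f \<in> (\<Pi>\<^sub>E i\<in>I. mor D C (X i)). finite {i \<in> I. f i \<noteq> \<zero>\<^bsub>Hom D C (X i)\<^esub>}}
          (mor D C S)}"

text \<open>
  Local smallness is demanded only for compact sources. For inaccessible \<open>\<kappa>\<close> this is implied by
  smallness of all hom-sets, whereas for \<open>\<kappa>\<close> not a strong limit smallness of all hom-sets would
  force \<open>D = 0\<close>. The assumption \<open>elements\<close> says that every small set has a copy in \<open>'m\<close>, so that
  \<open>R\<close>-modules with small carrier in \<open>'m\<close> (see \<open>dmod_objs\<close>) account for all small \<open>R\<close>-modules.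
\<close>

locale compactly_generated = triangulated_category R D
  for R :: "('r, 's) ring_scheme" (structure)
  and \<kappa> :: "'k rel"
  and D :: "('r, 'o, 'm, 'z) tricat_scheme" +
  assumes bound: "size_bound \<kappa>"
    and elements: "\<kappa> \<le>o |UNIV :: 'm set|"
    and coproducts: "has_small_coproducts \<kappa> D"
    and compacts_locally_small:
      "\<lbrakk>C \<in> compact_objs \<kappa> D; X \<in> Ob D\<rbrakk> \<Longrightarrow> small \<kappa> (mor D C X)"
    and compacts_ess_small:
      "\<exists>S \<subseteq> compact_objs \<kappa> D. small \<kappa> S \<and> (\<forall>C\<in>compact_objs \<kappa> D. \<exists>C'\<in>S. isomorphic_obj D C C')"
    and compacts_generate:
      "\<lbrakk>X \<in> Ob D; \<And>C. C \<in> compact_objs \<kappa> D \<Longrightarrow> mor D C X = {\<zero>\<^bsub>Hom D C X\<^esub>}\<rbrakk>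
       \<Longrightarrow> is_zero_obj D X"

text \<open>
  A contravariant functor from \<open>D\<^sup>c\<close> to \<open>R\<close>-modules: \<open>Act M C C' f\<close> is the map
  \<open>M(C') \<rightarrow> M(C)\<close> induced by \<open>f : C \<rightarrow> C'\<close>.
\<close>

record ('r, 'o, 'm) dmod =
  Val :: "'o \<Rightarrow> ('r, 'm) module"
  Act :: "'o \<Rightarrow> 'o \<Rightarrow> 'm \<Rightarrow> 'm \<Rightarrow> 'm"

definition dmod_objs ::
    "('r, 's) ring_scheme \<Rightarrow> 'k rel \<Rightarrow> ('r, 'o, 'm, 'z) lincat_scheme \<Rightarrow> ('r, 'o, 'm) dmod set" where
  "dmod_objs R \<kappa> D = {M.
     (\<forall>C\<in>compact_objs \<kappa> D. module R (Val M C) \<and> small \<kappa> (carrier (Val M C))) \<and>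
     (\<forall>C\<in>compact_objs \<kappa> D. \<forall>C'\<in>compact_objs \<kappa> D. \<forall>f\<in>mor D C C'.
        linear_map R (Val M C') (Val M C) (Act M C C' f)) \<and>
     (\<forall>C\<in>compact_objs \<kappa> D. \<forall>x\<in>carrier (Val M C). Act M C C (Idn D C) x = x) \<and>
     (\<forall>C\<in>compact_objs \<kappa> D. \<forall>C'\<in>compact_objs \<kappa> D. \<forall>C''\<in>compact_objs \<kappa> D.
        \<forall>f\<in>mor D C C'. \<forall>g\<in>mor D C' C''. \<forall>x\<in>carrier (Val M C'').
          Act M C C'' (g \<cdot>\<^bsub>D\<^esub> f) x = Act M C C' f (Act M C' C'' g x)) \<and>
     (\<forall>C\<in>compact_objs \<kappa> D. \<forall>C'\<in>compact_objs \<kappa> D. \<forall>x\<in>carrier (Val M C').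
        linear_map R (Hom D C C') (Val M C) (\<lambda>f. Act M C C' f x))}"

text \<open>\<open>Hom\<^bsub>D\<^sup>c\<^esub>(M, N)\<close>; extensional functions are used so that equality is equality of natural
  transformations.\<close>

definition nat_trans ::
    "('r, 's) ring_scheme \<Rightarrow> 'k rel \<Rightarrow> ('r, 'o, 'm, 'z) lincat_scheme \<Rightarrow>
     ('r, 'o, 'm) dmod \<Rightarrow> ('r, 'o, 'm) dmod \<Rightarrow> ('o \<Rightarrow> 'm \<Rightarrow> 'm) set" where
  "nat_trans R \<kappa> D M N =
     {\<alpha> \<in> (\<Pi>\<^sub>E C\<in>compact_objs \<kappa> D. carrier (Val M C) \<rightarrow>\<^sub>E carrier (Val N C)).
        (\<forall>C\<in>compact_objs \<kappa> D. linear_map R (Val M C) (Val N C) (\<alpha> C)) \<and>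
        (\<forall>C\<in>compact_objs \<kappa> D. \<forall>C'\<in>compact_objs \<kappa> D. \<forall>f\<in>mor D C C'. \<forall>x\<in>carrier (Val M C').
           \<alpha> C (Act M C C' f x) = Act N C C' f (\<alpha> C' x))}"

definition dmod_isomorphic ::
    "('r, 's) ring_scheme \<Rightarrow> 'k rel \<Rightarrow> ('r, 'o, 'm, 'z) lincat_scheme \<Rightarrow>
     ('r, 'o, 'm) dmod \<Rightarrow> ('r, 'o, 'm) dmod \<Rightarrow> bool" where
  "dmod_isomorphic R \<kappa> D M N \<longleftrightarrow>
     (\<exists>\<alpha>\<in>nat_trans R \<kappa> D M N. \<exists>\<beta>\<in>nat_trans R \<kappa> D N M. \<forall>C\<in>compact_objs \<kappa> D.
        (\<forall>x\<in>carrier (Val M C). \<beta> C (\<alpha> C x) = x) \<and> (\<forall>y\<in>carrier (Val N C). \<alpha> C (\<beta> C y) = y))"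

text \<open>Kernels, images and epimorphisms of \<open>D\<^sup>c\<close>-modules are pointwise.\<close>

definition dmod_short_exact ::
    "('r, 's) ring_scheme \<Rightarrow> 'k rel \<Rightarrow> ('r, 'o, 'm, 'z) lincat_scheme \<Rightarrow>
     ('r, 'o, 'm) dmod \<Rightarrow> ('r, 'o, 'm) dmod \<Rightarrow> ('r, 'o, 'm) dmod \<Rightarrow>
     ('o \<Rightarrow> 'm \<Rightarrow> 'm) \<Rightarrow> ('o \<Rightarrow> 'm \<Rightarrow> 'm) \<Rightarrow> bool" where
  "dmod_short_exact R \<kappa> D L M N \<alpha> \<beta> \<longleftrightarrow>
     \<alpha> \<in> nat_trans R \<kappa> D L M \<and> \<beta> \<in> nat_trans R \<kappa> D M N \<and>
     (\<forall>C\<in>compact_objs \<kappa> D. short_exact (Val L C) (Val M C) (Val N C) (\<alpha> C) (\<beta> C))"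

definition dmod_projective ::
    "('r, 's) ring_scheme \<Rightarrow> 'k rel \<Rightarrow> ('r, 'o, 'm, 'z) lincat_scheme \<Rightarrow> ('r, 'o, 'm) dmod \<Rightarrow> bool"
  where
  "dmod_projective R \<kappa> D P \<longleftrightarrow>
     P \<in> dmod_objs R \<kappa> D \<and>
     (\<forall>M\<in>dmod_objs R \<kappa> D. \<forall>N\<in>dmod_objs R \<kappa> D.
        \<forall>\<pi>\<in>nat_trans R \<kappa> D M N. \<forall>\<phi>\<in>nat_trans R \<kappa> D P N.
          (\<forall>C\<in>compact_objs \<kappa> D. \<pi> C ` carrier (Val M C) = carrier (Val N C)) \<longrightarrow>
          (\<exists>\<psi>\<in>nat_trans R \<kappa> D P M. \<forall>C\<in>compact_objs \<kappa> D. \<forall>x\<in>carrier (Val P C).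
             \<pi> C (\<psi> C x) = \<phi> C x))"

definition dmod_pdim_le1 ::
    "('r, 's) ring_scheme \<Rightarrow> 'k rel \<Rightarrow> ('r, 'o, 'm, 'z) lincat_scheme \<Rightarrow> ('r, 'o, 'm) dmod \<Rightarrow> bool"
  where
  "dmod_pdim_le1 R \<kappa> D M \<longleftrightarrow>
     (\<exists>P1 P0 \<alpha> \<beta>. dmod_projective R \<kappa> D P1 \<and> dmod_projective R \<kappa> D P0 \<and>
        dmod_short_exact R \<kappa> D P1 P0 M \<alpha> \<beta>)"

definition yoneda :: "('r, 'o, 'm, 'z) lincat_scheme \<Rightarrow> 'o \<Rightarrow> ('r, 'o, 'm) dmod" where
  "yoneda D X = \<lparr>Val = \<lambda>C. Hom D C X, Act = \<lambda>C C' f x. x \<cdot>\<^bsub>D\<^esub> f\<rparr>"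

text \<open>\<open>yoneda_map \<kappa> D X f\<close> is \<open>\<^bold>y f\<close> for a morphism \<open>f\<close> with source \<open>X\<close>; the target is not needed.\<close>

definition yoneda_map ::
    "'k rel \<Rightarrow> ('r, 'o, 'm, 'z) lincat_scheme \<Rightarrow> 'o \<Rightarrow> 'm \<Rightarrow> ('o \<Rightarrow> 'm \<Rightarrow> 'm)" where
  "yoneda_map \<kappa> D X f = (\<lambda>C\<in>compact_objs \<kappa> D. \<lambda>x\<in>mor D C X. f \<cdot>\<^bsub>D\<^esub> x)"

definition yoneda_surj ::
    "('r, 's) ring_scheme \<Rightarrow> 'k rel \<Rightarrow> ('r, 'o, 'm, 'z) lincat_scheme \<Rightarrow> 'o \<Rightarrow> 'o \<Rightarrow> bool" where
  "yoneda_surj R \<kappa> D X Y \<longleftrightarrow>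
     yoneda_map \<kappa> D X ` mor D X Y = nat_trans R \<kappa> D (yoneda D X) (yoneda D Y)"

definition pure_triangle ::
    "('r, 's) ring_scheme \<Rightarrow> 'k rel \<Rightarrow> ('r, 'o, 'm, 'z) tricat_scheme \<Rightarrow>
     'o \<Rightarrow> 'o \<Rightarrow> 'o \<Rightarrow> 'm \<Rightarrow> 'm \<Rightarrow> 'm \<Rightarrow> bool" where
  "pure_triangle R \<kappa> D X Y Z f g h \<longleftrightarrow>
     Tri D X Y Z f g h \<and>
     dmod_short_exact R \<kappa> D (yoneda D X) (yoneda D Y) (yoneda D Z)
       (yoneda_map \<kappa> D X f) (yoneda_map \<kappa> D Y g)"

definition pure_projective ::
    "('r, 's) ring_scheme \<Rightarrow> 'k rel \<Rightarrow> ('r, 'o, 'm, 'z) tricat_scheme \<Rightarrow> 'o \<Rightarrow> bool" where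
  "pure_projective R \<kappa> D P \<longleftrightarrow>
     P \<in> Ob D \<and>
     (\<forall>X Y Z f g h. pure_triangle R \<kappa> D X Y Z f g h \<longrightarrow>
        short_exact (Hom D P X) (Hom D P Y) (Hom D P Z) (\<lambda>x. f \<cdot>\<^bsub>D\<^esub> x) (\<lambda>y. g \<cdot>\<^bsub>D\<^esub> y))"

definition ppdim_le1 ::
    "('r, 's) ring_scheme \<Rightarrow> 'k rel \<Rightarrow> ('r, 'o, 'm, 'z) tricat_scheme \<Rightarrow> 'o \<Rightarrow> bool" where
  "ppdim_le1 R \<kappa> D X \<longleftrightarrow>
     (\<exists>P1 P0 f g h. pure_projective R \<kappa> D P1 \<and> pure_projective R \<kappa> D P0 \<and>
        pure_triangle R \<kappa> D P1 P0 X f g h)"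

definition ppdim_le1_objs ::
    "('r, 's) ring_scheme \<Rightarrow> 'k rel \<Rightarrow> ('r, 'o, 'm, 'z) tricat_scheme \<Rightarrow> 'o set" where
  "ppdim_le1_objs R \<kappa> D = {X \<in> Ob D. ppdim_le1 R \<kappa> D X}"

definition yoneda_full_on ::
    "('r, 's) ring_scheme \<Rightarrow> 'k rel \<Rightarrow> ('r, 'o, 'm, 'z) lincat_scheme \<Rightarrow> 'o set \<Rightarrow> bool" where
  "yoneda_full_on R \<kappa> D A \<longleftrightarrow> (\<forall>X\<in>A. \<forall>Y\<in>A. yoneda_surj R \<kappa> D X Y)"

definition yoneda_ess_image ::
    "('r, 's) ring_scheme \<Rightarrow> 'k rel \<Rightarrow> ('r, 'o, 'm, 'z) lincat_scheme \<Rightarrow> 'o set \<Rightarrow>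
     ('r, 'o, 'm) dmod set" where
  "yoneda_ess_image R \<kappa> D A =
     {M \<in> dmod_objs R \<kappa> D. \<exists>X\<in>A. dmod_isomorphic R \<kappa> D M (yoneda D X)}"

end

theory Submission
  imports Defs
begin

text \<open>
  Call a map phantom if it vanishes after composition with every map from a compact object. In a
  triangle \<open>K \<rightarrow>f P \<rightarrow>g X \<rightarrow>h K[1]\<close> the long exact sequences show that \<open>\<^bold>yf\<close> is injective iff \<open>\<^bold>yg\<close> is
  surjective iff \<open>h\<close> is phantom (\<open>connecting_zero_if_inj\<close>, \<open>pure_triangleI\<close>,
  \<open>pure_triangle_connecting\<close>); here compactness must be invariant under the shift and its inverse.
  Everything else rests on the behaviour of \<open>\<^bold>y\<close> on \<open>Add(D\<^sup>c)\<close>. A coproduct \<open>S\<close> of compact objects is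
  sent to the direct sum of representables, so by the Yoneda lemma a natural transformation out of
  \<open>\<^bold>yS\<close> is a family of elements (\<open>nat_from_sum\<close>, \<open>nat_from_sum_unique\<close>). Hence for \<open>P\<close> in \<open>Add(D\<^sup>c)\<close>
  the module \<open>\<^bold>yP\<close> is projective, every transformation \<open>\<^bold>yP \<rightarrow> \<^bold>yY\<close> is induced by a map \<open>P \<rightarrow> Y\<close>, and
  only by one: there are no nonzero phantoms out of \<open>P\<close> (\<open>Add_projective\<close>, \<open>Add_realize\<close>,
  \<open>Add_faithful\<close>). Every module is a quotient of some \<open>\<^bold>yS\<close>, so every object \<open>X\<close> has a pure triangle
  \<open>K \<rightarrow> P \<rightarrow> X\<close> with \<open>P\<close> in \<open>Add(D\<^sup>c)\<close> (\<open>pure_cover\<close>), and the pure projectives are exactly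
  \<open>Add(D\<^sup>c)\<close>.

  If \<open>K\<close> is pure projective too, a transformation \<open>\<phi> : \<^bold>yX \<rightarrow> \<^bold>yY\<close> is realised by first realising its
  composite with \<open>\<^bold>yP \<rightarrow> \<^bold>yX\<close> by a map \<open>t : P \<rightarrow> Y\<close>. The composite \<open>t f\<close> is phantom, hence zero because
  it starts in \<open>K\<close>, so \<open>t\<close> factors through \<open>X\<close> (\<open>ppdim_le1_yoneda_surj\<close>).

  Conversely, suppose that all transformations out of \<open>\<^bold>yX\<close> are realised. The point is that every phantom
  \<open>w\<close> out of \<open>K\<close> vanishes (\<open>phantom_out_of_kernel_zero\<close>): the pushout of the triangle along \<open>w\<close> looks
  split to \<open>\<^bold>y\<close>, and fullness turns this splitting into a genuine one, so that \<open>w\<close> extends to \<open>P\<close>;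
  fullness once more, applied to the extension, shows that it factors through \<open>g\<close>, whence \<open>w = 0\<close>.
  Applied to the connecting map of a pure cover of \<open>K\<close>, this makes \<open>K\<close> a retract of its cover.

  For the essential image, a projective module is a retract of some \<open>\<^bold>yS\<close>, and the retract comes from
  \<open>D\<close>, because the idempotent lifts to \<open>S\<close> and idempotents of \<open>D\<close> split by an Eilenberg swindle
  (\<open>idempotent_split\<close>). Thus a projective presentation of a module of projective dimension at most
  one is the image of a map in \<open>Add(D\<^sup>c)\<close>; its cone is the required object
  (\<open>pdim_le1_ess_image\<close>).
\<close>

section \<open>Linear maps\<close>

lemma linear_map_closed: "\<lbrakk>linear_map R M N f; x \<in> carrier M\<rbrakk> \<Longrightarrow> f x \<in> carrier N"
  by (auto simp: linear_map_def)

lemma linear_map_add: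
  "\<lbrakk>linear_map R M N f; x \<in> carrier M; y \<in> carrier M\<rbrakk> \<Longrightarrow> f (x \<oplus>\<^bsub>M\<^esub> y) = f x \<oplus>\<^bsub>N\<^esub> f y"
  by (auto simp: linear_map_def)

lemma linear_map_smult:
  "\<lbrakk>linear_map R M N f; a \<in> carrier R; x \<in> carrier M\<rbrakk> \<Longrightarrow> f (a \<odot>\<^bsub>M\<^esub> x) = a \<odot>\<^bsub>N\<^esub> f x"
  by (auto simp: linear_map_def)

lemma module_abelian_group: "module R M \<Longrightarrow> abelian_group M"
  by (rule module.axioms)

lemma linear_map_zero:
  assumes "module R M" "module R N" "linear_map R M N f"
  shows "f \<zero>\<^bsub>M\<^esub> = \<zero>\<^bsub>N\<^esub>"
proof -
  interpret M: abelian_group M using assms(1) by (rule module_abelian_group)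
  interpret N: abelian_group N using assms(2) by (rule module_abelian_group)
  have c: "f \<zero>\<^bsub>M\<^esub> \<in> carrier N" using assms(3) by (simp add: linear_map_closed)
  have "f \<zero>\<^bsub>M\<^esub> \<oplus>\<^bsub>N\<^esub> f \<zero>\<^bsub>M\<^esub> = f \<zero>\<^bsub>M\<^esub>"
    using linear_map_add[OF assms(3), of "\<zero>\<^bsub>M\<^esub>" "\<zero>\<^bsub>M\<^esub>"] by simp
  then show ?thesis using N.add.l_cancel_one[OF c c] by simp
qed

lemma linear_map_minus:
  assumes "module R M" "module R N" "linear_map R M N f" "x \<in> carrier M"
  shows "f (\<ominus>\<^bsub>M\<^esub> x) = \<ominus>\<^bsub>N\<^esub> f x"
proof -
  interpret M: abelian_group M using assms(1) by (rule module_abelian_group)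
  interpret N: abelian_group N using assms(2) by (rule module_abelian_group)
  have "f (\<ominus>\<^bsub>M\<^esub> x) \<oplus>\<^bsub>N\<^esub> f x = f (\<ominus>\<^bsub>M\<^esub> x \<oplus>\<^bsub>M\<^esub> x)"
    using assms(4) by (intro linear_map_add[OF assms(3), symmetric]) auto
  also have "\<dots> = \<zero>\<^bsub>N\<^esub>"
    using assms(4) linear_map_zero[OF assms(1-3)] by (simp add: M.l_neg)
  finally show ?thesis
    using assms(4) by (intro N.minus_equality[symmetric] linear_map_closed[OF assms(3)]) auto
qed

lemma linear_map_finsum:
  assumes "module R M" "module R N" "linear_map R M N f"
    and "finite F" "\<And>i. i \<in> F \<Longrightarrow> x i \<in> carrier M"
  shows "f (finsum M x F) = finsum N (\<lambda>i. f (x i)) F"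
proof -
  interpret M: abelian_group M using assms(1) by (rule module_abelian_group)
  interpret N: abelian_group N using assms(2) by (rule module_abelian_group)
  from assms(4,5) show ?thesis
  proof (induction F)
    case empty
    then show ?case using linear_map_zero[OF assms(1-3)] by simp
  next
    case (insert i F)
    then have "x \<in> F \<rightarrow> carrier M" "x i \<in> carrier M" by auto
    moreover from this have "(\<lambda>i. f (x i)) \<in> F \<rightarrow> carrier N" "f (x i) \<in> carrier N"
      using assms(3) by (auto intro: linear_map_closed)
    ultimately show ?case
      using insert by (simp add: linear_map_add[OF assms(3)])
  qed
qed

lemma linear_map_comp:
  "\<lbrakk>linear_map R L M f; linear_map R M N g\<rbrakk> \<Longrightarrow> linear_map R L N (\<lambda>x. g (f x))"
  by (auto simp: linear_map_def Pi_iff)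

lemma linear_map_cong:
  assumes "module R M" "linear_map R M N f" "\<And>x. x \<in> carrier M \<Longrightarrow> f x = g x"
  shows "linear_map R M N g"
proof -
  interpret M: module R M by fact
  show ?thesis using assms(2,3) by (auto simp: linear_map_def Pi_iff)
qed

lemma finsum_linear_map:
  assumes "module R M" "module R N"
    and "finite F" "\<And>i. i \<in> F \<Longrightarrow> linear_map R M N (f i)"
  shows "linear_map R M N (\<lambda>x. finsum N (\<lambda>i. f i x) F)"
proof -
  interpret M: module R M by fact
  interpret N: module R N by fact
  have cl: "(\<lambda>i. f i x) \<in> F \<rightarrow> carrier N" if "x \<in> carrier M" for x
    using that assms(4) by (auto intro: linear_map_closed)
  have smul: "finsum N (\<lambda>i. a \<odot>\<^bsub>N\<^esub> f i x) F = a \<odot>\<^bsub>N\<^esub> finsum N (\<lambda>i. f i x) F"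
    if "a \<in> carrier R" "x \<in> carrier M" for a x
  proof -
    have "linear_map R N N (\<lambda>y. a \<odot>\<^bsub>N\<^esub> y)"
      using that by (auto simp: linear_map_def N.smult_r_distr N.smult_assoc1[symmetric] M.m_comm)
    from linear_map_finsum[OF assms(2,2) this assms(3), of "\<lambda>i. f i x"] show ?thesis
      using cl[OF that(2)] by (simp add: Pi_iff)
  qed
  show ?thesis
    unfolding linear_map_def
  proof (intro conjI ballI funcsetI)
    fix x assume "x \<in> carrier M"
    then show "finsum N (\<lambda>i. f i x) F \<in> carrier N" using cl by simp
  next
    fix x y assume xy: "x \<in> carrier M" "y \<in> carrier M"
    have "finsum N (\<lambda>i. f i (x \<oplus>\<^bsub>M\<^esub> y)) F = finsum N (\<lambda>i. f i x \<oplus>\<^bsub>N\<^esub> f i y) F"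
      using xy by (intro N.finsum_cong')
        (auto simp: linear_map_add[OF assms(4)] intro!: N.a_closed linear_map_closed[OF assms(4)])
    then show "finsum N (\<lambda>i. f i (x \<oplus>\<^bsub>M\<^esub> y)) F
        = finsum N (\<lambda>i. f i x) F \<oplus>\<^bsub>N\<^esub> finsum N (\<lambda>i. f i y) F"
      using cl xy by (simp add: N.finsum_addf)
  next
    fix a x assume ax: "a \<in> carrier R" "x \<in> carrier M"
    have "finsum N (\<lambda>i. f i (a \<odot>\<^bsub>M\<^esub> x)) F = finsum N (\<lambda>i. a \<odot>\<^bsub>N\<^esub> f i x) F"
      using ax by (intro N.finsum_cong')
        (auto simp: linear_map_smult[OF assms(4)] intro!: N.smult_closed linear_map_closed[OF assms(4)])
    then show "finsum N (\<lambda>i. f i (a \<odot>\<^bsub>M\<^esub> x)) F = a \<odot>\<^bsub>N\<^esub> finsum N (\<lambda>i. f i x) F"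
      using smul[OF ax] by simp
  qed
qed

section \<open>Linear categories and coproducts\<close>

context linear_category
begin

abbreviation comp :: "'m \<Rightarrow> 'm \<Rightarrow> 'm" (infixl "\<bullet>" 70) where
  "g \<bullet> f \<equiv> g \<cdot>\<^bsub>D\<^esub> f"

abbreviation zer :: "'o \<Rightarrow> 'o \<Rightarrow> 'm" where
  "zer X Y \<equiv> \<zero>\<^bsub>Hom D X Y\<^esub>"

lemma Hom_abelian_group: "\<lbrakk>X \<in> Ob D; Y \<in> Ob D\<rbrakk> \<Longrightarrow> abelian_group (Hom D X Y)"
  by (rule module_abelian_group[OF Hom_module])

lemma zer_closed [simp]: "\<lbrakk>X \<in> Ob D; Y \<in> Ob D\<rbrakk> \<Longrightarrow> zer X Y \<in> mor D X Y"
  using abelian_group.axioms(1)[OF Hom_abelian_group] abelian_monoid.zero_closed by blast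

lemma Cmp_closed:
  "\<lbrakk>f \<in> mor D X Y; g \<in> mor D Y Z; X \<in> Ob D; Y \<in> Ob D; Z \<in> Ob D\<rbrakk> \<Longrightarrow> g \<bullet> f \<in> mor D X Z"
  by (rule linear_map_closed[OF Cmp_linear_left])

text \<open>Associativity and the identity laws with the typing premise first, which lets the simplifier find the other
  objects.\<close>

lemma assoc:
  "\<lbrakk>f \<in> mor D W X; g \<in> mor D X Y; h \<in> mor D Y Z; W \<in> Ob D; X \<in> Ob D; Y \<in> Ob D; Z \<in> Ob D\<rbrakk>
    \<Longrightarrow> h \<bullet> (g \<bullet> f) = h \<bullet> g \<bullet> f"
  by (rule Cmp_assoc)

lemma Idn_Cmp: "\<lbrakk>f \<in> mor D X Y; X \<in> Ob D; Y \<in> Ob D\<rbrakk> \<Longrightarrow> Idn D Y \<bullet> f = f"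
  by (rule Idn_left)

lemma Cmp_Idn: "\<lbrakk>f \<in> mor D X Y; X \<in> Ob D; Y \<in> Ob D\<rbrakk> \<Longrightarrow> f \<bullet> Idn D X = f"
  by (rule Idn_right)

lemma Cmp_zero_left:
  "\<lbrakk>f \<in> mor D X Y; X \<in> Ob D; Y \<in> Ob D; Z \<in> Ob D\<rbrakk> \<Longrightarrow> zer Y Z \<bullet> f = zer X Z"
  by (rule linear_map_zero[OF _ _ Cmp_linear_left]) (auto intro: Hom_module)

lemma Cmp_zero_right:
  "\<lbrakk>g \<in> mor D Y Z; X \<in> Ob D; Y \<in> Ob D; Z \<in> Ob D\<rbrakk> \<Longrightarrow> g \<bullet> zer X Y = zer X Z"
  by (rule linear_map_zero[OF _ _ Cmp_linear_right]) (auto intro: Hom_module)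

lemma Cmp_minus_left:
  "\<lbrakk>f \<in> mor D X Y; g \<in> mor D Y Z; X \<in> Ob D; Y \<in> Ob D; Z \<in> Ob D\<rbrakk>
    \<Longrightarrow> (\<ominus>\<^bsub>Hom D Y Z\<^esub> g) \<bullet> f = \<ominus>\<^bsub>Hom D X Z\<^esub> (g \<bullet> f)"
  by (rule linear_map_minus[OF _ _ Cmp_linear_left]) (auto intro: Hom_module)

lemma Cmp_minus_right:
  "\<lbrakk>f \<in> mor D X Y; g \<in> mor D Y Z; X \<in> Ob D; Y \<in> Ob D; Z \<in> Ob D\<rbrakk>
    \<Longrightarrow> g \<bullet> (\<ominus>\<^bsub>Hom D X Y\<^esub> f) = \<ominus>\<^bsub>Hom D X Z\<^esub> (g \<bullet> f)"
  by (rule linear_map_minus[OF _ _ Cmp_linear_right]) (auto intro: Hom_module)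

lemma minus_closed: "\<lbrakk>f \<in> mor D X Y; X \<in> Ob D; Y \<in> Ob D\<rbrakk> \<Longrightarrow> \<ominus>\<^bsub>Hom D X Y\<^esub> f \<in> mor D X Y"
  using abelian_group.a_inv_closed[OF Hom_abelian_group] by blast

lemma minus_cancel:
  assumes "\<ominus>\<^bsub>Hom D X Y\<^esub> f = \<ominus>\<^bsub>Hom D X Y\<^esub> g" "f \<in> mor D X Y" "g \<in> mor D X Y" "X \<in> Ob D" "Y \<in> Ob D"
  shows "f = g"
  using assms abelian_group.minus_minus[OF Hom_abelian_group[OF assms(4,5)]] by metis

lemma minus_zer: "\<lbrakk>X \<in> Ob D; Y \<in> Ob D\<rbrakk> \<Longrightarrow> \<ominus>\<^bsub>Hom D X Y\<^esub> zer X Y = zer X Y"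
  
proof -
  assume "X \<in> Ob D" "Y \<in> Ob D"
  then interpret H: abelian_group "Hom D X Y" by (rule Hom_abelian_group)
  show ?thesis using H.minus_equality[of "zer X Y" "zer X Y"] by simp
qed

lemma minus_eq_zer:
  assumes "\<ominus>\<^bsub>Hom D X Y\<^esub> f = zer X Y" "f \<in> mor D X Y" "X \<in> Ob D" "Y \<in> Ob D"
  shows "f = zer X Y"
  using assms minus_zer minus_cancel zer_closed by metis

lemma diff_closed:
  "\<lbrakk>f \<in> mor D X Y; g \<in> mor D X Y; X \<in> Ob D; Y \<in> Ob D\<rbrakk> \<Longrightarrow> f \<ominus>\<^bsub>Hom D X Y\<^esub> g \<in> mor D X Y"
  using abelian_group.minus_closed[OF Hom_abelian_group] by blast

lemma diff_self_iff:
  assumes "f \<in> mor D X Y" "g \<in> mor D X Y" "X \<in> Ob D" "Y \<in> Ob D"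
  shows "f \<ominus>\<^bsub>Hom D X Y\<^esub> g = zer X Y \<longleftrightarrow> f = g"
proof -
  interpret H: abelian_group "Hom D X Y" using assms by (intro Hom_abelian_group)
  show ?thesis
    using assms(1,2) H.minus_equality[of f "\<ominus>\<^bsub>Hom D X Y\<^esub> g"] by (auto simp: a_minus_def H.r_neg)
qed

lemma Cmp_diff_left:
  assumes "f \<in> mor D X Y" "g \<in> mor D Y Z" "g' \<in> mor D Y Z" "X \<in> Ob D" "Y \<in> Ob D" "Z \<in> Ob D"
  shows "(g \<ominus>\<^bsub>Hom D Y Z\<^esub> g') \<bullet> f = (g \<bullet> f) \<ominus>\<^bsub>Hom D X Z\<^esub> (g' \<bullet> f)"
proof -
  have lin: "linear_map R (Hom D Y Z) (Hom D X Z) (\<lambda>g. g \<bullet> f)"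
    using assms by (intro Cmp_linear_left)
  show ?thesis
    using assms linear_map_add[OF lin, of g "\<ominus>\<^bsub>Hom D Y Z\<^esub> g'"]
    by (simp add: a_minus_def minus_closed Cmp_minus_left)
qed

lemma Cmp_diff_right:
  assumes "f \<in> mor D X Y" "f' \<in> mor D X Y" "g \<in> mor D Y Z" "X \<in> Ob D" "Y \<in> Ob D" "Z \<in> Ob D"
  shows "g \<bullet> (f \<ominus>\<^bsub>Hom D X Y\<^esub> f') = (g \<bullet> f) \<ominus>\<^bsub>Hom D X Z\<^esub> (g \<bullet> f')"
proof -
  have lin: "linear_map R (Hom D X Y) (Hom D X Z) (\<lambda>f. g \<bullet> f)"
    using assms by (intro Cmp_linear_right)
  show ?thesis
    using assms linear_map_add[OF lin, of f "\<ominus>\<^bsub>Hom D X Y\<^esub> f'"]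
    by (simp add: a_minus_def minus_closed Cmp_minus_right)
qed

lemma Cmp_add_left:
  "\<lbrakk>f \<in> mor D X Y; g \<in> mor D Y Z; g' \<in> mor D Y Z; X \<in> Ob D; Y \<in> Ob D; Z \<in> Ob D\<rbrakk>
    \<Longrightarrow> (g \<oplus>\<^bsub>Hom D Y Z\<^esub> g') \<bullet> f = (g \<bullet> f) \<oplus>\<^bsub>Hom D X Z\<^esub> (g' \<bullet> f)"
  by (rule linear_map_add[OF Cmp_linear_left])

lemma Cmp_add_right:
  "\<lbrakk>f \<in> mor D X Y; f' \<in> mor D X Y; g \<in> mor D Y Z; X \<in> Ob D; Y \<in> Ob D; Z \<in> Ob D\<rbrakk>
    \<Longrightarrow> g \<bullet> (f \<oplus>\<^bsub>Hom D X Y\<^esub> f') = (g \<bullet> f) \<oplus>\<^bsub>Hom D X Z\<^esub> (g \<bullet> f')"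
  by (rule linear_map_add[OF Cmp_linear_right])

lemma zero_obj_Ob: "is_zero_obj D Z \<Longrightarrow> Z \<in> Ob D"
  by (simp add: is_zero_obj_def)

lemma mor_into_zero_obj:
  assumes "is_zero_obj D Z" "X \<in> Ob D" "f \<in> mor D X Z"
  shows "f = zer X Z"
  using assms by (metis Cmp_zero_left Idn_left is_zero_obj_def)

lemma Idn_iso: "X \<in> Ob D \<Longrightarrow> is_iso D X X (Idn D X)"
  unfolding is_iso_def using Idn_closed Idn_left by blast

lemma coproduct_Ob: "is_coproduct D I X S \<iota> \<Longrightarrow> S \<in> Ob D"
  by (simp add: is_coproduct_def)

lemma coproduct_inj: "\<lbrakk>is_coproduct D I X S \<iota>; i \<in> I\<rbrakk> \<Longrightarrow> \<iota> i \<in> mor D (X i) S"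
  by (simp add: is_coproduct_def)

lemma coproduct_map:
  assumes "is_coproduct D I X S \<iota>" "Y \<in> Ob D" "\<And>i. i \<in> I \<Longrightarrow> f i \<in> mor D (X i) Y"
  obtains g where "g \<in> mor D S Y" "\<forall>i\<in>I. g \<bullet> \<iota> i = f i"
  using assms unfolding is_coproduct_def by blast

lemma coproduct_ext:
  assumes "is_coproduct D I X S \<iota>" "Y \<in> Ob D" "\<And>i. i \<in> I \<Longrightarrow> X i \<in> Ob D"
    "g \<in> mor D S Y" "h \<in> mor D S Y" "\<And>i. i \<in> I \<Longrightarrow> g \<bullet> \<iota> i = h \<bullet> \<iota> i"
  shows "g = h"
proof -
  have S: "S \<in> Ob D" using assms(1) by (rule coproduct_Ob)
  have "\<forall>i\<in>I. h \<bullet> \<iota> i \<in> mor D (X i) Y"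
    using assms S by (auto intro: Cmp_closed[OF coproduct_inj])
  then have "\<exists>!k. k \<in> mor D S Y \<and> (\<forall>i\<in>I. k \<bullet> \<iota> i = h \<bullet> \<iota> i)"
    using assms(1,2) unfolding is_coproduct_def by (elim conjE) (drule (1) bspec, drule spec, erule mp)
  then show ?thesis using assms(4-6) by blast
qed

text \<open>The summands of a coproduct are retracts: the universal property, applied to an identity and
  zeros, yields projections.\<close>

lemma coproduct_projections:
  assumes "is_coproduct D I X S \<iota>" "\<And>i. i \<in> I \<Longrightarrow> X i \<in> Ob D"
  obtains p where "\<forall>i\<in>I. p i \<in> mor D S (X i)"
    "\<forall>i\<in>I. \<forall>j\<in>I. p i \<bullet> \<iota> j = (if i = j then Idn D (X i) else zer (X j) (X i))"
proof -
  have "\<exists>q. q \<in> mor D S (X i) \<and> (\<forall>j\<in>I. q \<bullet> \<iota> j = (if i = j then Idn D (X i) else zer (X j) (X i)))"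
    if "i \<in> I" for i
    by (rule coproduct_map[OF assms(1), of "X i" "\<lambda>j. if i = j then Idn D (X i) else zer (X j) (X i)"])
      (use that assms(2) Idn_closed in auto)
  then show ?thesis using that by metis
qed

lemma coproduct_reindex:
  assumes "is_coproduct D I (\<lambda>i. X (e i)) S \<iota>" "bij_betw e I J"
  shows "is_coproduct D J X S (\<lambda>j. \<iota> (the_inv_into I e j))"
proof -
  have inv: "the_inv_into I e (e i) = i" if "i \<in> I" for i
    using assms(2) that by (auto simp: bij_betw_def the_inv_into_f_f)
  have J: "J = e ` I" using assms(2) by (auto simp: bij_betw_def)
  show ?thesis
    unfolding is_coproduct_def J
  proof (intro conjI ballI allI impI)
    show "S \<in> Ob D" using assms(1) by (rule coproduct_Ob)
  next
    fix j assume "j \<in> e ` I"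
    then show "\<iota> (the_inv_into I e j) \<in> mor D (X j) S"
      using coproduct_inj[OF assms(1)] inv by auto
  next
    fix Y f assume Y: "Y \<in> Ob D" and f: "\<forall>i\<in>e ` I. f i \<in> mor D (X i) Y"
    then have "\<forall>i\<in>I. f (e i) \<in> mor D (X (e i)) Y" by blast
    then have "\<exists>!g. g \<in> mor D S Y \<and> (\<forall>i\<in>I. g \<bullet> \<iota> i = f (e i))"
      using assms(1) Y unfolding is_coproduct_def
      by (elim conjE) (drule (1) bspec, drule spec[of _ "\<lambda>i. f (e i)"], erule mp)
    then show "\<exists>!g. g \<in> mor D S Y \<and> (\<forall>i\<in>e ` I. g \<bullet> \<iota> (the_inv_into I e i) = f i)"
      by (simp add: inv)
  qed
qed

lemma projection_finsum:
  assumes "finite F" "F \<subseteq> I" "j \<in> I" "C \<in> Ob D" "S \<in> Ob D"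
    and X: "\<And>i. i \<in> I \<Longrightarrow> X i \<in> Ob D" and inj: "\<And>i. i \<in> I \<Longrightarrow> \<iota> i \<in> mor D (X i) S"
    and p: "p \<in> mor D S (X j)"
      "\<And>i. i \<in> I \<Longrightarrow> p \<bullet> \<iota> i = (if j = i then Idn D (X j) else zer (X i) (X j))"
    and f: "\<And>i. i \<in> F \<Longrightarrow> f i \<in> mor D C (X i)"
  shows "p \<bullet> finsum (Hom D C S) (\<lambda>i. \<iota> i \<bullet> f i) F = (if j \<in> F then f j else zer C (X j))"
proof -
  interpret H: abelian_group "Hom D C (X j)" using assms by (intro Hom_abelian_group)
  have "p \<bullet> finsum (Hom D C S) (\<lambda>i. \<iota> i \<bullet> f i) F = finsum (Hom D C (X j)) (\<lambda>i. p \<bullet> (\<iota> i \<bullet> f i)) F"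
    using assms
    by (intro linear_map_finsum[OF _ _ Cmp_linear_right]) (auto intro!: Hom_module Cmp_closed[OF f inj])
  also have "\<dots> = finsum (Hom D C (X j)) (\<lambda>i. if j = i then f i else zer C (X j)) F"
  proof (intro H.finsum_cong')
    show "(\<lambda>i. if j = i then f i else zer C (X j)) \<in> F \<rightarrow> mor D C (X j)"
      using f assms(3,4) X by auto
    fix i assume i: "i \<in> F"
    then have iI: "i \<in> I" using assms(2) by blast
    have "p \<bullet> (\<iota> i \<bullet> f i) = p \<bullet> \<iota> i \<bullet> f i"
      using assms(3,4,5) X inj[OF iI] f[OF i] p(1) iI by (intro Cmp_assoc) auto
    then show "p \<bullet> (\<iota> i \<bullet> f i) = (if j = i then f i else zer C (X j))"
      using p(2)[OF iI] f[OF i] X iI assms(3,4) by (auto simp: Idn_left intro: Cmp_zero_left)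
  qed simp
  also have "\<dots> = (if j \<in> F then f j else zer C (X j))"
  proof (cases "j \<in> F")
    case True
    then have "finsum (Hom D C (X j)) (\<lambda>i. if j = i then f i else zer C (X j)) F
       = finsum (Hom D C (X j)) (\<lambda>i. if j = i then f j else zer C (X j)) F"
      using f by (intro H.finsum_cong') auto
    then show ?thesis using H.finsum_singleton[OF True assms(1), of "\<lambda>_. f j"] f True by auto
  next
    case False
    then have "finsum (Hom D C (X j)) (\<lambda>i. if j = i then f i else zer C (X j)) F
       = finsum (Hom D C (X j)) (\<lambda>i. zer C (X j)) F"
      by (intro H.finsum_cong') auto
    then show ?thesis using False by (simp add: H.finsum_zero)
  qed
  finally show ?thesis .
qed

end

section \<open>Triangles\<close>

context triangulated_category
begin

abbreviation neg_shift :: "'o \<Rightarrow> 'o \<Rightarrow> 'm \<Rightarrow> 'm" where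
  "neg_shift X Y f \<equiv> \<ominus>\<^bsub>Hom D (ShO D X) (ShO D Y)\<^esub> ShM D f"

lemma shift_mor: "\<lbrakk>f \<in> mor D X Y; X \<in> Ob D; Y \<in> Ob D\<rbrakk> \<Longrightarrow> ShM D f \<in> mor D (ShO D X) (ShO D Y)"
  by (rule linear_map_closed[OF shift_linear])

lemma neg_shift_mor: "\<lbrakk>f \<in> mor D X Y; X \<in> Ob D; Y \<in> Ob D\<rbrakk> \<Longrightarrow> neg_shift X Y f \<in> mor D (ShO D X) (ShO D Y)"
  by (intro minus_closed shift_mor shift_closed)

lemma shift_faithful:
  "\<lbrakk>ShM D f = ShM D g; f \<in> mor D X Y; g \<in> mor D X Y; X \<in> Ob D; Y \<in> Ob D\<rbrakk> \<Longrightarrow> f = g"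
  using shift_fully_faithful[of X Y] inj_onD[of "ShM D" "mor D X Y" f g] by (simp add: bij_betw_def)

lemma shift_comp:
  "\<lbrakk>f \<in> mor D X Y; g \<in> mor D Y Z; X \<in> Ob D; Y \<in> Ob D; Z \<in> Ob D\<rbrakk>
    \<Longrightarrow> ShM D (g \<bullet> f) = ShM D g \<bullet> ShM D f"
  by (rule shift_Cmp)

lemma shift_full:
  assumes "u \<in> mor D (ShO D X) (ShO D Y)" "X \<in> Ob D" "Y \<in> Ob D"
  obtains f where "f \<in> mor D X Y" "ShM D f = u"
proof -
  have "u \<in> ShM D ` mor D X Y"
    using shift_fully_faithful[OF assms(2,3)] assms(1) by (simp add: bij_betw_def)
  then show ?thesis using that by blast
qed

lemma shift_zer: "\<lbrakk>X \<in> Ob D; Y \<in> Ob D\<rbrakk> \<Longrightarrow> ShM D (zer X Y) = zer (ShO D X) (ShO D Y)"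
  by (rule linear_map_zero[OF Hom_module Hom_module shift_linear]) (simp_all add: shift_closed)

lemma shift_minus:
  "\<lbrakk>f \<in> mor D X Y; X \<in> Ob D; Y \<in> Ob D\<rbrakk> \<Longrightarrow> ShM D (\<ominus>\<^bsub>Hom D X Y\<^esub> f) = neg_shift X Y f"
  by (rule linear_map_minus[OF Hom_module Hom_module shift_linear]) (simp_all add: shift_closed)

lemma shift_eq_zer:
  "\<lbrakk>ShM D f = zer (ShO D X) (ShO D Y); f \<in> mor D X Y; X \<in> Ob D; Y \<in> Ob D\<rbrakk> \<Longrightarrow> f = zer X Y"
  using shift_faithful[of f "zer X Y" X Y] by (simp add: shift_zer)

lemma shift_zero_obj: "is_zero_obj D Z \<Longrightarrow> is_zero_obj D (ShO D Z)"
  using shift_Idn[of Z] shift_zer[of Z Z] by (simp add: is_zero_obj_def shift_closed)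

lemma desuspension:
  assumes "Y \<in> Ob D"
  obtains X a b where "X \<in> Ob D" "a \<in> mor D (ShO D X) Y" "b \<in> mor D Y (ShO D X)"
    "b \<bullet> a = Idn D (ShO D X)" "a \<bullet> b = Idn D Y"
  using shift_ess_surj[OF assms] unfolding isomorphic_obj_def is_iso_def by blast

lemma iso_cancel:
  assumes "a \<in> mor D X Y" "b \<in> mor D Y X" "a \<bullet> b = Idn D Y" "f \<in> mor D W Y"
    "W \<in> Ob D" "X \<in> Ob D" "Y \<in> Ob D"
  shows "a \<bullet> (b \<bullet> f) = f"
  using assms Cmp_assoc[of W Y X Y f b a] by (simp add: Idn_Cmp)

lemma Tri_ob: "Tri D X Y Z f g h \<Longrightarrow> X \<in> Ob D \<and> Y \<in> Ob D \<and> Z \<in> Ob D \<and> ShO D X \<in> Ob D \<and> ShO D Y \<in> Ob D"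
  using Tri_typed shift_closed by blast

lemma Tri_rot:
  assumes "Tri D X Y Z f g h"
  shows "Tri D Y Z (ShO D X) g h (neg_shift X Y f)"
  using Tri_rotate[of X Y Z f g h] Tri_typed[OF assms] assms by blast

lemma Tri_rot_twice_iff:
  assumes "X \<in> Ob D" "Y \<in> Ob D" "Z \<in> Ob D" "f \<in> mor D X Y" "g \<in> mor D Y Z" "h \<in> mor D Z (ShO D X)"
  shows "Tri D X Y Z f g h \<longleftrightarrow> Tri D Z (ShO D X) (ShO D Y) h (neg_shift X Y f) (neg_shift Y Z g)"
  using Tri_rotate[OF assms] Tri_rotate[of Y Z "ShO D X" g h "neg_shift X Y f"] assms
  by (simp add: neg_shift_mor shift_closed)

lemma Tri_zero_Idn:
  assumes "is_zero_obj D Z" "A \<in> Ob D"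
  shows "Tri D Z A A (zer Z A) (Idn D A) (zer A (ShO D Z))"
proof -
  note Z = zero_obj_Ob[OF assms(1)]
  have "neg_shift Z A (zer Z A) = zer (ShO D Z) (ShO D A)"
    using Z assms by (simp add: shift_zer minus_zer shift_closed)
  moreover have "Tri D A A (ShO D Z) (Idn D A) (zer A (ShO D Z)) (zer (ShO D Z) (ShO D A))"
    using assms by (intro Tri_Idn shift_zero_obj)
  ultimately show ?thesis
    using Tri_rotate[of Z A A "zer Z A" "Idn D A" "zer A (ShO D Z)"] Z assms
    by (simp add: Idn_closed shift_closed)
qed

text \<open>The fill-in axiom compares a given triangle with triangles on identities: a map from
  \<open>X \<rightarrow> X \<rightarrow> 0\<close> shows that consecutive maps compose to zero, a map from \<open>A \<rightarrow> 0 \<rightarrow> A[1]\<close> into the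
  rotated triangle that \<open>D(A, -)\<close> is exact, a map to \<open>0 \<rightarrow> A \<rightarrow> A\<close> that \<open>D(-, A)\<close> is exact.\<close>

lemma Tri_comp_zer:
  assumes "Tri D X Y Z f g h"
  shows "g \<bullet> f = zer X Z"
proof -
  note T = Tri_typed[OF assms]
  obtain O' where O: "is_zero_obj D O'" using zero_object by blast
  note OO = zero_obj_Ob[OF O]
  have "Tri D X X O' (Idn D X) (zer X O') (zer O' (ShO D X))" using O T by (intro Tri_Idn) auto
  from Tri_morphism[OF this assms, of "Idn D X" f] T obtain c
    where "c \<in> mor D O' Z" "c \<bullet> zer X O' = g \<bullet> f"
    using Idn_closed by (auto simp: Cmp_Idn)
  then show ?thesis using Cmp_zero_right[of c O' Z X] T OO by simp
qed

lemma Tri_lift: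
  assumes "Tri D X Y Z f g h" "A \<in> Ob D" "y \<in> mor D A Y" "g \<bullet> y = zer A Z"
  obtains x where "x \<in> mor D A X" "f \<bullet> x = y"
proof -
  have T: "X \<in> Ob D" "Y \<in> Ob D" "Z \<in> Ob D" "f \<in> mor D X Y" "g \<in> mor D Y Z"
    using Tri_typed[OF assms(1)] by auto
  obtain O' where O: "is_zero_obj D O'" using zero_object by blast
  note OO = zero_obj_Ob[OF O]
  have 1: "Tri D A O' (ShO D A) (zer A O') (zer O' (ShO D A)) (neg_shift A A (Idn D A))"
    using O assms by (intro Tri_rot Tri_Idn)
  have "zer O' Z \<bullet> zer A O' = g \<bullet> y"
    using assms OO T by (simp add: Cmp_zero_right)
  from Tri_morphism[OF 1 Tri_rot[OF assms(1)] assms(3) _ this] OO T obtain c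
    where c: "c \<in> mor D (ShO D A) (ShO D X)"
      "ShM D y \<bullet> neg_shift A A (Idn D A) = neg_shift X Y f \<bullet> c"
    by auto
  obtain x where x: "x \<in> mor D A X" "ShM D x = c" using shift_full[OF c(1)] T assms(2) by blast
  have sy: "ShM D y \<in> mor D (ShO D A) (ShO D Y)" using assms T by (intro shift_mor)
  have sf: "ShM D f \<in> mor D (ShO D X) (ShO D Y)" using T by (intro shift_mor)
  have "\<ominus>\<^bsub>Hom D (ShO D A) (ShO D Y)\<^esub> (ShM D y) = ShM D y \<bullet> neg_shift A A (Idn D A)"
    using sy T assms(2) Cmp_minus_right[of "Idn D (ShO D A)" "ShO D A" "ShO D A" "ShM D y" "ShO D Y"]
    by (simp add: shift_Idn shift_closed Idn_closed Cmp_Idn)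
  also have "\<dots> = \<ominus>\<^bsub>Hom D (ShO D A) (ShO D Y)\<^esub> (ShM D f \<bullet> c)"
    unfolding c(2) using sf c(1) T assms(2) by (intro Cmp_minus_left) (auto intro: shift_closed)
  finally have "ShM D y = ShM D f \<bullet> c"
    using sy sf T assms(2) c(1)
    by (elim minus_cancel) (auto intro: shift_closed intro!: Cmp_closed[of _ _ "ShO D X"])
  then have "ShM D y = ShM D (f \<bullet> x)"
    using x T assms(2) by (simp add: shift_comp)
  then have "y = f \<bullet> x"
    using assms T x by (elim shift_faithful[of _ _ A Y]) (auto intro!: Cmp_closed[of _ _ X])
  then show ?thesis using x that by simp
qed

lemma Tri_extend:
  assumes "Tri D X Y Z f g h" "A \<in> Ob D" "y \<in> mor D Y A" "y \<bullet> f = zer X A"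
  obtains z where "z \<in> mor D Z A" "z \<bullet> g = y"
proof -
  have T: "X \<in> Ob D" "Y \<in> Ob D" "Z \<in> Ob D" "f \<in> mor D X Y"
    using Tri_typed[OF assms(1)] by auto
  obtain O' where O: "is_zero_obj D O'" using zero_object by blast
  note OO = zero_obj_Ob[OF O]
  have "y \<bullet> f = zer O' A \<bullet> zer X O'"
    using assms OO T Cmp_zero_right[of "zer O' A" O' A X] by simp
  from Tri_morphism[OF assms(1) Tri_zero_Idn[OF O assms(2)] _ assms(3) this] OO T
  obtain c where c: "c \<in> mor D Z A" "c \<bullet> g = Idn D A \<bullet> y" by auto
  then show ?thesis using that Idn_Cmp[of y Y A] assms T by auto
qed

lemma Tri_lift2:
  assumes "Tri D X Y Z f g h" "A \<in> Ob D" "z \<in> mor D A Z" "h \<bullet> z = zer A (ShO D X)"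
  obtains y where "y \<in> mor D A Y" "g \<bullet> y = z"
  using Tri_lift[OF Tri_rot[OF assms(1)] assms(2-4)] by blast

lemma neg_comp_zer_iff:
  assumes "f \<in> mor D X Y" "g \<in> mor D Y Z" "X \<in> Ob D" "Y \<in> Ob D" "Z \<in> Ob D"
  shows "(\<ominus>\<^bsub>Hom D Y Z\<^esub> g) \<bullet> f = zer X Z \<longleftrightarrow> g \<bullet> f = zer X Z"
proof -
  have "g \<bullet> f \<in> mor D X Z" using assms by (rule Cmp_closed)
  then show ?thesis
    using assms Cmp_minus_left[of f X Y g Z] minus_eq_zer[of X Z "g \<bullet> f"] by (auto simp: minus_zer)
qed

lemma Tri_lift3:
  assumes "Tri D X Y Z f g h" "A \<in> Ob D" "w \<in> mor D A (ShO D X)" "ShM D f \<bullet> w = zer A (ShO D Y)"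
  obtains z where "z \<in> mor D A Z" "h \<bullet> z = w"
proof -
  have T: "X \<in> Ob D" "Y \<in> Ob D" "f \<in> mor D X Y" "ShO D X \<in> Ob D" "ShO D Y \<in> Ob D"
    using Tri_typed[OF assms(1)] Tri_ob[OF assms(1)] by auto
  then have "neg_shift X Y f \<bullet> w = zer A (ShO D Y)"
    using assms neg_comp_zer_iff[of w A "ShO D X" "ShM D f" "ShO D Y"] by (simp add: shift_mor)
  then show ?thesis using that Tri_lift[OF Tri_rot[OF Tri_rot[OF assms(1)]] assms(2,3)] by blast
qed

lemma Tri_comp_zer2: "Tri D X Y Z f g h \<Longrightarrow> h \<bullet> g = zer Y (ShO D X)"
  using Tri_comp_zer Tri_rot by blast

lemma Tri_comp_zer3:
  assumes "Tri D X Y Z f g h"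
  shows "ShM D f \<bullet> h = zer Z (ShO D Y)"
proof -
  have T: "X \<in> Ob D" "Y \<in> Ob D" "Z \<in> Ob D" "f \<in> mor D X Y" "h \<in> mor D Z (ShO D X)"
      "ShO D X \<in> Ob D" "ShO D Y \<in> Ob D"
    using Tri_typed[OF assms(1)] Tri_ob[OF assms(1)] by auto
  have "neg_shift X Y f \<bullet> h = zer Z (ShO D Y)"
    using Tri_comp_zer[OF Tri_rot[OF Tri_rot[OF assms]]] .
  then show ?thesis
    using T neg_comp_zer_iff[of h Z "ShO D X" "ShM D f" "ShO D Y"] by (simp add: shift_mor)
qed

text \<open>If \<open>w[1] h\<close> vanishes, then \<open>w[1]\<close> extends along \<open>f[1]\<close> up to the sign that rotation introduces,
  and the extension desuspends.\<close>

lemma Tri_extend3: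
  assumes "Tri D X Y Z f g h" "A \<in> Ob D" "w \<in> mor D X A" "ShM D w \<bullet> h = zer Z (ShO D A)"
  obtains v where "v \<in> mor D Y A" "v \<bullet> f = w"
proof -
  have T: "X \<in> Ob D" "Y \<in> Ob D" "Z \<in> Ob D" "f \<in> mor D X Y" "h \<in> mor D Z (ShO D X)"
      "ShO D X \<in> Ob D" "ShO D Y \<in> Ob D" "ShO D A \<in> Ob D"
    using Tri_typed[OF assms(1)] Tri_ob[OF assms(1)] assms(2) shift_closed by auto
  have sf: "ShM D f \<in> mor D (ShO D X) (ShO D Y)" using T by (intro shift_mor)
  have "ShM D w \<in> mor D (ShO D X) (ShO D A)" using assms T by (intro shift_mor)
  then obtain u where u: "u \<in> mor D (ShO D Y) (ShO D A)" "u \<bullet> neg_shift X Y f = ShM D w"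
    using Tri_extend[OF Tri_rot[OF Tri_rot[OF assms(1)]] \<open>ShO D A \<in> Ob D\<close>] assms(4) by blast
  define u' where "u' = \<ominus>\<^bsub>Hom D (ShO D Y) (ShO D A)\<^esub> u"
  have u': "u' \<in> mor D (ShO D Y) (ShO D A)" using u T by (simp add: u'_def minus_closed)
  have "u' \<bullet> ShM D f = ShM D w"
    using u T sf Cmp_minus_right[of "ShM D f" "ShO D X" "ShO D Y" u "ShO D A"]
      Cmp_minus_left[of "ShM D f" "ShO D X" "ShO D Y" u "ShO D A"]
    by (simp add: u'_def)
  moreover obtain v where v: "v \<in> mor D Y A" "ShM D v = u'"
    using shift_full[OF u'] T assms(2) by blast
  ultimately have "ShM D (v \<bullet> f) = ShM D w"
    using T assms(2) by (simp add: shift_comp)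
  then have "v \<bullet> f = w"
    using T assms v by (elim shift_faithful[of _ _ X A]) (auto intro!: Cmp_closed[of _ _ Y])
  then show ?thesis using v that by blast
qed

lemma Tri_third_iso:
  assumes W: "Tri D X Y W f a b" and Z: "Z \<in> Ob D" "c \<in> mor D Z W" "d \<in> mor D W Z"
    "d \<bullet> c = Idn D Z" "c \<bullet> d = Idn D W"
  shows "Tri D X Y Z f (d \<bullet> a) (b \<bullet> c)"
proof -
  have T: "X \<in> Ob D" "Y \<in> Ob D" "W \<in> Ob D" "ShO D X \<in> Ob D"
    "f \<in> mor D X Y" "a \<in> mor D Y W" "b \<in> mor D W (ShO D X)"
    using Tri_typed[OF W] Tri_ob[OF W] by auto
  have da: "d \<bullet> a \<in> mor D Y Z" and bc: "b \<bullet> c \<in> mor D Z (ShO D X)"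
    using Cmp_closed[OF T(6) Z(3)] Cmp_closed[OF Z(2) T(7)] T(1-4) Z(1) by simp_all
  show ?thesis
  proof (rule Tri_iso[OF W T(1,2) Z(1) T(5) da bc Idn_iso[OF T(1)] Idn_iso[OF T(2)]])
    show "is_iso D W Z d" using Z by (auto simp: is_iso_def)
    show "Idn D Y \<bullet> f = f \<bullet> Idn D X" using T by (simp add: Idn_Cmp Cmp_Idn)
    show "d \<bullet> a = d \<bullet> a \<bullet> Idn D Y" using Cmp_Idn[OF da] T Z by simp
    have "b \<bullet> c \<bullet> d = b" using assoc[OF Z(3,2) T(7)] Z T by (simp add: Cmp_Idn)
    then show "ShM D (Idn D X) \<bullet> b = b \<bullet> c \<bullet> d" using T by (simp add: shift_Idn Idn_Cmp)
  qed
qed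

lemma minus_minus:
  "\<lbrakk>f \<in> mor D X Y; X \<in> Ob D; Y \<in> Ob D\<rbrakk> \<Longrightarrow> \<ominus>\<^bsub>Hom D X Y\<^esub> (\<ominus>\<^bsub>Hom D X Y\<^esub> f) = f"
  using abelian_group.minus_minus[OF Hom_abelian_group] by blast

lemma neg_shift_full:
  assumes u: "u \<in> mor D (ShO D X) (ShO D Y)" and X: "X \<in> Ob D" and Y: "Y \<in> Ob D"
  obtains f where "f \<in> mor D X Y" "neg_shift X Y f = u"
proof -
  obtain f where f: "f \<in> mor D X Y" "ShM D f = u" by (rule shift_full[OF u X Y])
  have "neg_shift X Y (\<ominus>\<^bsub>Hom D X Y\<^esub> f) = u"
    using f u X Y by (simp add: shift_minus minus_minus shift_closed)
  with minus_closed[OF f(1) X Y] show ?thesis by (rule that)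
qed

text \<open>Desuspend the cone and rotate back.\<close>

lemma Tri_second:
  assumes Y: "Y \<in> Ob D" and Z: "Z \<in> Ob D" and g: "g \<in> mor D Y Z"
  obtains X f h where "Tri D X Y Z f g h"
proof -
  obtain W a b where W: "Tri D Y Z W g a b" using Tri_cone[OF Y Z g] by blast
  have WO: "W \<in> Ob D" using Tri_typed[OF W] by auto
  obtain X c d where X: "X \<in> Ob D" "c \<in> mor D (ShO D X) W" "d \<in> mor D W (ShO D X)"
    "d \<bullet> c = Idn D (ShO D X)" "c \<bullet> d = Idn D W" by (rule desuspension[OF WO])
  have T: "Tri D Y Z (ShO D X) g (d \<bullet> a) (b \<bullet> c)" using Tri_third_iso[OF W shift_closed[OF X(1)] X(2-5)] .
  note TT = Tri_typed[OF T]
  have bc: "b \<bullet> c \<in> mor D (ShO D X) (ShO D Y)" using TT by blast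
  obtain f where f: "f \<in> mor D X Y" "neg_shift X Y f = b \<bullet> c" by (rule neg_shift_full[OF bc X(1) Y])
  have "Tri D X Y Z f g (d \<bullet> a)"
    using Tri_rotate[OF X(1) Y Z f(1) g, of "d \<bullet> a"] T TT f(2) by simp
  then show ?thesis by (rule that)
qed

lemma Tri_connecting:
  assumes X: "X \<in> Ob D" and Z: "Z \<in> Ob D" and h: "h \<in> mor D Z (ShO D X)"
  obtains Y f g where "Tri D X Y Z f g h"
proof -
  have sX: "ShO D X \<in> Ob D" using X by (rule shift_closed)
  obtain W a b where W: "Tri D Z (ShO D X) W h a b" using Tri_cone[OF Z sX h] by blast
  have WO: "W \<in> Ob D" using Tri_typed[OF W] by auto
  obtain Y c d where Y: "Y \<in> Ob D" "c \<in> mor D (ShO D Y) W" "d \<in> mor D W (ShO D Y)"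
    "d \<bullet> c = Idn D (ShO D Y)" "c \<bullet> d = Idn D W" by (rule desuspension[OF WO])
  have T: "Tri D Z (ShO D X) (ShO D Y) h (d \<bullet> a) (b \<bullet> c)"
    using Tri_third_iso[OF W shift_closed[OF Y(1)] Y(2-5)] .
  note TT = Tri_typed[OF T]
  have da: "d \<bullet> a \<in> mor D (ShO D X) (ShO D Y)" and bc: "b \<bullet> c \<in> mor D (ShO D Y) (ShO D Z)"
    using TT by blast+
  obtain f where f: "f \<in> mor D X Y" "neg_shift X Y f = d \<bullet> a" by (rule neg_shift_full[OF da X Y(1)])
  obtain g where g: "g \<in> mor D Y Z" "neg_shift Y Z g = b \<bullet> c" by (rule neg_shift_full[OF bc Y(1) Z])
  have "Tri D X Y Z f g h"
    using Tri_rot_twice_iff[OF X Y(1) Z f(1) g(1) h] T f(2) g(2) by simp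
  then show ?thesis by (rule that)
qed

text \<open>The fill-in axiom for the middle map, obtained from the one for the third map by rotating
  twice and desuspending.\<close>

lemma Tri_morphism_middle:
  assumes "Tri D X Y Z f g h" "Tri D X' Y' Z' f' g' h'" "a \<in> mor D X X'" "c \<in> mor D Z Z'"
    "ShM D a \<bullet> h = h' \<bullet> c"
  obtains b where "b \<in> mor D Y Y'" "b \<bullet> f = f' \<bullet> a" "g' \<bullet> b = c \<bullet> g"
proof -
  have T: "X \<in> Ob D" "Y \<in> Ob D" "Z \<in> Ob D" "f \<in> mor D X Y" "g \<in> mor D Y Z"
      "ShO D X \<in> Ob D" "ShO D Y \<in> Ob D"  "ShO D Z \<in> Ob D"
    using Tri_typed[OF assms(1)] Tri_ob[OF assms(1)] shift_closed by auto
  have T': "X' \<in> Ob D" "Y' \<in> Ob D" "Z' \<in> Ob D" "f' \<in> mor D X' Y'" "g' \<in> mor D Y' Z'"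
      "ShO D X' \<in> Ob D" "ShO D Y' \<in> Ob D"  "ShO D Z' \<in> Ob D"
    using Tri_typed[OF assms(2)] Tri_ob[OF assms(2)] shift_closed by auto
  have sa: "ShM D a \<in> mor D (ShO D X) (ShO D X')" using T T' assms by (intro shift_mor)
  from Tri_morphism[OF Tri_rot[OF Tri_rot[OF assms(1)]] Tri_rot[OF Tri_rot[OF assms(2)]] assms(4) sa assms(5)]
  obtain u where u: "u \<in> mor D (ShO D Y) (ShO D Y')"
    "u \<bullet> neg_shift X Y f = neg_shift X' Y' f' \<bullet> ShM D a"
    "ShM D c \<bullet> neg_shift Y Z g = neg_shift Y' Z' g' \<bullet> u" by blast
  obtain b where b: "b \<in> mor D Y Y'" "ShM D b = u" using shift_full[OF u(1)] T T' by blast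
  have bf: "b \<bullet> f \<in> mor D X Y'" "f' \<bullet> a \<in> mor D X Y'" "g' \<bullet> b \<in> mor D Y Z'" "c \<bullet> g \<in> mor D Y Z'"
    using T T' b assms by (auto intro: Cmp_closed)
  note sm = shift_mor
  have "\<ominus>\<^bsub>Hom D (ShO D X) (ShO D Y')\<^esub> (ShM D (b \<bullet> f)) = \<ominus>\<^bsub>Hom D (ShO D X) (ShO D Y')\<^esub> (ShM D (f' \<bullet> a))"
    using u(2)[folded b(2)] T T' b(1) assms
      Cmp_minus_right[of "ShM D f" "ShO D X" "ShO D Y" "ShM D b" "ShO D Y'"]
      Cmp_minus_left[of "ShM D a" "ShO D X" "ShO D X'" "ShM D f'" "ShO D Y'"]
    by (simp add: shift_comp sm)
  then have "ShM D (b \<bullet> f) = ShM D (f' \<bullet> a)"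
    using bf T T' by (elim minus_cancel) (auto intro: sm)
  then have 1: "b \<bullet> f = f' \<bullet> a" using bf T T' by (elim shift_faithful)
  have "\<ominus>\<^bsub>Hom D (ShO D Y) (ShO D Z')\<^esub> (ShM D (g' \<bullet> b)) = \<ominus>\<^bsub>Hom D (ShO D Y) (ShO D Z')\<^esub> (ShM D (c \<bullet> g))"
    using u(3)[folded b(2)] T T' b(1) assms
      Cmp_minus_right[of "ShM D g" "ShO D Y" "ShO D Z" "ShM D c" "ShO D Z'"]
      Cmp_minus_left[of "ShM D b" "ShO D Y" "ShO D Y'" "ShM D g'" "ShO D Z'"]
    by (simp add: shift_comp sm)
  then have "ShM D (g' \<bullet> b) = ShM D (c \<bullet> g)"
    using bf T T' by (elim minus_cancel) (auto intro: sm)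
  then have "g' \<bullet> b = c \<bullet> g" using bf T T' by (elim shift_faithful)
  with 1 b that show ?thesis by blast
qed

text \<open>The shift is an equivalence but perhaps not an automorphism, so a cocone on the \<open>X i[1]\<close> is first
  transported to a vertex of the form \<open>Y'[1]\<close>; there it is the shift of a cocone on the \<open>X i\<close>.\<close>

lemma shift_coproduct:
  assumes "is_coproduct D I X S \<iota>" and X: "\<And>i. i \<in> I \<Longrightarrow> X i \<in> Ob D"
  shows "is_coproduct D I (\<lambda>i. ShO D (X i)) (ShO D S) (\<lambda>i. ShM D (\<iota> i))"
  unfolding is_coproduct_def
proof (intro conjI ballI allI impI)
  note S = coproduct_Ob[OF assms(1)]
  note inj = coproduct_inj[OF assms(1)]
  show sS: "ShO D S \<in> Ob D" using S by (rule shift_closed)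
  show si: "ShM D (\<iota> i) \<in> mor D (ShO D (X i)) (ShO D S)" if "i \<in> I" for i
    using S inj[OF that] X[OF that] by (intro shift_mor)
  fix Y f assume Y: "Y \<in> Ob D" and f: "\<forall>i\<in>I. f i \<in> mor D (ShO D (X i)) Y"
  obtain Y' a b where Y': "Y' \<in> Ob D" "a \<in> mor D (ShO D Y') Y" "b \<in> mor D Y (ShO D Y')"
    "b \<bullet> a = Idn D (ShO D Y')" "a \<bullet> b = Idn D Y" using desuspension[OF Y] by blast
  have sY': "ShO D Y' \<in> Ob D" using Y' by (intro shift_closed)
  have sX: "ShO D (X i) \<in> Ob D" if "i \<in> I" for i using X[OF that] by (rule shift_closed)
  have "\<exists>h\<in>mor D (X i) Y'. ShM D h = b \<bullet> f i" if "i \<in> I" for i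
  proof -
    have "b \<bullet> f i \<in> mor D (ShO D (X i)) (ShO D Y')"
      using f that Y Y' sY' sX by (auto intro: Cmp_closed)
    then show ?thesis using shift_full[OF _ X[OF that] Y'(1)] by metis
  qed
  then obtain h where h: "\<And>i. i \<in> I \<Longrightarrow> h i \<in> mor D (X i) Y'" "\<And>i. i \<in> I \<Longrightarrow> ShM D (h i) = b \<bullet> f i"
    by metis
  obtain g where g: "g \<in> mor D S Y'" "\<forall>i\<in>I. g \<bullet> \<iota> i = h i"
    by (rule coproduct_map[OF assms(1) Y'(1) h(1)])
  have sg: "ShM D g \<in> mor D (ShO D S) (ShO D Y')" using g S Y' by (intro shift_mor)
  show "\<exists>!k. k \<in> mor D (ShO D S) Y \<and> (\<forall>i\<in>I. k \<bullet> ShM D (\<iota> i) = f i)"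
  proof (intro ex1I[of _ "a \<bullet> ShM D g"] conjI ballI)
    show "a \<bullet> ShM D g \<in> mor D (ShO D S) Y" using sg Y' sY' sS Y by (auto intro: Cmp_closed)
    fix i assume i: "i \<in> I"
    have "a \<bullet> ShM D g \<bullet> ShM D (\<iota> i) = a \<bullet> (ShM D g \<bullet> ShM D (\<iota> i))"
      using Cmp_assoc[OF sX[OF i] sS sY' Y si[OF i] sg Y'(2)] by simp
    also have "ShM D g \<bullet> ShM D (\<iota> i) = b \<bullet> f i"
      using shift_Cmp[OF X[OF i] S Y'(1) inj[OF i] g(1)] g(2) h(2) i by simp
    also have "a \<bullet> (b \<bullet> f i) = f i"
      using f i Y' sX[OF i] sY' Y by (intro iso_cancel[of a "ShO D Y'" Y b _ "ShO D (X i)"]) auto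
    finally show "a \<bullet> ShM D g \<bullet> ShM D (\<iota> i) = f i" .
  next
    fix k assume k: "k \<in> mor D (ShO D S) Y \<and> (\<forall>i\<in>I. k \<bullet> ShM D (\<iota> i) = f i)"
    have bk: "b \<bullet> k \<in> mor D (ShO D S) (ShO D Y')" using k Y' sY' sS Y by (auto intro: Cmp_closed)
    obtain l where l: "l \<in> mor D S Y'" "ShM D l = b \<bullet> k" using shift_full[OF bk S Y'(1)] by blast
    have "l = g"
    proof (rule coproduct_ext[OF assms(1) Y'(1) X l(1) g(1)])
      fix i assume i: "i \<in> I"
      have "ShM D (l \<bullet> \<iota> i) = b \<bullet> k \<bullet> ShM D (\<iota> i)"
        using shift_Cmp[OF X[OF i] S Y'(1) inj[OF i] l(1)] l(2) by simp
      also have "\<dots> = b \<bullet> f i"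
        using Cmp_assoc[OF sX[OF i] sS Y sY' si[OF i] _ Y'(3), of k] k i by simp
      finally have "ShM D (l \<bullet> \<iota> i) = ShM D (h i)" using h(2)[OF i] by simp
      then have "l \<bullet> \<iota> i = h i"
        using h(1)[OF i] Cmp_closed[OF inj[OF i] l(1) X[OF i] S Y'(1)] X[OF i] Y'(1)
        by (elim shift_faithful)
      then show "l \<bullet> \<iota> i = g \<bullet> \<iota> i" using g(2) i by simp
    qed
    then have "a \<bullet> ShM D g = a \<bullet> (b \<bullet> k)" using l by simp
    also have "\<dots> = k" using k Y' sY' sS Y by (intro iso_cancel[of a "ShO D Y'" Y b _ "ShO D S"]) auto
    finally show "k = a \<bullet> ShM D g" ..
  qed
qed


section \<open>Splitting idempotents\<close>

text \<open>An Eilenberg swindle. Write \<open>W\<close> for the coproduct of countably many copies of \<open>Q\<close>. If \<open>e\<close> were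
  split with image \<open>A\<close> and complementary summand \<open>B\<close>, then \<open>W = (A \<oplus> B) \<oplus> (A \<oplus> B) \<oplus> \<dots>\<close> would have
  the endomorphism \<open>u\<close> that moves every copy of \<open>A\<close> one place further and fixes every copy of \<open>B\<close>; its
  cokernel is the first copy of \<open>A\<close>. In terms of \<open>e\<close> and \<open>1 - e\<close> this endomorphism exists in any case.
  It has a left inverse \<open>v\<close>, so its cone is a split cokernel, and that cone is the image of \<open>e\<close>.\<close>

lemma idempotent_split:
  fixes \<iota> :: "nat \<Rightarrow> 'm"
  assumes W: "is_coproduct D UNIV (\<lambda>_. Q) W \<iota>"
    and Q: "Q \<in> Ob D" and e: "e \<in> mor D Q Q" "e \<bullet> e = e"
  obtains T r s where "T \<in> Ob D" "r \<in> mor D Q T" "s \<in> mor D T Q" "r \<bullet> s = Idn D T" "s \<bullet> r = e"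
proof -
  have WO: "W \<in> Ob D" using W by (rule coproduct_Ob)
  have inj: "\<iota> n \<in> mor D Q W" for n using coproduct_inj[OF W] by blast
  note cl = Cmp_closed
  interpret QQ: abelian_group "Hom D Q Q" using Q by (intro Hom_abelian_group)
  interpret QW: abelian_group "Hom D Q W" using Q WO by (intro Hom_abelian_group)
  define e' where "e' = Idn D Q \<ominus>\<^bsub>Hom D Q Q\<^esub> e"
  have e': "e' \<in> mor D Q Q" using e Q by (simp add: e'_def diff_closed Idn_closed)
  have ee': "e \<bullet> e' = zer Q Q" "e' \<bullet> e = zer Q Q"
    using e Q Idn_closed[OF Q] Cmp_diff_left[of e Q Q "Idn D Q" Q e] Cmp_diff_right[of "Idn D Q" Q Q e e Q]
    by (simp_all add: e'_def Idn_Cmp Cmp_Idn diff_self_iff)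
  have e'e': "e' \<bullet> e' = e'"
  proof -
    have "e' \<bullet> e' = (Idn D Q \<bullet> e') \<ominus>\<^bsub>Hom D Q Q\<^esub> (e \<bullet> e')"
      unfolding e'_def[of] using e Q Idn_closed[OF Q] e' by (subst Cmp_diff_left) (auto simp: e'_def)
    also have "\<dots> = e'" using e' Q ee' by (simp add: Idn_Cmp a_minus_def minus_zer)
    finally show ?thesis .
  qed
  have one: "e' \<oplus>\<^bsub>Hom D Q Q\<^esub> e = Idn D Q"
    using e Idn_closed[OF Q] by (simp add: e'_def a_minus_def QQ.a_assoc QQ.l_neg)
  have ie: "\<iota> n \<bullet> e \<in> mor D Q W" "\<iota> n \<bullet> e' \<in> mor D Q W" for n
    using inj e e' Q WO by (auto intro: cl)
  have rel: "\<iota> n \<bullet> e \<bullet> e = \<iota> n \<bullet> e" "\<iota> n \<bullet> e' \<bullet> e' = \<iota> n \<bullet> e'"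
      "\<iota> n \<bullet> e \<bullet> e' = zer Q W" "\<iota> n \<bullet> e' \<bullet> e = zer Q W" for n
    using inj[of n] e e' Q WO ee' e'e' by (simp_all add: assoc[symmetric] Cmp_zero_right)
  have sum: "\<iota> n \<bullet> e' \<oplus>\<^bsub>Hom D Q W\<^esub> \<iota> n \<bullet> e = \<iota> n" for n
    using Cmp_add_right[of e' Q Q e "\<iota> n" W] one inj[of n] e e' Q WO by (simp add: Cmp_Idn)
  have u_mor: "\<iota> n \<bullet> e' \<oplus>\<^bsub>Hom D Q W\<^esub> \<iota> (Suc n) \<bullet> e \<in> mor D Q W" for n
    using ie by simp
  obtain u where u: "u \<in> mor D W W" "\<And>n. u \<bullet> \<iota> n = \<iota> n \<bullet> e' \<oplus>\<^bsub>Hom D Q W\<^esub> \<iota> (Suc n) \<bullet> e"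
    using coproduct_map[OF W WO, of "\<lambda>n. \<iota> n \<bullet> e' \<oplus>\<^bsub>Hom D Q W\<^esub> \<iota> (Suc n) \<bullet> e"] u_mor by auto
  define v' where "v' n = (case n of 0 \<Rightarrow> \<iota> 0 \<bullet> e' | Suc m \<Rightarrow> \<iota> n \<bullet> e' \<oplus>\<^bsub>Hom D Q W\<^esub> \<iota> m \<bullet> e)" for n
  have "v' n \<in> mor D Q W" for n using ie by (auto simp: v'_def split: nat.split)
  then obtain v where v: "v \<in> mor D W W" "\<And>n. v \<bullet> \<iota> n = v' n"
    using coproduct_map[OF W WO, of v'] by auto
  have v1: "v \<bullet> \<iota> n \<bullet> e' = \<iota> n \<bullet> e'" for n
    using ie e' Q WO by (cases n) (simp_all add: v v'_def rel Cmp_add_left[of e' Q Q _ W])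
  have v2: "v \<bullet> \<iota> (Suc n) \<bullet> e = \<iota> n \<bullet> e" for n
    using ie e Q WO by (simp add: v v'_def rel Cmp_add_left[of e Q Q _ W])
  have vu: "v \<bullet> u = Idn D W"
  proof (rule coproduct_ext[OF W WO])
    fix n
    have "v \<bullet> u \<bullet> \<iota> n = v \<bullet> (\<iota> n \<bullet> e' \<oplus>\<^bsub>Hom D Q W\<^esub> \<iota> (Suc n) \<bullet> e)"
      using assoc[OF inj u(1) v(1)] Q WO u(2) by simp
    also have "\<dots> = v \<bullet> \<iota> n \<bullet> e' \<oplus>\<^bsub>Hom D Q W\<^esub> v \<bullet> \<iota> (Suc n) \<bullet> e"
      using Cmp_add_right[OF ie(2) ie(1) v(1)] assoc[OF e(1) inj v(1)] assoc[OF e' inj v(1)] Q WO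
      by simp
    also have "\<dots> = Idn D W \<bullet> \<iota> n" using inj[of n] Q WO by (simp add: v1 v2 sum Idn_Cmp)
    finally show "v \<bullet> u \<bullet> \<iota> n = Idn D W \<bullet> \<iota> n" .
  qed (use Q u v WO in \<open>auto intro: cl Idn_closed\<close>)
  obtain T c d where tri: "Tri D W W T u c d" using Tri_cone[OF WO WO u(1)] by blast
  have T: "T \<in> Ob D" "c \<in> mor D W T" "d \<in> mor D T (ShO D W)" using Tri_typed[OF tri] by auto
  have sW: "ShO D W \<in> Ob D" using WO by (rule shift_closed)
  have su: "ShM D u \<in> mor D (ShO D W) (ShO D W)" "ShM D v \<in> mor D (ShO D W) (ShO D W)"
    using u v WO by (auto intro: shift_mor)
  \<comment> \<open>Since \<open>u\<close> is a split monomorphism, \<open>d\<close> vanishes and \<open>c\<close> is a split epimorphism.\<close>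
  have "d = ShM D (v \<bullet> u) \<bullet> d" using T WO sW vu by (simp add: shift_Idn Idn_Cmp)
  also have "\<dots> = ShM D v \<bullet> (ShM D u \<bullet> d)"
    using assoc[OF T(3) su] u v T WO sW by (simp add: shift_comp)
  also have "\<dots> = zer T (ShO D W)"
    using Tri_comp_zer3[OF tri] su T sW by (simp add: Cmp_zero_right)
  finally have "d \<bullet> Idn D T = zer T (ShO D W)" using T sW Cmp_Idn[OF T(3)] by simp
  then obtain t0 where t0: "t0 \<in> mor D T W" "c \<bullet> t0 = Idn D T"
    using Tri_lift2[OF tri T(1) Idn_closed[OF T(1)]] by blast
  obtain p' where p': "\<forall>i\<in>UNIV. p' i \<in> mor D W Q"
    "\<forall>i\<in>UNIV. \<forall>j\<in>UNIV. p' i \<bullet> \<iota> j = (if i = j then Idn D Q else zer Q Q)"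
    by (rule coproduct_projections[OF W Q])
  define p where "p = p' 0"
  have p: "p \<in> mor D W Q" "p \<bullet> \<iota> j = (if 0 = j then Idn D Q else zer Q Q)" for j
    using p' by (simp_all add: p_def)
  \<comment> \<open>The projection of \<open>W\<close> onto the first copy of \<open>A\<close>. It kills \<open>u\<close>, so it factors as \<open>t c\<close>.\<close>
  define q where "q = \<iota> 0 \<bullet> e \<bullet> p"
  have q: "q \<in> mor D W W" using ie p Q WO by (auto simp: q_def intro: cl)
  have qi: "q \<bullet> \<iota> n = (if n = 0 then \<iota> 0 \<bullet> e else zer Q W)" for n
    using assoc[OF inj[of n] p(1) ie(1)[of 0]] p(2)[of n] ie[of 0] Q WO
    by (auto simp: q_def Cmp_Idn Cmp_zero_right)
  have qi': "q \<bullet> \<iota> n \<bullet> e' = zer Q W" "q \<bullet> \<iota> (Suc n) \<bullet> e = zer Q W" for n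
    using e e' Q WO by (auto simp: qi rel Cmp_zero_left)
  have "q \<bullet> u = zer W W"
  proof (rule coproduct_ext[OF W WO])
    fix n
    have "q \<bullet> u \<bullet> \<iota> n = q \<bullet> \<iota> n \<bullet> e' \<oplus>\<^bsub>Hom D Q W\<^esub> q \<bullet> \<iota> (Suc n) \<bullet> e"
      using assoc[OF inj u(1) q] Cmp_add_right[OF ie(2) ie(1) q] assoc[OF e(1) inj q] assoc[OF e' inj q]
        Q WO by (simp add: u(2))
    then show "q \<bullet> u \<bullet> \<iota> n = zer W W \<bullet> \<iota> n"
      using inj[of n] Q WO by (simp add: qi' Cmp_zero_left)
  qed (use Q q u WO in \<open>auto intro: cl\<close>)
  then obtain t where t: "t \<in> mor D T W" "t \<bullet> c = q" using Tri_extend[OF tri WO q] by blast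
  interpret QT: abelian_group "Hom D Q T" using Q T by (intro Hom_abelian_group)
  \<comment> \<open>The relation \<open>c u = 0\<close>, split into its two parts by composing with \<open>e\<close> and \<open>1 - e\<close>, says that
    \<open>c\<close> sees only the first copy of \<open>A\<close>, that is, \<open>c q = c\<close>.\<close>
  have ci: "c \<bullet> \<iota> n \<in> mor D Q T" "c \<bullet> \<iota> n \<bullet> e \<in> mor D Q T" "c \<bullet> \<iota> n \<bullet> e' \<in> mor D Q T" for n
    using inj T Q WO e e' by (auto intro: cl)
  have ci_ass: "c \<bullet> \<iota> n \<bullet> e = c \<bullet> (\<iota> n \<bullet> e)" "c \<bullet> \<iota> n \<bullet> e' = c \<bullet> (\<iota> n \<bullet> e')" for n
    using assoc[OF e(1) inj T(2)] assoc[OF e' inj T(2)] Q WO T by simp_all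
  have cu: "c \<bullet> \<iota> n \<bullet> e' \<oplus>\<^bsub>Hom D Q T\<^esub> c \<bullet> \<iota> (Suc n) \<bullet> e = zer Q T" for n
  proof -
    have "c \<bullet> \<iota> n \<bullet> e' \<oplus>\<^bsub>Hom D Q T\<^esub> c \<bullet> \<iota> (Suc n) \<bullet> e = c \<bullet> (u \<bullet> \<iota> n)"
      using Cmp_add_right[OF ie(2) ie(1) T(2)] Q WO T by (simp add: u(2) ci_ass)
    also have "\<dots> = c \<bullet> u \<bullet> \<iota> n" using assoc[OF inj u(1) T(2)] Q WO T by simp
    also have "\<dots> = zer Q T" using Tri_comp_zer[OF tri] inj[of n] Q WO T by (simp add: Cmp_zero_left)
    finally show ?thesis .
  qed
  have rel': "c \<bullet> \<iota> n \<bullet> e \<bullet> e = c \<bullet> \<iota> n \<bullet> e" "c \<bullet> \<iota> n \<bullet> e' \<bullet> e' = c \<bullet> \<iota> n \<bullet> e'"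
      "c \<bullet> \<iota> n \<bullet> e \<bullet> e' = zer Q T" "c \<bullet> \<iota> n \<bullet> e' \<bullet> e = zer Q T" for n
    using ci(1)[of n] e e' Q T ee' e'e' by (simp_all add: assoc[symmetric] Cmp_zero_right)
  have ce': "c \<bullet> \<iota> n \<bullet> e' = zer Q T" for n
  proof -
    have "(c \<bullet> \<iota> n \<bullet> e' \<oplus>\<^bsub>Hom D Q T\<^esub> c \<bullet> \<iota> (Suc n) \<bullet> e) \<bullet> e' = c \<bullet> \<iota> n \<bullet> e'"
      using Cmp_add_left[OF e' ci(3) ci(2)] Q T ci by (simp add: rel')
    then show ?thesis using cu e' Q T by (simp add: Cmp_zero_left)
  qed
  have ce: "c \<bullet> \<iota> (Suc n) \<bullet> e = zer Q T" for n
    using cu[of n] ce'[of n] ci by simp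
  have csum: "c \<bullet> \<iota> n \<bullet> e' \<oplus>\<^bsub>Hom D Q T\<^esub> c \<bullet> \<iota> n \<bullet> e = c \<bullet> \<iota> n" for n
    using Cmp_add_right[OF ie(2)[of n] ie(1)[of n] T(2) Q WO T(1), symmetric] unfolding ci_ass sum .
  have cq: "c \<bullet> q = c"
  proof (rule coproduct_ext[OF W T(1)])
    fix n
    have "c \<bullet> q \<bullet> \<iota> n = c \<bullet> (q \<bullet> \<iota> n)" using assoc[OF inj q T(2)] Q WO T by simp
    also have "\<dots> = c \<bullet> \<iota> n"
      using csum[of n] ce'[of n] ce ci Q WO T
      by (cases n) (auto simp: qi ci_ass[symmetric] Cmp_zero_right)
    finally show "c \<bullet> q \<bullet> \<iota> n = c \<bullet> \<iota> n" .
  qed (use Q q T WO in \<open>auto intro: cl\<close>)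
  have ct: "c \<bullet> t = Idn D T"
  proof -
    have ctm: "c \<bullet> t \<in> mor D T T" using t T WO by (auto intro: cl)
    have "c \<bullet> t = c \<bullet> t \<bullet> (c \<bullet> t0)" using ctm t0 T by (simp add: Cmp_Idn)
    also have "\<dots> = c \<bullet> t \<bullet> c \<bullet> t0" using assoc[OF t0(1) T(2) ctm] T WO by simp
    also have "c \<bullet> t \<bullet> c = c" using assoc[OF T(2) t(1) T(2)] t(2) cq T WO by simp
    finally show ?thesis using t0 by simp
  qed
  define r where "r = c \<bullet> \<iota> 0"
  define s where "s = e \<bullet> p \<bullet> t"
  have ep: "e \<bullet> p \<in> mor D W Q" using e p Q WO by (auto intro: cl)
  have r: "r \<in> mor D Q T" and s: "s \<in> mor D T Q"
    using ci ep t T Q WO by (auto simp: r_def s_def intro: cl)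
  have "r \<bullet> s = c \<bullet> (\<iota> 0 \<bullet> (e \<bullet> p \<bullet> t))"
    using assoc[OF s inj T(2)] T Q WO by (simp add: r_def s_def)
  also have "\<iota> 0 \<bullet> (e \<bullet> p \<bullet> t) = q \<bullet> t"
    using assoc[OF t(1) ep inj] assoc[OF p(1) e(1) inj] T Q WO by (simp add: q_def)
  also have "c \<bullet> (q \<bullet> t) = Idn D T" using assoc[OF t(1) q T(2)] cq ct T Q WO by simp
  finally have rs: "r \<bullet> s = Idn D T" .
  have "s \<bullet> r = e \<bullet> p \<bullet> (t \<bullet> (c \<bullet> \<iota> 0))"
    using assoc[OF r t(1) ep] T Q WO by (simp add: r_def s_def)
  also have "t \<bullet> (c \<bullet> \<iota> 0) = \<iota> 0 \<bullet> e"
    using assoc[OF inj T(2) t(1)] t(2) qi[of 0] T Q WO by simp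
  also have "e \<bullet> p \<bullet> (\<iota> 0 \<bullet> e) = e \<bullet> (p \<bullet> \<iota> 0 \<bullet> e)"
    using assoc[OF ie(1) p(1) e(1)] assoc[OF e(1) inj p(1)] Q WO by simp
  also have "\<dots> = e" using p(2)[of 0] e Q by (simp add: Idn_Cmp)
  finally have "s \<bullet> r = e" .
  with rs r s T that show ?thesis by blast
qed

end

section \<open>Compact objects\<close>

context compactly_generated
begin

abbreviation cpt :: "'o set" where
  "cpt \<equiv> compact_objs \<kappa> D"

text \<open>For an infinite cardinal regularity amounts to stability under sums of fewer than \<open>\<kappa>\<close> sets
  with fewer than \<open>\<kappa>\<close> elements each.\<close>

lemma small_Sigma:
  assumes "small \<kappa> A" "\<And>a. a \<in> A \<Longrightarrow> small \<kappa> (F a)"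
  shows "small \<kappa> (Sigma A F)"
proof -
  have \<kappa>: "Card_order \<kappa>" "natLeq <o \<kappa>" "regularCard \<kappa>" using bound by (auto simp: size_bound_def)
  have "natLeq \<le>o |Field \<kappa>|"
    using ordLeq_ordIso_trans[OF ordLess_imp_ordLeq[OF \<kappa>(2)] ordIso_symmetric[OF card_of_Field_ordIso[OF \<kappa>(1)]]] .
  then have "infinite (Field \<kappa>)" using infinite_iff_natLeq_ordLeq[of "Field \<kappa>"] by simp
  then have "stable \<kappa>" using \<kappa> by (intro regularCard_stable)
  then show ?thesis using assms unfolding small_def by (rule stable_elim)
qed

lemma small_copy:
  assumes "small \<kappa> J"
  obtains I :: "'k set" and e where "small \<kappa> I" "bij_betw e I J"
proof -
  obtain I :: "'k set" where I: "|J| =o |I|" "|I| <o \<kappa>"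
    using assms internalize_card_of_ordLess[of J \<kappa>] unfolding small_def by blast
  then obtain e where "bij_betw e I J"
    using card_of_ordIso[of I J] ordIso_symmetric by blast
  then show ?thesis using I that unfolding small_def by blast
qed

lemma small_coproduct:
  fixes I :: "'k set"
  assumes "small \<kappa> I" "\<And>i. i \<in> I \<Longrightarrow> X i \<in> Ob D"
  obtains S \<iota> where "is_coproduct D I X S \<iota>"
proof -
  have "small \<kappa> I \<and> (\<forall>i\<in>I. X i \<in> Ob D)" using assms by blast
  then have "\<exists>S \<iota>. is_coproduct D I X S \<iota>"
    using coproducts unfolding has_small_coproducts_def by blast
  then show ?thesis using that by blast
qed

text \<open>Countable copowers exist because \<open>\<kappa>\<close> is uncountable.\<close>

lemma idempotents_split:
  assumes Q: "Q \<in> Ob D" and e: "e \<in> mor D Q Q" "e \<bullet> e = e"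
  obtains T r s where "T \<in> Ob D" "r \<in> mor D Q T" "s \<in> mor D T Q" "r \<bullet> s = Idn D T" "s \<bullet> r = e"
proof -
  have "|UNIV :: nat set| <o \<kappa>"
    using bound card_of_nat ordIso_ordLess_trans unfolding size_bound_def by blast
  then obtain I and b :: "'k \<Rightarrow> nat" where I: "small \<kappa> I" "bij_betw b I UNIV"
    using small_copy[of "UNIV :: nat set"] unfolding small_def by blast
  obtain W \<iota> where "is_coproduct D I (\<lambda>i. (\<lambda>_. Q) (b i)) W \<iota>"
    using small_coproduct[OF I(1), of "\<lambda>_. Q"] Q by blast
  from coproduct_reindex[OF this I(2)] show ?thesis
    using idempotent_split[OF _ Q e] that by blast
qed

lemma compact_Ob: "C \<in> cpt \<Longrightarrow> C \<in> Ob D"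
  by (simp add: compact_objs_def)

lemma compact_decomposition:
  fixes I :: "'k set"
  assumes "C \<in> cpt" "small \<kappa> I" "\<And>i. i \<in> I \<Longrightarrow> X i \<in> Ob D" "is_coproduct D I X S \<iota>" "x \<in> mor D C S"
  obtains F f where "finite F" "F \<subseteq> I" "\<forall>i\<in>F. f i \<in> mor D C (X i)"
    "x = finsum (Hom D C S) (\<lambda>i. \<iota> i \<bullet> f i) F"
proof -
  let ?A = "{f \<in> (\<Pi>\<^sub>E i\<in>I. mor D C (X i)). finite {i \<in> I. f i \<noteq> zer C (X i)}}"
  let ?h = "\<lambda>f. finsum (Hom D C S) (\<lambda>i. \<iota> i \<bullet> f i) {i \<in> I. f i \<noteq> zer C (X i)}"
  have "small \<kappa> I \<and> (\<forall>i\<in>I. X i \<in> Ob D) \<and> is_coproduct D I X S \<iota>" using assms by blast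
  then have "bij_betw ?h ?A (mor D C S)"
    using assms(1) unfolding compact_objs_def by blast
  then have "x \<in> ?h ` ?A" using assms(5) by (simp add: bij_betw_def)
  then obtain f where f: "f \<in> ?A" "x = ?h f" by blast
  show ?thesis
  proof (rule that[of "{i \<in> I. f i \<noteq> zer C (X i)}" f])
    show "\<forall>i\<in>{i \<in> I. f i \<noteq> zer C (X i)}. f i \<in> mor D C (X i)"
      using f(1) by (auto simp: PiE_iff)
  qed (use f in auto)
qed

text \<open>The projections recover the components of a finite sum \<open>\<Sum> \<iota> i f i\<close>, which gives the injectivity
  half of compactness for free; what remains is that every map into a coproduct is such a sum.\<close>

lemma compactI:
  assumes C: "C \<in> Ob D"
    and fin: "\<And>(I :: 'k set) X S \<iota> x.
      \<lbrakk>small \<kappa> I; \<And>i. i \<in> I \<Longrightarrow> X i \<in> Ob D; is_coproduct D I X S \<iota>; x \<in> mor D C S\<rbrakk>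
      \<Longrightarrow> \<exists>F f. finite F \<and> F \<subseteq> I \<and> (\<forall>i\<in>F. f i \<in> mor D C (X i)) \<and>
        x = finsum (Hom D C S) (\<lambda>i. \<iota> i \<bullet> f i) F"
  shows "C \<in> cpt"
  unfolding compact_objs_def
proof (intro CollectI conjI allI impI C)
  fix I :: "'k set" and X S \<iota>
  assume "small \<kappa> I \<and> (\<forall>i\<in>I. X i \<in> Ob D) \<and> is_coproduct D I X S \<iota>"
  then have sm: "small \<kappa> I" and X: "\<And>i. i \<in> I \<Longrightarrow> X i \<in> Ob D" and S: "is_coproduct D I X S \<iota>" by auto
  note SO = coproduct_Ob[OF S] and inj = coproduct_inj[OF S]
  interpret CS: abelian_group "Hom D C S" using C SO by (rule Hom_abelian_group)
  obtain p where p: "\<forall>i\<in>I. p i \<in> mor D S (X i)"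
    "\<forall>i\<in>I. \<forall>j\<in>I. p i \<bullet> \<iota> j = (if i = j then Idn D (X i) else zer (X j) (X i))"
    by (rule coproduct_projections[OF S X])
  let ?A = "{f \<in> (\<Pi>\<^sub>E i\<in>I. mor D C (X i)). finite {i \<in> I. f i \<noteq> zer C (X i)}}"
  let ?h = "\<lambda>f. finsum (Hom D C S) (\<lambda>i. \<iota> i \<bullet> f i) {i \<in> I. f i \<noteq> zer C (X i)}"
  have comp: "p j \<bullet> ?h f = f j" if f: "f \<in> ?A" and j: "j \<in> I" for f j
  proof -
    have fc: "f i \<in> mor D C (X i)" if "i \<in> I" for i using f that by (auto simp: PiE_iff)
    have "p j \<bullet> ?h f = (if j \<in> {i \<in> I. f i \<noteq> zer C (X i)} then f j else zer C (X j))"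
      by (rule projection_finsum[OF _ _ j C SO X inj p(1)[rule_format, OF j] p(2)[rule_format, OF j]]) (use f fc in auto)
    then show ?thesis using j by auto
  qed
  show "bij_betw ?h ?A (mor D C S)"
  proof (rule bij_betw_imageI)
    show "inj_on ?h ?A"
    proof (rule inj_onI)
      fix f g assume fg: "f \<in> ?A" "g \<in> ?A" "?h f = ?h g"
      have "f i = g i" if "i \<in> I" for i
        using comp[OF fg(1) that] comp[OF fg(2) that] unfolding fg(3) by simp
      then show "f = g" using fg(1,2) by (auto intro: PiE_ext)
    qed
    show "?h ` ?A = mor D C S"
    proof (intro equalityI subsetI)
      fix x assume "x \<in> ?h ` ?A"
      then obtain f where f: "f \<in> ?A" "x = ?h f" by blast
      have "\<iota> i \<bullet> f i \<in> mor D C S" if "i \<in> I" for i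
        using f that Cmp_closed[of "f i" C "X i" "\<iota> i" S] inj X C SO by (auto simp: PiE_iff)
      then show "x \<in> mor D C S" unfolding f(2) by (intro CS.finsum_closed) auto
    next
      fix x assume x: "x \<in> mor D C S"
      obtain F f where F: "finite F" "F \<subseteq> I" "\<forall>i\<in>F. f i \<in> mor D C (X i)"
        "x = finsum (Hom D C S) (\<lambda>i. \<iota> i \<bullet> f i) F"
        using fin[OF sm X S x] by blast
      define g where "g = (\<lambda>i\<in>I. if i \<in> F then f i else zer C (X i))"
      have sub: "{i \<in> I. g i \<noteq> zer C (X i)} \<subseteq> F" by (auto simp: g_def)
      have gA: "g \<in> ?A"
        using F(3) X C finite_subset[OF sub F(1)] by (auto simp: g_def)
      have m: "\<iota> i \<bullet> f i \<in> mor D C S" if "i \<in> F" for i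
        using that F(2,3) Cmp_closed[of "f i" C "X i" "\<iota> i" S] inj X C SO by auto
      have "?h g = finsum (Hom D C S) (\<lambda>i. \<iota> i \<bullet> f i) F"
      proof (rule CS.add.finprod_mono_neutral_cong_left[OF F(1) sub])
        fix i assume i: "i \<in> F - {i \<in> I. g i \<noteq> zer C (X i)}"
        then have "i \<in> I" "f i = zer C (X i)" using F(2) by (auto simp: g_def)
        then show "\<iota> i \<bullet> f i = zer C S" using Cmp_zero_right[OF inj C X SO] by simp
      next
        fix i assume "i \<in> {i \<in> I. g i \<noteq> zer C (X i)}"
        then show "\<iota> i \<bullet> g i = \<iota> i \<bullet> f i" by (auto simp: g_def split: if_splits)
      qed (use m in auto)
      then show "x \<in> ?h ` ?A" using gA F(4) by (intro image_eqI[of _ _ g]) auto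
    qed
  qed
qed

lemma compact_retract:
  assumes C: "C \<in> cpt" and C': "C' \<in> Ob D" and s: "s \<in> mor D C' C" and r: "r \<in> mor D C C'"
    and rs: "r \<bullet> s = Idn D C'"
  shows "C' \<in> cpt"
proof (rule compactI[OF C'])
  fix I :: "'k set" and X S \<iota> x
  assume I: "small \<kappa> I" and X: "\<And>i. i \<in> I \<Longrightarrow> X i \<in> Ob D" and S: "is_coproduct D I X S \<iota>"
    and x: "x \<in> mor D C' S"
  note CO = compact_Ob[OF C] and SO = coproduct_Ob[OF S] and inj = coproduct_inj[OF S]
  interpret C'S: abelian_group "Hom D C' S" using C' SO by (rule Hom_abelian_group)
  have xr: "x \<bullet> r \<in> mor D C S" using x r CO C' SO by (auto intro: Cmp_closed)
  obtain F f where F: "finite F" "F \<subseteq> I" "\<forall>i\<in>F. f i \<in> mor D C (X i)"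
    "x \<bullet> r = finsum (Hom D C S) (\<lambda>i. \<iota> i \<bullet> f i) F"
    by (rule compact_decomposition[OF C I X S xr])
  have m: "\<iota> i \<bullet> f i \<in> mor D C S" "\<iota> i \<bullet> (f i \<bullet> s) = \<iota> i \<bullet> f i \<bullet> s" "f i \<bullet> s \<in> mor D C' (X i)"
    "\<iota> i \<bullet> (f i \<bullet> s) \<in> mor D C' S" if "i \<in> F" for i
  proof -
    have i: "i \<in> I" "f i \<in> mor D C (X i)" using that F by auto
    show "\<iota> i \<bullet> f i \<in> mor D C S" "\<iota> i \<bullet> (f i \<bullet> s) = \<iota> i \<bullet> f i \<bullet> s"
      using Cmp_closed[OF i(2) inj[OF i(1)]] assoc[OF s i(2) inj[OF i(1)]] CO C' SO X[OF i(1)] by auto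
    show fs: "f i \<bullet> s \<in> mor D C' (X i)" using Cmp_closed[OF s i(2)] CO C' X[OF i(1)] by simp
    show "\<iota> i \<bullet> (f i \<bullet> s) \<in> mor D C' S" using Cmp_closed[OF fs inj[OF i(1)]] C' X[OF i(1)] SO by simp
  qed
  have "x \<bullet> r \<bullet> s = x" using assoc[OF s r x C' CO C' SO] rs Cmp_Idn[OF x C' SO] by simp
  then have "x = x \<bullet> r \<bullet> s" ..
  also have "\<dots> = finsum (Hom D C' S) (\<lambda>i. \<iota> i \<bullet> f i \<bullet> s) F"
    unfolding F(4)
    by (rule linear_map_finsum[OF Hom_module Hom_module Cmp_linear_left]) (use s CO C' SO F(1) m in auto)
  also have "\<dots> = finsum (Hom D C' S) (\<lambda>i. \<iota> i \<bullet> (f i \<bullet> s)) F"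
    using m by (intro C'S.finsum_cong') auto
  finally show "\<exists>F f. finite F \<and> F \<subseteq> I \<and> (\<forall>i\<in>F. f i \<in> mor D C' (X i)) \<and>
      x = finsum (Hom D C' S) (\<lambda>i. \<iota> i \<bullet> f i) F"
    using F(1,2) m(3) by (intro exI[of _ F] exI[of _ "\<lambda>i. f i \<bullet> s"]) auto
qed

text \<open>A coproduct \<open>S\<close> of the \<open>X i\<close> is identified, via desuspensions \<open>X' i\<close> of the \<open>X i\<close>, with the
  shift of a coproduct of the \<open>X' i\<close>; maps \<open>C[1] \<rightarrow> S\<close> then are shifts of maps out of \<open>C\<close>.\<close>

lemma compact_shift:
  assumes C: "C \<in> cpt"
  shows "ShO D C \<in> cpt"
proof (rule compactI)
  note CO = compact_Ob[OF C]
  show sC: "ShO D C \<in> Ob D" using CO by (rule shift_closed)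
  fix I :: "'k set" and X S \<iota> x
  assume I: "small \<kappa> I" and X: "\<And>i. i \<in> I \<Longrightarrow> X i \<in> Ob D" and S: "is_coproduct D I X S \<iota>"
    and x: "x \<in> mor D (ShO D C) S"
  note SO = coproduct_Ob[OF S] and inj = coproduct_inj[OF S]
  have "\<exists>X' a b. X' \<in> Ob D \<and> a \<in> mor D (ShO D X') (X i) \<and> b \<in> mor D (X i) (ShO D X') \<and>
      b \<bullet> a = Idn D (ShO D X') \<and> a \<bullet> b = Idn D (X i)" if "i \<in> I" for i
    by (rule desuspension[OF X[OF that]]) blast
  then obtain X' a b where X': "\<And>i. i \<in> I \<Longrightarrow> X' i \<in> Ob D"
      "\<And>i. i \<in> I \<Longrightarrow> a i \<in> mor D (ShO D (X' i)) (X i)" "\<And>i. i \<in> I \<Longrightarrow> b i \<in> mor D (X i) (ShO D (X' i))"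
      "\<And>i. i \<in> I \<Longrightarrow> a i \<bullet> b i = Idn D (X i)"
    by metis
  have sX': "ShO D (X' i) \<in> Ob D" if "i \<in> I" for i using X'(1)[OF that] by (rule shift_closed)
  obtain S' \<iota>' where S': "is_coproduct D I X' S' \<iota>'" by (rule small_coproduct[where X = X', OF I X'(1)])
  note S'O = coproduct_Ob[OF S'] and inj' = coproduct_inj[OF S']
  have sS': "ShO D S' \<in> Ob D" using S'O by (rule shift_closed)
  have sinj: "ShM D (\<iota>' i) \<in> mor D (ShO D (X' i)) (ShO D S')" if "i \<in> I" for i
    using inj'[OF that] X'(1)[OF that] S'O by (rule shift_mor)
  have ia: "\<iota> i \<bullet> a i \<in> mor D (ShO D (X' i)) S" if "i \<in> I" for i
    using Cmp_closed[OF X'(2)[OF that] inj[OF that]] sX'[OF that] X[OF that] SO by simp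
  obtain v where v: "v \<in> mor D (ShO D S') S" "\<forall>i\<in>I. v \<bullet> ShM D (\<iota>' i) = \<iota> i \<bullet> a i"
    by (rule coproduct_map[OF shift_coproduct[OF S' X'(1)] SO ia])
  have ib: "ShM D (\<iota>' i) \<bullet> b i \<in> mor D (X i) (ShO D S')" if "i \<in> I" for i
    using Cmp_closed[OF X'(3)[OF that] sinj[OF that]] sX'[OF that] X[OF that] sS' by simp
  obtain u where u: "u \<in> mor D S (ShO D S')" "\<forall>i\<in>I. u \<bullet> \<iota> i = ShM D (\<iota>' i) \<bullet> b i"
    by (rule coproduct_map[OF S sS' ib])
  \<comment> \<open>\<open>u\<close> and \<open>v\<close> are mutually inverse; this half is the one that expresses \<open>x\<close> by \<open>u x\<close>.\<close>
  have "v \<bullet> u = Idn D S"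
  proof (rule coproduct_ext[OF S SO X])
    fix i assume i: "i \<in> I"
    have "v \<bullet> u \<bullet> \<iota> i = v \<bullet> (ShM D (\<iota>' i) \<bullet> b i)"
      using assoc[OF inj[OF i] u(1) v(1)] X[OF i] SO sS' u(2)[rule_format, OF i] by simp
    also have "\<dots> = \<iota> i \<bullet> a i \<bullet> b i"
      using assoc[OF X'(3)[OF i] sinj[OF i] v(1)] X[OF i] SO sS' sX'[OF i] v(2)[rule_format, OF i] by simp
    also have "\<dots> = Idn D S \<bullet> \<iota> i"
      using assoc[OF X'(3)[OF i] X'(2)[OF i] inj[OF i]] X[OF i] SO sX'[OF i] X'(4)[OF i] inj[OF i]
      by (simp add: Cmp_Idn Idn_Cmp)
    finally show "v \<bullet> u \<bullet> \<iota> i = Idn D S \<bullet> \<iota> i" .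
  qed (use u v SO sS' in \<open>auto intro: Cmp_closed Idn_closed\<close>)
  then have x_eq: "x = v \<bullet> (u \<bullet> x)"
    using assoc[OF x u(1) v(1)] x sC SO sS' by (simp add: Idn_Cmp)
  have "u \<bullet> x \<in> mor D (ShO D C) (ShO D S')" using x u sC SO sS' by (auto intro: Cmp_closed)
  then obtain z where z: "z \<in> mor D C S'" "ShM D z = u \<bullet> x" by (rule shift_full[OF _ CO S'O])
  obtain F f where F: "finite F" "F \<subseteq> I" "\<forall>i\<in>F. f i \<in> mor D C (X' i)"
    "z = finsum (Hom D C S') (\<lambda>i. \<iota>' i \<bullet> f i) F"
    by (rule compact_decomposition[OF C I X'(1) S' z(1)])
  interpret CS: abelian_group "Hom D (ShO D C) S" using sC SO by (rule Hom_abelian_group)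
  have m: "\<iota>' i \<bullet> f i \<in> mor D C S'" "v \<bullet> ShM D (\<iota>' i \<bullet> f i) = \<iota> i \<bullet> (a i \<bullet> ShM D (f i))"
    "a i \<bullet> ShM D (f i) \<in> mor D (ShO D C) (X i)"
    "\<iota> i \<bullet> (a i \<bullet> ShM D (f i)) \<in> mor D (ShO D C) S" if "i \<in> F" for i
  proof -
    have i: "i \<in> I" "f i \<in> mor D C (X' i)" using that F by auto
    note Xi = X[OF i(1)] X'(1)[OF i(1)] sX'[OF i(1)]
    have sf: "ShM D (f i) \<in> mor D (ShO D C) (ShO D (X' i))" using i(2) CO Xi(2) by (rule shift_mor)
    show "\<iota>' i \<bullet> f i \<in> mor D C S'" using Cmp_closed[OF i(2) inj'[OF i(1)]] CO S'O Xi by simp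
    show af: "a i \<bullet> ShM D (f i) \<in> mor D (ShO D C) (X i)"
      using Cmp_closed[OF sf X'(2)[OF i(1)]] sC Xi by simp
    show "\<iota> i \<bullet> (a i \<bullet> ShM D (f i)) \<in> mor D (ShO D C) S"
      using Cmp_closed[OF af inj[OF i(1)]] sC SO Xi by simp
    have "v \<bullet> ShM D (\<iota>' i \<bullet> f i) = v \<bullet> (ShM D (\<iota>' i) \<bullet> ShM D (f i))"
      using shift_comp[OF i(2) inj'[OF i(1)]] CO S'O Xi by simp
    also have "\<dots> = \<iota> i \<bullet> a i \<bullet> ShM D (f i)"
      using assoc[OF sf sinj[OF i(1)] v(1)] v(2)[rule_format, OF i(1)] sC SO sS' Xi by simp
    also have "\<dots> = \<iota> i \<bullet> (a i \<bullet> ShM D (f i))"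
      using assoc[OF sf X'(2)[OF i(1)] inj[OF i(1)]] sC SO Xi by simp
    finally show "v \<bullet> ShM D (\<iota>' i \<bullet> f i) = \<iota> i \<bullet> (a i \<bullet> ShM D (f i))" .
  qed
  have lin: "linear_map R (Hom D C S') (Hom D (ShO D C) S) (\<lambda>y. v \<bullet> ShM D y)"
    using CO S'O sC sS' SO v by (intro linear_map_comp[OF shift_linear Cmp_linear_right])
  have "x = v \<bullet> ShM D z" using x_eq z by simp
  also have "\<dots> = finsum (Hom D (ShO D C) S) (\<lambda>i. v \<bullet> ShM D (\<iota>' i \<bullet> f i)) F"
    unfolding F(4) using CO S'O sC SO
    by (rule linear_map_finsum[OF Hom_module Hom_module lin F(1) m(1)])
  also have "\<dots> = finsum (Hom D (ShO D C) S) (\<lambda>i. \<iota> i \<bullet> (a i \<bullet> ShM D (f i))) F"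
    using m by (intro CS.finsum_cong') auto
  finally show "\<exists>F f. finite F \<and> F \<subseteq> I \<and> (\<forall>i\<in>F. f i \<in> mor D (ShO D C) (X i)) \<and>
      x = finsum (Hom D (ShO D C) S) (\<lambda>i. \<iota> i \<bullet> f i) F"
    using F(1,2) m(3) by (intro exI[of _ F] exI[of _ "\<lambda>i. a i \<bullet> ShM D (f i)"]) auto
qed

text \<open>Here coproducts of the \<open>X i\<close> are shifted and finite sums are desuspended, the shift being additive
  and fully faithful.\<close>

lemma compact_unshift:
  assumes C: "C \<in> Ob D" and sC: "ShO D C \<in> cpt"
  shows "C \<in> cpt"
proof (rule compactI[OF C])
  fix I :: "'k set" and X S \<iota> x
  assume I: "small \<kappa> I" and X: "\<And>i. i \<in> I \<Longrightarrow> X i \<in> Ob D" and S: "is_coproduct D I X S \<iota>"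
    and x: "x \<in> mor D C S"
  note SO = coproduct_Ob[OF S] and inj = coproduct_inj[OF S] and sCO = compact_Ob[OF sC]
  have sX: "ShO D (X i) \<in> Ob D" if "i \<in> I" for i using X[OF that] by (rule shift_closed)
  have sS: "ShO D S \<in> Ob D" using SO by (rule shift_closed)
  have sx: "ShM D x \<in> mor D (ShO D C) (ShO D S)" using x C SO by (rule shift_mor)
  obtain F g where F: "finite F" "F \<subseteq> I" "\<forall>i\<in>F. g i \<in> mor D (ShO D C) (ShO D (X i))"
    "ShM D x = finsum (Hom D (ShO D C) (ShO D S)) (\<lambda>i. ShM D (\<iota> i) \<bullet> g i) F"
    by (rule compact_decomposition[OF sC I sX shift_coproduct[OF S X] sx])
  have "\<exists>f\<in>mor D C (X i). ShM D f = g i" if "i \<in> F" for i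
    using shift_full[OF F(3)[rule_format, OF that] C X] F(2) that by blast
  then obtain f where f: "\<forall>i\<in>F. f i \<in> mor D C (X i)" "\<And>i. i \<in> F \<Longrightarrow> ShM D (f i) = g i" by metis
  interpret CS: abelian_group "Hom D C S" using C SO by (rule Hom_abelian_group)
  interpret sCS: abelian_group "Hom D (ShO D C) (ShO D S)" using sCO sS by (rule Hom_abelian_group)
  have m: "\<iota> i \<bullet> f i \<in> mor D C S" "ShM D (\<iota> i \<bullet> f i) = ShM D (\<iota> i) \<bullet> g i"
    "ShM D (\<iota> i \<bullet> f i) \<in> mor D (ShO D C) (ShO D S)" if "i \<in> F" for i
  proof -
    have i: "i \<in> I" using that F by auto
    show 1: "\<iota> i \<bullet> f i \<in> mor D C S" using Cmp_closed[OF f(1)[rule_format, OF that] inj[OF i] C X[OF i] SO] .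
    show "ShM D (\<iota> i \<bullet> f i) = ShM D (\<iota> i) \<bullet> g i"
      using shift_comp[OF f(1)[rule_format, OF that] inj[OF i] C X[OF i] SO] f(2)[OF that] by simp
    show "ShM D (\<iota> i \<bullet> f i) \<in> mor D (ShO D C) (ShO D S)" using 1 C SO by (rule shift_mor)
  qed
  have "ShM D (finsum (Hom D C S) (\<lambda>i. \<iota> i \<bullet> f i) F)
      = finsum (Hom D (ShO D C) (ShO D S)) (\<lambda>i. ShM D (\<iota> i \<bullet> f i)) F"
    by (rule linear_map_finsum[OF Hom_module[OF C SO] Hom_module[OF sCO sS] shift_linear[OF C SO] F(1) m(1)])
  also have "\<dots> = ShM D x" unfolding F(4) using m by (intro sCS.finsum_cong') auto
  finally have "ShM D x = ShM D (finsum (Hom D C S) (\<lambda>i. \<iota> i \<bullet> f i) F)" ..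
  then have "x = finsum (Hom D C S) (\<lambda>i. \<iota> i \<bullet> f i) F"
    using x m(1) C SO by (elim shift_faithful[of _ _ C S]) (auto intro: CS.finsum_closed)
  then show "\<exists>F f. finite F \<and> F \<subseteq> I \<and> (\<forall>i\<in>F. f i \<in> mor D C (X i)) \<and>
      x = finsum (Hom D C S) (\<lambda>i. \<iota> i \<bullet> f i) F"
    using F(1,2) f(1) by (intro exI[of _ F] exI[of _ f]) auto
qed

lemma compact_desuspension:
  assumes C: "C \<in> cpt"
  obtains C' a b where "C' \<in> cpt" "a \<in> mor D (ShO D C') C" "b \<in> mor D C (ShO D C')"
    "b \<bullet> a = Idn D (ShO D C')" "a \<bullet> b = Idn D C"
proof -
  obtain C' a b where C': "C' \<in> Ob D" "a \<in> mor D (ShO D C') C" "b \<in> mor D C (ShO D C')"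
    "b \<bullet> a = Idn D (ShO D C')" "a \<bullet> b = Idn D C" by (rule desuspension[OF compact_Ob[OF C]])
  have "C' \<in> cpt"
    by (rule compact_unshift[OF C'(1) compact_retract[OF C shift_closed[OF C'(1)] C'(2,3,4)]])
  then show ?thesis using C'(2-5) by (rule that)
qed

end

section \<open>Modules over the compact objects\<close>

context compactly_generated
begin

abbreviation dmods :: "('r, 'o, 'm) dmod set" where
  "dmods \<equiv> dmod_objs R \<kappa> D"

abbreviation Nat :: "('r, 'o, 'm) dmod \<Rightarrow> ('r, 'o, 'm) dmod \<Rightarrow> ('o \<Rightarrow> 'm \<Rightarrow> 'm) set" where
  "Nat \<equiv> nat_trans R \<kappa> D"

lemma dmod_module: "\<lbrakk>M \<in> dmods; C \<in> cpt\<rbrakk> \<Longrightarrow> module R (Val M C)"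
  by (simp add: dmod_objs_def)

lemma dmod_small: "\<lbrakk>M \<in> dmods; C \<in> cpt\<rbrakk> \<Longrightarrow> small \<kappa> (carrier (Val M C))"
  by (simp add: dmod_objs_def)

lemma dmod_act_linear:
  "\<lbrakk>M \<in> dmods; C \<in> cpt; C' \<in> cpt; f \<in> mor D C C'\<rbrakk> \<Longrightarrow> linear_map R (Val M C') (Val M C) (Act M C C' f)"
  by (simp add: dmod_objs_def)

lemma dmod_act_Idn: "\<lbrakk>M \<in> dmods; C \<in> cpt; x \<in> carrier (Val M C)\<rbrakk> \<Longrightarrow> Act M C C (Idn D C) x = x"
  by (simp add: dmod_objs_def)

lemma dmod_act_comp:
  "\<lbrakk>M \<in> dmods; C \<in> cpt; C' \<in> cpt; C'' \<in> cpt; f \<in> mor D C C'; g \<in> mor D C' C''; x \<in> carrier (Val M C'')\<rbrakk>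
    \<Longrightarrow> Act M C C'' (g \<bullet> f) x = Act M C C' f (Act M C' C'' g x)"
  by (simp add: dmod_objs_def)

lemma dmod_act_linear_left:
  "\<lbrakk>M \<in> dmods; C \<in> cpt; C' \<in> cpt; x \<in> carrier (Val M C')\<rbrakk>
    \<Longrightarrow> linear_map R (Hom D C C') (Val M C) (\<lambda>f. Act M C C' f x)"
  by (simp add: dmod_objs_def)

lemma dmod_act_closed:
  "\<lbrakk>M \<in> dmods; C \<in> cpt; C' \<in> cpt; f \<in> mor D C C'; x \<in> carrier (Val M C')\<rbrakk>
    \<Longrightarrow> Act M C C' f x \<in> carrier (Val M C)"
  by (rule linear_map_closed[OF dmod_act_linear])

lemma yoneda_simps [simp]: "Val (yoneda D X) C = Hom D C X" "Act (yoneda D X) C C' f x = x \<bullet> f"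
  by (simp_all add: yoneda_def)

lemma yoneda_dmod:
  assumes X: "X \<in> Ob D"
  shows "yoneda D X \<in> dmods"
  unfolding dmod_objs_def
proof (intro CollectI conjI ballI)
  fix C assume C: "C \<in> cpt"
  note CO = compact_Ob[OF C]
  show "module R (Val (yoneda D X) C)" using CO X by (simp add: Hom_module)
  show "small \<kappa> (carrier (Val (yoneda D X) C))" using C X by (simp add: compacts_locally_small)
  show "Act (yoneda D X) C C (Idn D C) x = x" if "x \<in> carrier (Val (yoneda D X) C)" for x
    using that CO X by (simp add: Cmp_Idn)
  fix C' assume C': "C' \<in> cpt"
  note C'O = compact_Ob[OF C']
  show "linear_map R (Val (yoneda D X) C') (Val (yoneda D X) C) (Act (yoneda D X) C C' f)"
    if "f \<in> mor D C C'" for f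
    using Cmp_linear_left[OF CO C'O X that] by (simp add: yoneda_def)
  show "linear_map R (Hom D C C') (Val (yoneda D X) C) (\<lambda>f. Act (yoneda D X) C C' f x)"
    if "x \<in> carrier (Val (yoneda D X) C')" for x
    using Cmp_linear_right[OF CO C'O X, of x] that by simp
  fix C'' f g x
  assume "C'' \<in> cpt" and f: "f \<in> mor D C C'" and g: "g \<in> mor D C' C''"
    and "x \<in> carrier (Val (yoneda D X) C'')"
  then have "C'' \<in> Ob D" "x \<in> mor D C'' X" by (simp_all add: compact_Ob)
  then show "Act (yoneda D X) C C'' (g \<bullet> f) x = Act (yoneda D X) C C' f (Act (yoneda D X) C' C'' g x)"
    using assoc[OF f g] CO C'O X by simp
qed

lemma nat_linear: "\<lbrakk>\<alpha> \<in> Nat M N; C \<in> cpt\<rbrakk> \<Longrightarrow> linear_map R (Val M C) (Val N C) (\<alpha> C)"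
  by (simp add: nat_trans_def)

lemma nat_closed: "\<lbrakk>\<alpha> \<in> Nat M N; C \<in> cpt; x \<in> carrier (Val M C)\<rbrakk> \<Longrightarrow> \<alpha> C x \<in> carrier (Val N C)"
  by (rule linear_map_closed[OF nat_linear])

lemma nat_natural:
  "\<lbrakk>\<alpha> \<in> Nat M N; C \<in> cpt; C' \<in> cpt; f \<in> mor D C C'; x \<in> carrier (Val M C')\<rbrakk>
    \<Longrightarrow> \<alpha> C (Act M C C' f x) = Act N C C' f (\<alpha> C' x)"
  by (simp add: nat_trans_def)

lemma nat_ext:
  assumes "\<alpha> \<in> Nat M N" "\<beta> \<in> Nat M N" "\<And>C x. \<lbrakk>C \<in> cpt; x \<in> carrier (Val M C)\<rbrakk> \<Longrightarrow> \<alpha> C x = \<beta> C x"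
  shows "\<alpha> = \<beta>"
proof -
  have P: "\<alpha> \<in> (\<Pi>\<^sub>E C\<in>cpt. carrier (Val M C) \<rightarrow>\<^sub>E carrier (Val N C))"
    "\<beta> \<in> (\<Pi>\<^sub>E C\<in>cpt. carrier (Val M C) \<rightarrow>\<^sub>E carrier (Val N C))"
    using assms(1,2) by (auto simp: nat_trans_def)
  show ?thesis
  proof (rule PiE_ext[OF P])
    fix C assume C: "C \<in> cpt"
    show "\<alpha> C = \<beta> C" by (rule PiE_ext[OF PiE_mem[OF P(1) C] PiE_mem[OF P(2) C]]) (rule assms(3)[OF C])
  qed
qed

lemma nat_exists:
  assumes M: "M \<in> dmods"
    and lin: "\<And>C. C \<in> cpt \<Longrightarrow> linear_map R (Val M C) (Val N C) (\<alpha> C)"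
    and nat: "\<And>C C' f x. \<lbrakk>C \<in> cpt; C' \<in> cpt; f \<in> mor D C C'; x \<in> carrier (Val M C')\<rbrakk>
      \<Longrightarrow> \<alpha> C (Act M C C' f x) = Act N C C' f (\<alpha> C' x)"
  obtains \<beta> where "\<beta> \<in> Nat M N" "\<forall>C\<in>cpt. \<forall>x\<in>carrier (Val M C). \<beta> C x = \<alpha> C x"
proof -
  define \<beta> where "\<beta> = (\<lambda>C\<in>cpt. \<lambda>x\<in>carrier (Val M C). \<alpha> C x)"
  have app: "\<beta> C x = \<alpha> C x" if "C \<in> cpt" "x \<in> carrier (Val M C)" for C x
    using that by (simp add: \<beta>_def)
  have "\<beta> \<in> Nat M N"
    unfolding nat_trans_def
  proof (intro CollectI conjI ballI)
    show "\<beta> \<in> (\<Pi>\<^sub>E C\<in>cpt. carrier (Val M C) \<rightarrow>\<^sub>E carrier (Val N C))"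
      unfolding \<beta>_def by (intro restrict_PiE_iff[THEN iffD2] ballI linear_map_closed[OF lin])
    fix C assume C: "C \<in> cpt"
    show "linear_map R (Val M C) (Val N C) (\<beta> C)"
      by (rule linear_map_cong[OF dmod_module[OF M C] lin[OF C]]) (simp add: app C)
    fix C' f x assume *: "C' \<in> cpt" "f \<in> mor D C C'" "x \<in> carrier (Val M C')"
    show "\<beta> C (Act M C C' f x) = Act N C C' f (\<beta> C' x)"
      using dmod_act_closed[OF M C *] nat[OF C *] by (simp add: app C *)
  qed
  then show ?thesis using app that by blast
qed

lemma nat_comp:
  assumes L: "L \<in> dmods" and \<alpha>: "\<alpha> \<in> Nat L M" and \<beta>: "\<beta> \<in> Nat M N"
  obtains \<gamma> where "\<gamma> \<in> Nat L N" "\<forall>C\<in>cpt. \<forall>x\<in>carrier (Val L C). \<gamma> C x = \<beta> C (\<alpha> C x)"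
proof (rule nat_exists[OF L, of N "\<lambda>C x. \<beta> C (\<alpha> C x)"])
  show "linear_map R (Val L C) (Val N C) (\<lambda>x. \<beta> C (\<alpha> C x))" if "C \<in> cpt" for C
    by (rule linear_map_comp[OF nat_linear[OF \<alpha> that] nat_linear[OF \<beta> that]])
  fix C C' f x assume *: "C \<in> cpt" "C' \<in> cpt" "f \<in> mor D C C'" "x \<in> carrier (Val L C')"
  show "\<beta> C (\<alpha> C (Act L C C' f x)) = Act N C C' f (\<beta> C' (\<alpha> C' x))"
    using nat_natural[OF \<alpha> *] nat_natural[OF \<beta> *(1-3) nat_closed[OF \<alpha> *(2,4)]] by simp
qed

lemma nat_zero:
  "\<lbrakk>M \<in> dmods; N \<in> dmods; \<alpha> \<in> Nat M N; C \<in> cpt\<rbrakk> \<Longrightarrow> \<alpha> C \<zero>\<^bsub>Val M C\<^esub> = \<zero>\<^bsub>Val N C\<^esub>"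
  by (rule linear_map_zero[OF dmod_module dmod_module nat_linear])

text \<open>Pointwise epimorphisms are cokernels of their kernels: \<open>\<gamma>\<close> is constant on the fibres of \<open>\<beta>\<close>, so
  \<open>\<delta>\<close> can be computed from any preimage.\<close>

lemma nat_factor:
  assumes M: "M \<in> dmods" and N: "N \<in> dmods" and N': "N' \<in> dmods"
    and \<beta>: "\<beta> \<in> Nat M N" and \<gamma>: "\<gamma> \<in> Nat M N'"
    and surj: "\<And>C. C \<in> cpt \<Longrightarrow> \<beta> C ` carrier (Val M C) = carrier (Val N C)"
    and ker: "\<And>C x. \<lbrakk>C \<in> cpt; x \<in> carrier (Val M C); \<beta> C x = \<zero>\<^bsub>Val N C\<^esub>\<rbrakk> \<Longrightarrow> \<gamma> C x = \<zero>\<^bsub>Val N' C\<^esub>"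
  obtains \<delta> where "\<delta> \<in> Nat N N'" "\<forall>C\<in>cpt. \<forall>x\<in>carrier (Val M C). \<delta> C (\<beta> C x) = \<gamma> C x"
proof -
  define \<delta> where "\<delta> C y = \<gamma> C (SOME x. x \<in> carrier (Val M C) \<and> \<beta> C x = y)" for C y
  have eq: "\<delta> C (\<beta> C x) = \<gamma> C x" if C: "C \<in> cpt" and x: "x \<in> carrier (Val M C)" for C x
  proof -
    define x' where "x' = (SOME x'. x' \<in> carrier (Val M C) \<and> \<beta> C x' = \<beta> C x)"
    have x': "x' \<in> carrier (Val M C)" "\<beta> C x' = \<beta> C x"
      using someI[of "\<lambda>x'. x' \<in> carrier (Val M C) \<and> \<beta> C x' = \<beta> C x" x] x unfolding x'_def by auto
    interpret MC: abelian_group "Val M C" using module_abelian_group[OF dmod_module[OF M C]] .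
    interpret NC: abelian_group "Val N C" using module_abelian_group[OF dmod_module[OF N C]] .
    interpret N'C: abelian_group "Val N' C" using module_abelian_group[OF dmod_module[OF N' C]] .
    let ?d = "x' \<oplus>\<^bsub>Val M C\<^esub> (\<ominus>\<^bsub>Val M C\<^esub> x)"
    have d: "?d \<in> carrier (Val M C)" using x x' by simp
    have cl: "\<beta> C x \<in> carrier (Val N C)" "\<gamma> C x \<in> carrier (Val N' C)" "\<gamma> C x' \<in> carrier (Val N' C)"
      using nat_closed[OF \<beta> C x] nat_closed[OF \<gamma> C x] nat_closed[OF \<gamma> C x'(1)] by auto
    have "\<beta> C ?d = \<beta> C x' \<oplus>\<^bsub>Val N C\<^esub> (\<ominus>\<^bsub>Val N C\<^esub> \<beta> C x)"
      using linear_map_add[OF nat_linear[OF \<beta> C] x'(1), of "\<ominus>\<^bsub>Val M C\<^esub> x"] x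
        linear_map_minus[OF dmod_module[OF M C] dmod_module[OF N C] nat_linear[OF \<beta> C] x] by simp
    then have "\<beta> C ?d = \<zero>\<^bsub>Val N C\<^esub>" using x'(2) cl by (simp add: NC.r_neg)
    then have "\<gamma> C ?d = \<zero>\<^bsub>Val N' C\<^esub>" using ker[OF C d] by simp
    moreover have "\<gamma> C ?d = \<gamma> C x' \<oplus>\<^bsub>Val N' C\<^esub> (\<ominus>\<^bsub>Val N' C\<^esub> \<gamma> C x)"
      using linear_map_add[OF nat_linear[OF \<gamma> C] x'(1), of "\<ominus>\<^bsub>Val M C\<^esub> x"] x
        linear_map_minus[OF dmod_module[OF M C] dmod_module[OF N' C] nat_linear[OF \<gamma> C] x] by simp
    ultimately have "\<gamma> C x' = \<gamma> C x"
      using N'C.minus_equality[of "\<gamma> C x'" "\<ominus>\<^bsub>Val N' C\<^esub> \<gamma> C x"] cl by simp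
    then show ?thesis unfolding \<delta>_def x'_def .
  qed
  have lift: "\<exists>x\<in>carrier (Val M C). \<beta> C x = y" if "C \<in> cpt" "y \<in> carrier (Val N C)" for C y
    using surj[OF that(1)] that(2) by (metis imageE)
  have lin: "linear_map R (Val N C) (Val N' C) (\<delta> C)" if C: "C \<in> cpt" for C
    unfolding linear_map_def
  proof (intro conjI ballI funcsetI)
    interpret MC: module R "Val M C" using dmod_module[OF M C] .
    fix y assume "y \<in> carrier (Val N C)"
    then obtain x where x: "x \<in> carrier (Val M C)" "y = \<beta> C x" using lift[OF C] by blast
    show "\<delta> C y \<in> carrier (Val N' C)" using eq[OF C x(1)] nat_closed[OF \<gamma> C x(1)] x(2) by simp
    { fix y' assume "y' \<in> carrier (Val N C)"
      then obtain x' where x': "x' \<in> carrier (Val M C)" "y' = \<beta> C x'" using lift[OF C] by blast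
      have "y \<oplus>\<^bsub>Val N C\<^esub> y' = \<beta> C (x \<oplus>\<^bsub>Val M C\<^esub> x')"
        using linear_map_add[OF nat_linear[OF \<beta> C] x(1) x'(1)] x x' by simp
      then show "\<delta> C (y \<oplus>\<^bsub>Val N C\<^esub> y') = \<delta> C y \<oplus>\<^bsub>Val N' C\<^esub> \<delta> C y'"
        using eq[OF C, of "x \<oplus>\<^bsub>Val M C\<^esub> x'"] eq[OF C x(1)] eq[OF C x'(1)] x x'
          linear_map_add[OF nat_linear[OF \<gamma> C] x(1) x'(1)] by simp }
    fix a assume a: "a \<in> carrier R"
    have "a \<odot>\<^bsub>Val N C\<^esub> y = \<beta> C (a \<odot>\<^bsub>Val M C\<^esub> x)"
      using linear_map_smult[OF nat_linear[OF \<beta> C] a x(1)] x by simp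
    then show "\<delta> C (a \<odot>\<^bsub>Val N C\<^esub> y) = a \<odot>\<^bsub>Val N' C\<^esub> \<delta> C y"
      using eq[OF C, of "a \<odot>\<^bsub>Val M C\<^esub> x"] eq[OF C x(1)] x a
        linear_map_smult[OF nat_linear[OF \<gamma> C] a x(1)] by simp
  qed
  have nat: "\<delta> C (Act N C C' f y) = Act N' C C' f (\<delta> C' y)"
    if C: "C \<in> cpt" "C' \<in> cpt" "f \<in> mor D C C'" and y: "y \<in> carrier (Val N C')" for C C' f y
  proof -
    obtain x where x: "x \<in> carrier (Val M C')" "y = \<beta> C' x" using lift[OF C(2) y] by blast
    have "Act N C C' f y = \<beta> C (Act M C C' f x)" using nat_natural[OF \<beta> C x(1)] x(2) by simp
    then show ?thesis
      using eq[OF C(1) dmod_act_closed[OF M C x(1)]] nat_natural[OF \<gamma> C x(1)] eq[OF C(2) x(1)] x(2) by simp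
  qed
  obtain \<epsilon> where \<epsilon>: "\<epsilon> \<in> Nat N N'" "\<forall>C\<in>cpt. \<forall>y\<in>carrier (Val N C). \<epsilon> C y = \<delta> C y"
    by (rule nat_exists[OF N lin nat])
  have "\<forall>C\<in>cpt. \<forall>x\<in>carrier (Val M C). \<epsilon> C (\<beta> C x) = \<gamma> C x"
    using \<epsilon>(2) eq nat_closed[OF \<beta>] by simp
  with \<epsilon>(1) show ?thesis by (rule that)
qed

lemma yoneda_map_apply [simp]: "\<lbrakk>C \<in> cpt; x \<in> mor D C X\<rbrakk> \<Longrightarrow> yoneda_map \<kappa> D X u C x = u \<bullet> x"
  by (simp add: yoneda_map_def)

lemma yoneda_map_nat:
  assumes X: "X \<in> Ob D" and Y: "Y \<in> Ob D" and u: "u \<in> mor D X Y"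
  shows "yoneda_map \<kappa> D X u \<in> Nat (yoneda D X) (yoneda D Y)"
proof -
  have lin: "linear_map R (Val (yoneda D X) C) (Val (yoneda D Y) C) (\<lambda>x. u \<bullet> x)" if "C \<in> cpt" for C
    using Cmp_linear_right[OF compact_Ob[OF that] X Y u] by simp
  have nat: "u \<bullet> Act (yoneda D X) C C' f x = Act (yoneda D Y) C C' f (u \<bullet> x)"
    if C: "C \<in> cpt" "C' \<in> cpt" and f: "f \<in> mor D C C'" and x: "x \<in> carrier (Val (yoneda D X) C')" for C C' f x
    using assoc[OF f _ u compact_Ob[OF C(1)] compact_Ob[OF C(2)] X Y, of x] x by simp
  obtain \<beta> where \<beta>: "\<beta> \<in> Nat (yoneda D X) (yoneda D Y)"
    "\<forall>C\<in>cpt. \<forall>x\<in>carrier (Val (yoneda D X) C). \<beta> C x = u \<bullet> x"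
    by (rule nat_exists[OF yoneda_dmod[OF X] lin nat])
  have "\<beta> C = yoneda_map \<kappa> D X u C" for C
  proof (cases "C \<in> cpt")
    case True
    then have "\<beta> C \<in> mor D C X \<rightarrow>\<^sub>E mor D C Y" using \<beta>(1) by (auto simp: nat_trans_def PiE_iff)
    then have "\<beta> C = (\<lambda>x\<in>mor D C X. u \<bullet> x)"
      using \<beta>(2) True by (intro ext) (auto simp: PiE_iff extensional_def restrict_def)
    then show ?thesis using True by (simp add: yoneda_map_def)
  next
    case False
    then show ?thesis using \<beta>(1) by (auto simp: nat_trans_def PiE_iff extensional_def yoneda_map_def)
  qed
  then have "\<beta> = yoneda_map \<kappa> D X u" by blast
  then show ?thesis using \<beta>(1) by simp
qed

section \<open>Coproducts of compact objects and their retracts\<close>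

definition compact_sum :: "'k set \<Rightarrow> ('k \<Rightarrow> 'o) \<Rightarrow> 'o \<Rightarrow> ('k \<Rightarrow> 'm) \<Rightarrow> bool" where
  "compact_sum I X S \<iota> \<longleftrightarrow> small \<kappa> I \<and> (\<forall>i\<in>I. X i \<in> cpt) \<and> is_coproduct D I X S \<iota>"

text \<open>The objects of \<open>Add(D\<^sup>c)\<close>. Direct summands are encoded as retracts; in a triangulated category the
  complement of a retract exists as a cone.\<close>

definition in_Add :: "'o \<Rightarrow> bool" where
  "in_Add P \<longleftrightarrow> P \<in> Ob D \<and>
    (\<exists>I X S \<iota> r s. compact_sum I X S \<iota> \<and> r \<in> mor D S P \<and> s \<in> mor D P S \<and> r \<bullet> s = Idn D P)"

lemma compact_sumD:
  assumes "compact_sum I X S \<iota>"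
  shows "small \<kappa> I" "is_coproduct D I X S \<iota>" "S \<in> Ob D"
    "\<And>i. i \<in> I \<Longrightarrow> X i \<in> cpt" "\<And>i. i \<in> I \<Longrightarrow> X i \<in> Ob D" "\<And>i. i \<in> I \<Longrightarrow> \<iota> i \<in> mor D (X i) S"
  using assms by (auto simp: compact_sum_def compact_Ob coproduct_Ob coproduct_inj)

lemma compact_sum_in_Add: "compact_sum I X S \<iota> \<Longrightarrow> in_Add S"
  unfolding in_Add_def using compact_sumD(3) Idn_closed Idn_Cmp by blast

lemma in_AddE:
  assumes "in_Add P"
  obtains I X S \<iota> r s where "P \<in> Ob D" "compact_sum I X S \<iota>" "S \<in> Ob D" "r \<in> mor D S P" "s \<in> mor D P S"
    "r \<bullet> s = Idn D P"
  using assms compact_sumD(3) unfolding in_Add_def by blast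

text \<open>The module \<open>\<^bold>yS\<close> is the direct sum of the \<open>\<^bold>y(X i)\<close>, so by the Yoneda lemma maps from it to \<open>N\<close>
  correspond to families of elements of \<open>N(X i)\<close>. Uniqueness: every map from a compact object to
  \<open>S\<close> is a finite sum of maps through the summands, where naturality applies.\<close>

lemma nat_from_sum_unique:
  assumes S: "compact_sum I X S \<iota>" and N: "N \<in> dmods"
    and \<phi>: "\<phi> \<in> Nat (yoneda D S) N" and \<psi>: "\<psi> \<in> Nat (yoneda D S) N"
    and eq: "\<And>i. i \<in> I \<Longrightarrow> \<phi> (X i) (\<iota> i) = \<psi> (X i) (\<iota> i)"
    and C: "C \<in> cpt" and x: "x \<in> mor D C S"
  shows "\<phi> C x = \<psi> C x"
proof -
  note sD = compact_sumD[OF S] and CO = compact_Ob[OF C]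
  obtain F f where F: "finite F" "F \<subseteq> I" "\<forall>i\<in>F. f i \<in> mor D C (X i)"
    "x = finsum (Hom D C S) (\<lambda>i. \<iota> i \<bullet> f i) F"
    by (rule compact_decomposition[OF C sD(1) sD(5) sD(2) x])
  have m: "\<iota> i \<bullet> f i \<in> carrier (Val (yoneda D S) C)" if "i \<in> F" for i
    using Cmp_closed[of "f i" C "X i" "\<iota> i" S] F(2,3) that sD CO by auto
  have sum: "\<chi> C x = finsum (Val N C) (\<lambda>i. Act N C (X i) (f i) (\<chi> (X i) (\<iota> i))) F"
    if \<chi>: "\<chi> \<in> Nat (yoneda D S) N" for \<chi>
  proof -
    interpret NC: abelian_group "Val N C" using module_abelian_group[OF dmod_module[OF N C]] .
    have "\<chi> C x = finsum (Val N C) (\<lambda>i. \<chi> C (\<iota> i \<bullet> f i)) F"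
      unfolding F(4)
      using linear_map_finsum[OF dmod_module[OF yoneda_dmod[OF sD(3)] C] dmod_module[OF N C]
          nat_linear[OF \<chi> C] F(1) m] by simp
    also have "\<dots> = finsum (Val N C) (\<lambda>i. Act N C (X i) (f i) (\<chi> (X i) (\<iota> i))) F"
    proof (rule NC.finsum_cong'[OF refl])
      have i: "i \<in> I" "f i \<in> mor D C (X i)" "\<iota> i \<in> carrier (Val (yoneda D S) (X i))" if "i \<in> F" for i
        using that F(2,3) sD(6) by auto
      show "(\<lambda>i. Act N C (X i) (f i) (\<chi> (X i) (\<iota> i))) \<in> F \<rightarrow> carrier (Val N C)"
        using dmod_act_closed[OF N C sD(4) _ nat_closed[OF \<chi> sD(4)]] i by blast
      show "\<chi> C (\<iota> i \<bullet> f i) = Act N C (X i) (f i) (\<chi> (X i) (\<iota> i))" if "i \<in> F" for i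
        using nat_natural[OF \<chi> C sD(4)[OF i(1)[OF that]] i(2)[OF that] i(3)[OF that]] by simp
    qed
    finally show ?thesis .
  qed
  interpret NC: abelian_group "Val N C" using module_abelian_group[OF dmod_module[OF N C]] .
  have "finsum (Val N C) (\<lambda>i. Act N C (X i) (f i) (\<phi> (X i) (\<iota> i))) F
      = finsum (Val N C) (\<lambda>i. Act N C (X i) (f i) (\<psi> (X i) (\<iota> i))) F"
  proof (rule NC.finsum_cong'[OF refl])
    show "Act N C (X i) (f i) (\<phi> (X i) (\<iota> i)) = Act N C (X i) (f i) (\<psi> (X i) (\<iota> i))" if "i \<in> F" for i
      using eq that F(2) by auto
    show "(\<lambda>i. Act N C (X i) (f i) (\<psi> (X i) (\<iota> i))) \<in> F \<rightarrow> carrier (Val N C)"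
    proof
      fix i assume "i \<in> F"
      then have i: "i \<in> I" "f i \<in> mor D C (X i)" "\<iota> i \<in> carrier (Val (yoneda D S) (X i))"
        using F(2,3) sD(6) by auto
      show "Act N C (X i) (f i) (\<psi> (X i) (\<iota> i)) \<in> carrier (Val N C)"
        using dmod_act_closed[OF N C sD(4)[OF i(1)] i(2) nat_closed[OF \<psi> sD(4)[OF i(1)] i(3)]] .
    qed
  qed
  then show ?thesis using sum[OF \<phi>] sum[OF \<psi>] by simp
qed

text \<open>For existence, an element \<open>x\<close> of \<open>D(C, S)\<close> is sent to the sum of the \<open>p i \<bullet> x\<close> acting on
  the given elements, where \<open>p i\<close> are the projections. By compactness of \<open>C\<close> almost all terms vanish.\<close>

lemma nat_from_sum:
  assumes S: "compact_sum I X S \<iota>" and N: "N \<in> dmods"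
    and n: "\<And>i. i \<in> I \<Longrightarrow> n i \<in> carrier (Val N (X i))"
  obtains \<phi> where "\<phi> \<in> Nat (yoneda D S) N" "\<forall>i\<in>I. \<phi> (X i) (\<iota> i) = n i"
proof -
  note sD = compact_sumD[OF S]
  obtain p where "\<forall>i\<in>I. p i \<in> mor D S (X i)"
    "\<forall>i\<in>I. \<forall>j\<in>I. p i \<bullet> \<iota> j = (if i = j then Idn D (X i) else zer (X j) (X i))"
    by (rule coproduct_projections[OF sD(2,5)])
  then have p: "p i \<in> mor D S (X i)"
    "j \<in> I \<Longrightarrow> p i \<bullet> \<iota> j = (if i = j then Idn D (X i) else zer (X j) (X i))" if "i \<in> I" for i j
    using that by auto
  define supp where "supp C x = {i \<in> I. p i \<bullet> x \<noteq> zer C (X i)}" for C x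
  define summand where "summand C i x = Act N C (X i) (p i \<bullet> x) (n i)" for C i x
  have px: "p i \<bullet> x \<in> mor D C (X i)" if "C \<in> cpt" "x \<in> mor D C S" "i \<in> I" for C x i
    using Cmp_closed[OF that(2) p(1)[OF that(3)] compact_Ob[OF that(1)] sD(3) sD(5)[OF that(3)]] .
  have fin: "finite (supp C x)" if C: "C \<in> cpt" and x: "x \<in> mor D C S" for C x
  proof -
    obtain F f where F: "finite F" "F \<subseteq> I" "\<forall>i\<in>F. f i \<in> mor D C (X i)"
      "x = finsum (Hom D C S) (\<lambda>i. \<iota> i \<bullet> f i) F"
      by (rule compact_decomposition[OF C sD(1) sD(5) sD(2) x])
    have "p j \<bullet> x = (if j \<in> F then f j else zer C (X j))" if j: "j \<in> I" for j
      unfolding F(4)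
      by (rule projection_finsum[OF F(1,2) j compact_Ob[OF C] sD(3) sD(5) sD(6) p(1)[OF j] p(2)[OF j]])
        (use F(3) in auto)
    then have "supp C x \<subseteq> F" by (auto simp: supp_def split: if_splits)
    then show ?thesis using F(1) by (rule finite_subset)
  qed
  have summand_lin: "linear_map R (Hom D C S) (Val N C) (summand C i)" if C: "C \<in> cpt" and i: "i \<in> I" for C i
    unfolding summand_def
    using linear_map_comp[OF Cmp_linear_right[OF compact_Ob[OF C] sD(3) sD(5)[OF i] p(1)[OF i]]
        dmod_act_linear_left[OF N C sD(4)[OF i] n[OF i]]] .
  define \<phi> where "\<phi> C x = finsum (Val N C) (\<lambda>i. summand C i x) (supp C x)" for C x
  have sum: "\<phi> C x = finsum (Val N C) (\<lambda>i. summand C i x) F"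
    if C: "C \<in> cpt" and x: "x \<in> mor D C S" and F: "finite F" "supp C x \<subseteq> F" "F \<subseteq> I" for C x F
  proof -
    interpret NC: abelian_group "Val N C" using module_abelian_group[OF dmod_module[OF N C]] .
    show ?thesis
      unfolding \<phi>_def
    proof (rule NC.add.finprod_mono_neutral_cong_left[OF F(1,2)])
      show "(\<lambda>i. summand C i x) \<in> F \<rightarrow> carrier (Val N C)"
        using linear_map_closed[OF summand_lin[OF C] x] F(3) by blast
      fix i assume "i \<in> F - supp C x"
      then have i: "i \<in> I" "p i \<bullet> x = zer C (X i)" using F(3) by (auto simp: supp_def)
      show "summand C i x = \<zero>\<^bsub>Val N C\<^esub>"
        unfolding summand_def i(2)
        using linear_map_zero[OF Hom_module[OF compact_Ob[OF C] sD(5)[OF i(1)]] dmod_module[OF N C]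
            dmod_act_linear_left[OF N C sD(4)[OF i(1)] n[OF i(1)]]] .
    qed simp
  qed
  have sum_lin: "linear_map R (Hom D C S) (Val N C) (\<lambda>x. finsum (Val N C) (\<lambda>i. summand C i x) F)"
    if "C \<in> cpt" "finite F" "F \<subseteq> I" for C F
    using that summand_lin
    by (intro finsum_linear_map[OF Hom_module[OF compact_Ob[OF that(1)] sD(3)] dmod_module[OF N that(1)]]) auto
  have lin: "linear_map R (Val (yoneda D S) C) (Val N C) (\<phi> C)" if C: "C \<in> cpt" for C
    unfolding yoneda_simps linear_map_def
  proof (intro conjI ballI funcsetI)
    interpret CS: module R "Hom D C S" using Hom_module[OF compact_Ob[OF C] sD(3)] .
    have sub: "supp C x \<subseteq> I" for x by (auto simp: supp_def)
    fix x assume x: "x \<in> mor D C S"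
    show "\<phi> C x \<in> carrier (Val N C)"
      using linear_map_closed[OF sum_lin[OF C fin[OF C x] sub] x] by (simp add: \<phi>_def)
    { fix y assume y: "y \<in> mor D C S"
      have xy: "x \<oplus>\<^bsub>Hom D C S\<^esub> y \<in> mor D C S" using x y by simp
      let ?F = "supp C x \<union> supp C y \<union> supp C (x \<oplus>\<^bsub>Hom D C S\<^esub> y)"
      have F: "finite ?F" "?F \<subseteq> I" using fin[OF C x] fin[OF C y] fin[OF C xy] sub by auto
      have "\<phi> C x = finsum (Val N C) (\<lambda>i. summand C i x) ?F" "\<phi> C y = finsum (Val N C) (\<lambda>i. summand C i y) ?F"
        "\<phi> C (x \<oplus>\<^bsub>Hom D C S\<^esub> y) = finsum (Val N C) (\<lambda>i. summand C i (x \<oplus>\<^bsub>Hom D C S\<^esub> y)) ?F"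
        using sum[OF C x F(1) _ F(2)] sum[OF C y F(1) _ F(2)] sum[OF C xy F(1) _ F(2)] by auto
      then show "\<phi> C (x \<oplus>\<^bsub>Hom D C S\<^esub> y) = \<phi> C x \<oplus>\<^bsub>Val N C\<^esub> \<phi> C y"
        using linear_map_add[OF sum_lin[OF C F] x y] by simp }
    fix a assume a: "a \<in> carrier R"
    have ax: "a \<odot>\<^bsub>Hom D C S\<^esub> x \<in> mor D C S" using a x by simp
    let ?F = "supp C x \<union> supp C (a \<odot>\<^bsub>Hom D C S\<^esub> x)"
    have F: "finite ?F" "?F \<subseteq> I" using fin[OF C x] fin[OF C ax] sub by auto
    have "\<phi> C x = finsum (Val N C) (\<lambda>i. summand C i x) ?F"
      "\<phi> C (a \<odot>\<^bsub>Hom D C S\<^esub> x) = finsum (Val N C) (\<lambda>i. summand C i (a \<odot>\<^bsub>Hom D C S\<^esub> x)) ?F"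
      using sum[OF C x F(1) _ F(2)] sum[OF C ax F(1) _ F(2)] by auto
    then show "\<phi> C (a \<odot>\<^bsub>Hom D C S\<^esub> x) = a \<odot>\<^bsub>Val N C\<^esub> \<phi> C x"
      using linear_map_smult[OF sum_lin[OF C F] a x] by simp
  qed
  have nat: "\<phi> C (Act (yoneda D S) C C' f x) = Act N C C' f (\<phi> C' x)"
    if C: "C \<in> cpt" and C': "C' \<in> cpt" and f: "f \<in> mor D C C'" and x: "x \<in> carrier (Val (yoneda D S) C')"
    for C C' f x
  proof -
    note CO = compact_Ob[OF C] and C'O = compact_Ob[OF C']
    have x: "x \<in> mor D C' S" using x by simp
    have xf: "x \<bullet> f \<in> mor D C S" using f x CO C'O sD(3) by (rule Cmp_closed)
    have pxf: "p i \<bullet> (x \<bullet> f) = p i \<bullet> x \<bullet> f" if "i \<in> I" for i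
      using assoc[OF f x p(1)[OF that] CO C'O sD(3) sD(5)[OF that]] .
    have sub: "supp C (x \<bullet> f) \<subseteq> supp C' x"
      using pxf Cmp_zero_left[OF f CO C'O sD(5)] by (auto simp: supp_def)
    have sub': "supp C' x \<subseteq> I" by (auto simp: supp_def)
    interpret NC: abelian_group "Val N C" using module_abelian_group[OF dmod_module[OF N C]] .
    have tc: "summand C' i x \<in> carrier (Val N C')" if "i \<in> supp C' x" for i
      using linear_map_closed[OF summand_lin[OF C' subsetD[OF sub' that]] x] .
    have "\<phi> C (x \<bullet> f) = finsum (Val N C) (\<lambda>i. summand C i (x \<bullet> f)) (supp C' x)"
      using sum[OF C xf fin[OF C' x] sub sub'] .
    also have "\<dots> = finsum (Val N C) (\<lambda>i. Act N C C' f (summand C' i x)) (supp C' x)"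
    proof (rule NC.finsum_cong'[OF refl])
      show "(\<lambda>i. Act N C C' f (summand C' i x)) \<in> supp C' x \<rightarrow> carrier (Val N C)"
        using dmod_act_closed[OF N C C' f tc] by blast
      fix i assume "i \<in> supp C' x"
      then have i: "i \<in> I" using sub' by blast
      show "summand C i (x \<bullet> f) = Act N C C' f (summand C' i x)"
        unfolding summand_def pxf[OF i] using dmod_act_comp[OF N C C' sD(4)[OF i] f px[OF C' x i] n[OF i]] .
    qed
    also have "\<dots> = Act N C C' f (\<phi> C' x)"
      unfolding \<phi>_def
      using linear_map_finsum[OF dmod_module[OF N C'] dmod_module[OF N C] dmod_act_linear[OF N C C' f]
          fin[OF C' x] tc] by simp
    finally show ?thesis by simp
  qed
  obtain \<psi> where \<psi>: "\<psi> \<in> Nat (yoneda D S) N" "\<forall>C\<in>cpt. \<forall>x\<in>carrier (Val (yoneda D S) C). \<psi> C x = \<phi> C x"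
    by (rule nat_exists[OF yoneda_dmod[OF sD(3)] lin nat])
  have "\<psi> (X j) (\<iota> j) = n j" if j: "j \<in> I" for j
  proof -
    note C = sD(4)[OF j] and x = sD(6)[OF j]
    interpret NC: abelian_group "Val N (X j)" using module_abelian_group[OF dmod_module[OF N C]] .
    have tj: "summand (X j) j (\<iota> j) = n j"
      unfolding summand_def using p(2)[OF j j] dmod_act_Idn[OF N C n[OF j]] by simp
    have "supp (X j) (\<iota> j) \<subseteq> {j}" using p(2)[OF _ j] by (auto simp: supp_def split: if_splits)
    then have "\<phi> (X j) (\<iota> j) = finsum (Val N (X j)) (\<lambda>i. summand (X j) i (\<iota> j)) {j}"
      using sum[OF C x, of "{j}"] j by simp
    also have "\<dots> = n j" using NC.finsum_insert[of "{}" j "\<lambda>i. summand (X j) i (\<iota> j)"] n[OF j] tj by simp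
    finally show ?thesis using \<psi>(2) C x by simp
  qed
  with \<psi>(1) show ?thesis using that by blast
qed

text \<open>A natural transformation from \<open>\<^bold>yS\<close> to \<open>\<^bold>yY\<close> amounts to a family of maps \<open>X i \<rightarrow> Y\<close>, and so does
  a map \<open>S \<rightarrow> Y\<close>.\<close>

lemma sum_realize:
  assumes S: "compact_sum I X S \<iota>" and Y: "Y \<in> Ob D" and \<phi>: "\<phi> \<in> Nat (yoneda D S) (yoneda D Y)"
  obtains u where "u \<in> mor D S Y" "\<forall>C\<in>cpt. \<forall>x\<in>mor D C S. \<phi> C x = u \<bullet> x"
proof -
  note sD = compact_sumD[OF S]
  have "\<phi> (X i) (\<iota> i) \<in> mor D (X i) Y" if "i \<in> I" for i
    using nat_closed[OF \<phi> sD(4)[OF that], of "\<iota> i"] sD(6)[OF that] by simp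
  from coproduct_map[where f = "\<lambda>i. \<phi> (X i) (\<iota> i)", OF sD(2) Y this]
  obtain u where u: "u \<in> mor D S Y" "\<forall>i\<in>I. u \<bullet> \<iota> i = \<phi> (X i) (\<iota> i)" by metis
  have "\<phi> C x = yoneda_map \<kappa> D S u C x" if "C \<in> cpt" "x \<in> mor D C S" for C x
  proof (rule nat_from_sum_unique[OF S yoneda_dmod[OF Y] \<phi> yoneda_map_nat[OF sD(3) Y u(1)] _ that])
    show "\<phi> (X i) (\<iota> i) = yoneda_map \<kappa> D S u (X i) (\<iota> i)" if "i \<in> I" for i
      using u(2) that sD(4)[OF that] sD(6)[OF that] by simp
  qed
  then have "\<forall>C\<in>cpt. \<forall>x\<in>mor D C S. \<phi> C x = u \<bullet> x" by simp
  with u(1) show ?thesis by (rule that)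
qed

lemma Add_retract:
  assumes P: "in_Add P" and Q: "Q \<in> Ob D" "r \<in> mor D P Q" "s \<in> mor D Q P" "r \<bullet> s = Idn D Q"
  shows "in_Add Q"
proof -
  obtain I X S \<iota> a b where PO: "P \<in> Ob D" and S: "compact_sum I X S \<iota>" and SO: "S \<in> Ob D"
    and a: "a \<in> mor D S P" and b: "b \<in> mor D P S" and ab: "a \<bullet> b = Idn D P"
    by (rule in_AddE[OF P])
  have ra: "r \<bullet> a \<in> mor D S Q" using a Q(2) SO PO Q(1) by (rule Cmp_closed)
  have bs: "b \<bullet> s \<in> mor D Q S" using Q(3) b Q(1) PO SO by (rule Cmp_closed)
  have "r \<bullet> a \<bullet> (b \<bullet> s) = r \<bullet> (a \<bullet> (b \<bullet> s))" using assoc[OF bs a Q(2)] Q(1) SO PO by simp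
  also have "a \<bullet> (b \<bullet> s) = s" using assoc[OF Q(3) b a] ab Idn_Cmp[OF Q(3)] Q(1) SO PO by simp
  finally have "r \<bullet> a \<bullet> (b \<bullet> s) = Idn D Q" using Q(4) by simp
  with Q(1) S ra bs show ?thesis unfolding in_Add_def by blast
qed

text \<open>Full faithfulness of the restricted Yoneda functor on coproducts of compact objects passes to their
  retracts: precompose with the retraction, then with the section.\<close>

lemma Add_realize:
  assumes P: "in_Add P" and Y: "Y \<in> Ob D" and \<phi>: "\<phi> \<in> Nat (yoneda D P) (yoneda D Y)"
  obtains u where "u \<in> mor D P Y" "\<forall>C\<in>cpt. \<forall>x\<in>mor D C P. \<phi> C x = u \<bullet> x"
proof -
  obtain I X S \<iota> r s where PO: "P \<in> Ob D" and S: "compact_sum I X S \<iota>" and SO: "S \<in> Ob D"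
    and r: "r \<in> mor D S P" and s: "s \<in> mor D P S" and rs: "r \<bullet> s = Idn D P"
    by (rule in_AddE[OF P])
  obtain \<psi> where \<psi>: "\<psi> \<in> Nat (yoneda D S) (yoneda D Y)"
    "\<forall>C\<in>cpt. \<forall>x\<in>carrier (Val (yoneda D S) C). \<psi> C x = \<phi> C (yoneda_map \<kappa> D S r C x)"
    by (rule nat_comp[OF yoneda_dmod[OF SO] yoneda_map_nat[OF SO PO r] \<phi>])
  obtain v where v: "v \<in> mor D S Y" "\<forall>C\<in>cpt. \<forall>x\<in>mor D C S. \<psi> C x = v \<bullet> x"
    by (rule sum_realize[OF S Y \<psi>(1)])
  have vs: "v \<bullet> s \<in> mor D P Y" using s v(1) PO SO Y by (rule Cmp_closed)
  have "\<phi> C x = v \<bullet> s \<bullet> x" if C: "C \<in> cpt" and x: "x \<in> mor D C P" for C x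
  proof -
    note CO = compact_Ob[OF C]
    have sx: "s \<bullet> x \<in> mor D C S" using x s CO PO SO by (rule Cmp_closed)
    have "r \<bullet> (s \<bullet> x) = x" using assoc[OF x s r CO PO SO PO] rs Idn_Cmp[OF x CO PO] by simp
    then have "\<phi> C x = \<psi> C (s \<bullet> x)" using \<psi>(2) C sx by simp
    also have "\<dots> = v \<bullet> (s \<bullet> x)" using v(2) C sx by simp
    also have "\<dots> = v \<bullet> s \<bullet> x" by (rule assoc[OF x s v(1) CO PO SO Y])
    finally show ?thesis .
  qed
  with vs show ?thesis using that by blast
qed

lemma Add_faithful:
  assumes P: "in_Add P" and Y: "Y \<in> Ob D" and u: "u \<in> mor D P Y" and v: "v \<in> mor D P Y"
    and eq: "\<And>C x. \<lbrakk>C \<in> cpt; x \<in> mor D C P\<rbrakk> \<Longrightarrow> u \<bullet> x = v \<bullet> x"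
  shows "u = v"
proof -
  obtain I X S \<iota> r s where PO: "P \<in> Ob D" and S: "compact_sum I X S \<iota>" and SO: "S \<in> Ob D"
    and r: "r \<in> mor D S P" and s: "s \<in> mor D P S" and rs: "r \<bullet> s = Idn D P"
    by (rule in_AddE[OF P])
  note sD = compact_sumD[OF S]
  have "u \<bullet> r = v \<bullet> r"
  proof (rule coproduct_ext[OF sD(2) Y sD(5)])
    show "u \<bullet> r \<in> mor D S Y" using r u SO PO Y by (rule Cmp_closed)
    show "v \<bullet> r \<in> mor D S Y" using r v SO PO Y by (rule Cmp_closed)
    fix i assume i: "i \<in> I"
    have "r \<bullet> \<iota> i \<in> mor D (X i) P" using sD(6)[OF i] r sD(5)[OF i] SO PO by (rule Cmp_closed)
    then have "u \<bullet> (r \<bullet> \<iota> i) = v \<bullet> (r \<bullet> \<iota> i)" by (rule eq[OF sD(4)[OF i]])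
    then show "u \<bullet> r \<bullet> \<iota> i = v \<bullet> r \<bullet> \<iota> i"
      using assoc[OF sD(6)[OF i] r u sD(5)[OF i] SO PO Y] assoc[OF sD(6)[OF i] r v sD(5)[OF i] SO PO Y]
      by simp
  qed
  then have "u \<bullet> (r \<bullet> s) = v \<bullet> (r \<bullet> s)"
    using assoc[OF s r u PO SO PO Y] assoc[OF s r v PO SO PO Y] by simp
  then show ?thesis using rs Cmp_Idn[OF u PO Y] Cmp_Idn[OF v PO Y] by simp
qed

text \<open>It suffices to choose preimages of the images of the \<open>\<iota> i\<close>.\<close>

lemma sum_lift:
  assumes S: "compact_sum I X S \<iota>" and M: "M \<in> dmods" and N: "N \<in> dmods"
    and \<pi>: "\<pi> \<in> Nat M N" and \<phi>: "\<phi> \<in> Nat (yoneda D S) N"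
    and surj: "\<forall>C\<in>cpt. \<pi> C ` carrier (Val M C) = carrier (Val N C)"
  obtains \<psi> where "\<psi> \<in> Nat (yoneda D S) M" "\<forall>C\<in>cpt. \<forall>x\<in>mor D C S. \<pi> C (\<psi> C x) = \<phi> C x"
proof -
  note sD = compact_sumD[OF S]
  have "\<exists>m\<in>carrier (Val M (X i)). \<pi> (X i) m = \<phi> (X i) (\<iota> i)" if "i \<in> I" for i
  proof -
    have "\<phi> (X i) (\<iota> i) \<in> carrier (Val N (X i))"
      using nat_closed[OF \<phi> sD(4)[OF that], of "\<iota> i"] sD(6)[OF that] by simp
    then have "\<phi> (X i) (\<iota> i) \<in> \<pi> (X i) ` carrier (Val M (X i))" using surj sD(4)[OF that] by simp
    then show ?thesis by auto
  qed
  then obtain m where m: "\<And>i. i \<in> I \<Longrightarrow> m i \<in> carrier (Val M (X i))"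
    "\<And>i. i \<in> I \<Longrightarrow> \<pi> (X i) (m i) = \<phi> (X i) (\<iota> i)" by metis
  obtain \<psi> where \<psi>: "\<psi> \<in> Nat (yoneda D S) M" "\<forall>i\<in>I. \<psi> (X i) (\<iota> i) = m i"
    by (rule nat_from_sum[where n = m, OF S M m(1)])
  obtain \<chi> where \<chi>: "\<chi> \<in> Nat (yoneda D S) N"
    "\<forall>C\<in>cpt. \<forall>x\<in>carrier (Val (yoneda D S) C). \<chi> C x = \<pi> C (\<psi> C x)"
    by (rule nat_comp[OF yoneda_dmod[OF sD(3)] \<psi>(1) \<pi>])
  have "\<chi> C x = \<phi> C x" if "C \<in> cpt" "x \<in> mor D C S" for C x
  proof (rule nat_from_sum_unique[OF S N \<chi>(1) \<phi> _ that])
    show "\<chi> (X i) (\<iota> i) = \<phi> (X i) (\<iota> i)" if "i \<in> I" for i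
      using \<chi>(2) \<psi>(2) m(2) that sD(4)[OF that] sD(6)[OF that] by simp
  qed
  then have "\<forall>C\<in>cpt. \<forall>x\<in>mor D C S. \<pi> C (\<psi> C x) = \<phi> C x" using \<chi>(2) by simp
  with \<psi>(1) show ?thesis by (rule that)
qed

lemma Add_projective:
  assumes P: "in_Add P"
  shows "dmod_projective R \<kappa> D (yoneda D P)"
  unfolding dmod_projective_def
proof (intro conjI ballI impI)
  obtain I X S \<iota> r s where PO: "P \<in> Ob D" and S: "compact_sum I X S \<iota>" and SO: "S \<in> Ob D"
    and r: "r \<in> mor D S P" and s: "s \<in> mor D P S" and rs: "r \<bullet> s = Idn D P"
    by (rule in_AddE[OF P])
  show yP: "yoneda D P \<in> dmods" using PO by (rule yoneda_dmod)
  fix M N \<pi> \<phi>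
  assume M: "M \<in> dmods" and N: "N \<in> dmods" and \<pi>: "\<pi> \<in> Nat M N" and \<phi>: "\<phi> \<in> Nat (yoneda D P) N"
    and surj: "\<forall>C\<in>cpt. \<pi> C ` carrier (Val M C) = carrier (Val N C)"
  obtain \<phi>' where \<phi>': "\<phi>' \<in> Nat (yoneda D S) N"
    "\<forall>C\<in>cpt. \<forall>x\<in>carrier (Val (yoneda D S) C). \<phi>' C x = \<phi> C (yoneda_map \<kappa> D S r C x)"
    by (rule nat_comp[OF yoneda_dmod[OF SO] yoneda_map_nat[OF SO PO r] \<phi>])
  obtain \<psi>' where \<psi>': "\<psi>' \<in> Nat (yoneda D S) M" "\<forall>C\<in>cpt. \<forall>x\<in>mor D C S. \<pi> C (\<psi>' C x) = \<phi>' C x"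
    by (rule sum_lift[OF S M N \<pi> \<phi>'(1) surj])
  obtain \<psi> where \<psi>: "\<psi> \<in> Nat (yoneda D P) M"
    "\<forall>C\<in>cpt. \<forall>x\<in>carrier (Val (yoneda D P) C). \<psi> C x = \<psi>' C (yoneda_map \<kappa> D P s C x)"
    by (rule nat_comp[OF yP yoneda_map_nat[OF PO SO s] \<psi>'(1)])
  have "\<pi> C (\<psi> C x) = \<phi> C x" if C: "C \<in> cpt" and x: "x \<in> mor D C P" for C x
  proof -
    note CO = compact_Ob[OF C]
    have sx: "s \<bullet> x \<in> mor D C S" using x s CO PO SO by (rule Cmp_closed)
    have "r \<bullet> (s \<bullet> x) = x" using assoc[OF x s r CO PO SO PO] rs Idn_Cmp[OF x CO PO] by simp
    then show ?thesis using \<psi>(2) \<psi>'(2) \<phi>'(2) C x sx by simp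
  qed
  then show "\<exists>\<psi>\<in>Nat (yoneda D P) M. \<forall>C\<in>cpt. \<forall>x\<in>carrier (Val (yoneda D P) C). \<pi> C (\<psi> C x) = \<phi> C x"
    using \<psi>(1) by auto
qed

text \<open>Take one summand for each element of the values of \<open>M\<close> at representatives of the compact objects.
  Regularity of \<open>\<kappa>\<close> keeps the number of summands small.\<close>

lemma free_cover:
  assumes M: "M \<in> dmods"
  obtains I X S \<iota> \<phi> where "compact_sum I X S \<iota>" "\<phi> \<in> Nat (yoneda D S) M"
    "\<forall>C\<in>cpt. \<phi> C ` mor D C S = carrier (Val M C)"
proof -
  obtain A where A: "A \<subseteq> cpt" "small \<kappa> A" "\<forall>C\<in>cpt. \<exists>C'\<in>A. isomorphic_obj D C C'"
    using compacts_ess_small by blast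
  have "small \<kappa> (SIGMA C:A. carrier (Val M C))"
    by (rule small_Sigma[OF A(2)]) (use A(1) dmod_small[OF M] in blast)
  then obtain I :: "'k set" and e where I: "small \<kappa> I" "bij_betw e I (SIGMA C:A. carrier (Val M C))"
    by (rule small_copy)
  \<comment> \<open>An index \<open>i\<close> encodes a compact object \<open>X i\<close> and an element \<open>n i\<close> of \<open>M(X i)\<close>.\<close>
  define X where "X i = fst (e i)" for i
  define n where "n i = snd (e i)" for i
  have ei: "e i \<in> (SIGMA C:A. carrier (Val M C))" if "i \<in> I" for i
    using bij_betwE[OF I(2)] that by blast
  have X: "X i \<in> cpt" and n: "n i \<in> carrier (Val M (X i))" if "i \<in> I" for i
    using ei[OF that] A(1) by (auto simp: X_def n_def)
  obtain S \<iota> where "is_coproduct D I X S \<iota>"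
    by (rule small_coproduct[where X = X, OF I(1) compact_Ob[OF X]])
  then have S: "compact_sum I X S \<iota>" using I(1) X by (simp add: compact_sum_def)
  note sD = compact_sumD[OF S]
  obtain \<phi> where \<phi>: "\<phi> \<in> Nat (yoneda D S) M" "\<forall>i\<in>I. \<phi> (X i) (\<iota> i) = n i"
    by (rule nat_from_sum[where n = n, OF S M n])
  have "\<phi> C ` mor D C S = carrier (Val M C)" if C: "C \<in> cpt" for C
  proof (intro equalityI subsetI)
    fix y assume "y \<in> \<phi> C ` mor D C S"
    then show "y \<in> carrier (Val M C)" using nat_closed[OF \<phi>(1) C] by auto
  next
    fix x assume x: "x \<in> carrier (Val M C)"
    obtain C' f where C': "C' \<in> A" "is_iso D C C' f"
      using A(3) C unfolding isomorphic_obj_def by blast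
    obtain g where f: "f \<in> mor D C C'" and g: "g \<in> mor D C' C" and gf: "g \<bullet> f = Idn D C"
      using C'(2) unfolding is_iso_def by blast
    have C'c: "C' \<in> cpt" using C'(1) A(1) by blast
    have "(C', Act M C' C g x) \<in> (SIGMA C:A. carrier (Val M C))"
      using C'(1) dmod_act_closed[OF M C'c C g x] by simp
    then obtain i where i: "i \<in> I" "e i = (C', Act M C' C g x)"
      using bij_betw_imp_surj_on[OF I(2)] by (metis imageE)
    have Xi: "X i = C'" "n i = Act M C' C g x" using i(2) by (simp_all add: X_def n_def)
    have inj: "\<iota> i \<in> mor D C' S" using sD(6)[OF i(1)] Xi by simp
    have "\<phi> C (\<iota> i \<bullet> f) = Act M C C' f (\<phi> C' (\<iota> i))"
      using nat_natural[OF \<phi>(1) C C'c f, of "\<iota> i"] inj by simp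
    also have "\<phi> C' (\<iota> i) = Act M C' C g x" using \<phi>(2)[rule_format, OF i(1)] Xi by simp
    also have "Act M C C' f (Act M C' C g x) = x"
      using dmod_act_comp[OF M C C'c C f g x] dmod_act_Idn[OF M C x] gf by simp
    finally have "x = \<phi> C (\<iota> i \<bullet> f)" ..
    moreover have "\<iota> i \<bullet> f \<in> mor D C S"
      by (rule Cmp_closed[OF f inj compact_Ob[OF C] compact_Ob[OF C'c] sD(3)])
    ultimately show "x \<in> \<phi> C ` mor D C S" by (rule image_eqI)
  qed
  then have "\<forall>C\<in>cpt. \<phi> C ` mor D C S = carrier (Val M C)" by blast
  with S \<phi>(1) show ?thesis by (rule that)
qed

section \<open>Pure triangles\<close>

text \<open>Desuspend first the source, which remains compact, and then the map; \<open>a\<close> and \<open>b\<close> are the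
  isomorphisms that identify \<open>C\<close> with the shift of \<open>C'\<close>.\<close>

lemma desuspend_mor:
  assumes C: "C \<in> cpt" and X: "X \<in> Ob D" and w: "w \<in> mor D C (ShO D X)"
  obtains C' a b t where "C' \<in> cpt" "a \<in> mor D (ShO D C') C" "b \<in> mor D C (ShO D C')"
    "t \<in> mor D C' X" "ShM D t = w \<bullet> a" "w = ShM D t \<bullet> b"
proof -
  obtain C' a b where C': "C' \<in> cpt" and a: "a \<in> mor D (ShO D C') C" and b: "b \<in> mor D C (ShO D C')"
    and "b \<bullet> a = Idn D (ShO D C')" and ab: "a \<bullet> b = Idn D C"
    by (rule compact_desuspension[OF C])
  note CO = compact_Ob[OF C] and C'O = compact_Ob[OF C']
  have O: "ShO D C' \<in> Ob D" "ShO D X \<in> Ob D" using C'O X by (auto intro: shift_closed)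
  have wa: "w \<bullet> a \<in> mor D (ShO D C') (ShO D X)" using a w O(1) CO O(2) by (rule Cmp_closed)
  obtain t where t: "t \<in> mor D C' X" "ShM D t = w \<bullet> a" by (rule shift_full[OF wa C'O X])
  have "w \<bullet> a \<bullet> b = w" using assoc[OF b a w CO O(1) CO O(2)] ab Cmp_Idn[OF w CO O(2)] by simp
  then have "w = ShM D t \<bullet> b" using t(2) by simp
  with C' a b t show ?thesis by (rule that)
qed

text \<open>The composite \<open>h z\<close> is killed by \<open>f[1]\<close>. Once its compact source is desuspended, it is the shift of
  a map killed by \<open>f\<close>.\<close>

lemma connecting_zero_if_inj:
  assumes T: "Tri D X Y Z f g h"
    and inj: "\<And>C x. \<lbrakk>C \<in> cpt; x \<in> mor D C X; f \<bullet> x = zer C Y\<rbrakk> \<Longrightarrow> x = zer C X"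
    and C: "C \<in> cpt" and z: "z \<in> mor D C Z"
  shows "h \<bullet> z = zer C (ShO D X)"
proof -
  have O: "X \<in> Ob D" "Y \<in> Ob D" "Z \<in> Ob D" "ShO D X \<in> Ob D" "ShO D Y \<in> Ob D"
    and f: "f \<in> mor D X Y" and h: "h \<in> mor D Z (ShO D X)"
    using Tri_typed[OF T] Tri_ob[OF T] by auto
  note CO = compact_Ob[OF C]
  have hz: "h \<bullet> z \<in> mor D C (ShO D X)" using z h CO O(3,4) by (rule Cmp_closed)
  have sf: "ShM D f \<in> mor D (ShO D X) (ShO D Y)" using f O(1,2) by (rule shift_mor)
  obtain C' a b t where C': "C' \<in> cpt" and a: "a \<in> mor D (ShO D C') C" and b: "b \<in> mor D C (ShO D C')"
    and t: "t \<in> mor D C' X" "ShM D t = h \<bullet> z \<bullet> a" "h \<bullet> z = ShM D t \<bullet> b"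
    by (rule desuspend_mor[OF C O(1) hz])
  note C'O = compact_Ob[OF C']
  have sC': "ShO D C' \<in> Ob D" using C'O by (rule shift_closed)
  have ft: "f \<bullet> t \<in> mor D C' Y" using t(1) f C'O O(1,2) by (rule Cmp_closed)
  have "ShM D (f \<bullet> t) = ShM D f \<bullet> (h \<bullet> z \<bullet> a)"
    using shift_comp[OF t(1) f C'O O(1,2)] t(2) by simp
  also have "\<dots> = ShM D f \<bullet> (h \<bullet> z) \<bullet> a" by (rule assoc[OF a hz sf sC' CO O(4,5)])
  also have "ShM D f \<bullet> (h \<bullet> z) = ShM D f \<bullet> h \<bullet> z" by (rule assoc[OF z h sf CO O(3-5)])
  also have "\<dots> = zer C (ShO D Y)" using Tri_comp_zer3[OF T] Cmp_zero_left[OF z CO O(3,5)] by simp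
  also have "zer C (ShO D Y) \<bullet> a = zer (ShO D C') (ShO D Y)" by (rule Cmp_zero_left[OF a sC' CO O(5)])
  finally have "f \<bullet> t = zer C' Y" by (rule shift_eq_zer[OF _ ft C'O O(2)])
  then have "t = zer C' X" by (rule inj[OF C' t(1)])
  then have "ShM D t = zer (ShO D C') (ShO D X)" using shift_zer[OF C'O O(1)] by simp
  then show ?thesis using t(3) Cmp_zero_left[OF b CO sC' O(4)] by simp
qed

text \<open>If \<open>x : C \<rightarrow> X\<close> is killed by \<open>f\<close>, then \<open>x[1]\<close> factors through \<open>h\<close>; as \<open>C[1]\<close> is compact, it is zero.
  The other conditions are exactness of the triangle.\<close>

lemma pure_triangleI:
  assumes T: "Tri D X Y Z f g h"
    and h0: "\<And>C z. \<lbrakk>C \<in> cpt; z \<in> mor D C Z\<rbrakk> \<Longrightarrow> h \<bullet> z = zer C (ShO D X)"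
  shows "pure_triangle R \<kappa> D X Y Z f g h"
  unfolding pure_triangle_def dmod_short_exact_def short_exact_def
proof (intro conjI T ballI)
  have O: "X \<in> Ob D" "Y \<in> Ob D" "Z \<in> Ob D" "ShO D X \<in> Ob D" "ShO D Y \<in> Ob D"
    and f: "f \<in> mor D X Y" and g: "g \<in> mor D Y Z" and h: "h \<in> mor D Z (ShO D X)"
    using Tri_typed[OF T] Tri_ob[OF T] by auto
  show "yoneda_map \<kappa> D X f \<in> Nat (yoneda D X) (yoneda D Y)" using O(1,2) f by (rule yoneda_map_nat)
  show "yoneda_map \<kappa> D Y g \<in> Nat (yoneda D Y) (yoneda D Z)" using O(2,3) g by (rule yoneda_map_nat)
  have sf: "ShM D f \<in> mor D (ShO D X) (ShO D Y)" using f O(1,2) by (rule shift_mor)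
  fix C assume C: "C \<in> cpt"
  note CO = compact_Ob[OF C]
  have sC: "ShO D C \<in> Ob D" using CO by (rule shift_closed)
  have ker: "x = zer C X" if x: "x \<in> mor D C X" and fx: "f \<bullet> x = zer C Y" for x
  proof -
    have sx: "ShM D x \<in> mor D (ShO D C) (ShO D X)" using x CO O(1) by (rule shift_mor)
    have "ShM D f \<bullet> ShM D x = zer (ShO D C) (ShO D Y)"
      using shift_comp[OF x f CO O(1,2)] fx shift_zer[OF CO O(2)] by simp
    then obtain z where z: "z \<in> mor D (ShO D C) Z" "h \<bullet> z = ShM D x"
      by (rule Tri_lift3[OF T sC sx])
    have "ShM D x = zer (ShO D C) (ShO D X)" using h0[OF compact_shift[OF C] z(1)] z(2) by simp
    then show ?thesis by (rule shift_eq_zer[OF _ x CO O(1)])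
  qed
  show "inj_on (yoneda_map \<kappa> D X f C) (carrier (Val (yoneda D X) C))"
  proof (rule inj_onI)
    fix x x' assume "x \<in> carrier (Val (yoneda D X) C)" "x' \<in> carrier (Val (yoneda D X) C)"
      "yoneda_map \<kappa> D X f C x = yoneda_map \<kappa> D X f C x'"
    then have x: "x \<in> mor D C X" "x' \<in> mor D C X" and fx: "f \<bullet> x = f \<bullet> x'" using C by simp_all
    have fx': "f \<bullet> x' \<in> mor D C Y" using x(2) f CO O(1,2) by (rule Cmp_closed)
    have "f \<bullet> (x \<ominus>\<^bsub>Hom D C X\<^esub> x') = zer C Y"
      unfolding Cmp_diff_right[OF x f CO O(1,2)] fx using diff_self_iff[OF fx' fx' CO O(2)] by simp
    then have "x \<ominus>\<^bsub>Hom D C X\<^esub> x' = zer C X" by (rule ker[OF diff_closed[OF x CO O(1)]])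
    then show "x = x'" using diff_self_iff[OF x CO O(1)] by simp
  qed
  show "yoneda_map \<kappa> D X f C ` carrier (Val (yoneda D X) C)
      = {y \<in> carrier (Val (yoneda D Y) C). yoneda_map \<kappa> D Y g C y = \<zero>\<^bsub>Val (yoneda D Z) C\<^esub>}"
  proof (intro equalityI subsetI)
    fix y assume "y \<in> yoneda_map \<kappa> D X f C ` carrier (Val (yoneda D X) C)"
    then obtain x where x: "x \<in> mor D C X" "y = f \<bullet> x" using C by auto
    have fx: "f \<bullet> x \<in> mor D C Y" using x(1) f CO O(1,2) by (rule Cmp_closed)
    have "g \<bullet> (f \<bullet> x) = zer C Z"
      using assoc[OF x(1) f g CO O(1-3)] Tri_comp_zer[OF T] Cmp_zero_left[OF x(1) CO O(1,3)] by simp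
    then show "y \<in> {y \<in> carrier (Val (yoneda D Y) C). yoneda_map \<kappa> D Y g C y = \<zero>\<^bsub>Val (yoneda D Z) C\<^esub>}"
      using x(2) fx C by simp
  next
    fix y assume "y \<in> {y \<in> carrier (Val (yoneda D Y) C). yoneda_map \<kappa> D Y g C y = \<zero>\<^bsub>Val (yoneda D Z) C\<^esub>}"
    then have y: "y \<in> mor D C Y" "g \<bullet> y = zer C Z" using C by auto
    obtain x where x: "x \<in> mor D C X" "f \<bullet> x = y" by (rule Tri_lift[OF T CO y])
    then show "y \<in> yoneda_map \<kappa> D X f C ` carrier (Val (yoneda D X) C)"
      using C by (intro image_eqI[of _ _ x]) simp_all
  qed
  show "yoneda_map \<kappa> D Y g C ` carrier (Val (yoneda D Y) C) = carrier (Val (yoneda D Z) C)"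
  proof (intro equalityI subsetI)
    fix z assume "z \<in> yoneda_map \<kappa> D Y g C ` carrier (Val (yoneda D Y) C)"
    then show "z \<in> carrier (Val (yoneda D Z) C)"
      using C Cmp_closed[OF _ g CO O(2,3)] by auto
  next
    fix z assume "z \<in> carrier (Val (yoneda D Z) C)"
    then have z: "z \<in> mor D C Z" by simp
    obtain y where y: "y \<in> mor D C Y" "g \<bullet> y = z" by (rule Tri_lift2[OF T CO z h0[OF C z]])
    then show "z \<in> yoneda_map \<kappa> D Y g C ` carrier (Val (yoneda D Y) C)"
      using C by (intro image_eqI[of _ _ y]) simp_all
  qed
qed

lemma pure_triangleD:
  assumes "pure_triangle R \<kappa> D X Y Z f g h"
  shows "Tri D X Y Z f g h"
    and pure_triangle_inj: "\<lbrakk>C \<in> cpt; x \<in> mor D C X; x' \<in> mor D C X; f \<bullet> x = f \<bullet> x'\<rbrakk> \<Longrightarrow> x = x'"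
    and pure_triangle_surj: "\<lbrakk>C \<in> cpt; z \<in> mor D C Z\<rbrakk> \<Longrightarrow> \<exists>y\<in>mor D C Y. g \<bullet> y = z"
proof -
  show "Tri D X Y Z f g h" using assms by (simp add: pure_triangle_def)
  { assume C: "C \<in> cpt"
    then have e: "inj_on (yoneda_map \<kappa> D X f C) (mor D C X)"
      "yoneda_map \<kappa> D Y g C ` mor D C Y = mor D C Z"
      using assms by (simp_all add: pure_triangle_def dmod_short_exact_def short_exact_def)
    show "x = x'" if "x \<in> mor D C X" "x' \<in> mor D C X" "f \<bullet> x = f \<bullet> x'"
      using inj_onD[OF e(1) _ that(1,2)] that C by simp
    show "\<exists>y\<in>mor D C Y. g \<bullet> y = z" if "z \<in> mor D C Z"
    proof -
      have "z \<in> yoneda_map \<kappa> D Y g C ` mor D C Y" using that e(2) by simp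
      then show ?thesis using C by auto
    qed }
qed

lemma pure_triangle_connecting:
  assumes T: "pure_triangle R \<kappa> D X Y Z f g h" and C: "C \<in> cpt" and z: "z \<in> mor D C Z"
  shows "h \<bullet> z = zer C (ShO D X)"
proof -
  note T' = pure_triangleD(1)[OF T] and CO = compact_Ob[OF C]
  have O: "X \<in> Ob D" "Y \<in> Ob D" "Z \<in> Ob D" "ShO D X \<in> Ob D"
    and g: "g \<in> mor D Y Z" and h: "h \<in> mor D Z (ShO D X)"
    using Tri_typed[OF T'] Tri_ob[OF T'] by auto
  obtain y where y: "y \<in> mor D C Y" "g \<bullet> y = z" using pure_triangle_surj[OF T C z] by blast
  then show ?thesis
    using assoc[OF y(1) g h CO O(2-4)] Tri_comp_zer2[OF T'] Cmp_zero_left[OF y(1) CO O(2,4)] by simp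
qed

text \<open>A free cover of \<open>\<^bold>yX\<close> is induced by a map \<open>g : S \<rightarrow> X\<close>; as \<open>\<^bold>yg\<close> is onto, the triangle ending in \<open>g\<close>
  is pure.\<close>

lemma pure_cover:
  assumes X: "X \<in> Ob D"
  obtains K P f g h where "in_Add P" "pure_triangle R \<kappa> D K P X f g h"
proof -
  obtain I Y S \<iota> \<phi> where S: "compact_sum I Y S \<iota>" and \<phi>: "\<phi> \<in> Nat (yoneda D S) (yoneda D X)"
    and surj: "\<forall>C\<in>cpt. \<phi> C ` mor D C S = carrier (Val (yoneda D X) C)"
    by (rule free_cover[OF yoneda_dmod[OF X]])
  note SO = compact_sumD(3)[OF S]
  obtain g where g: "g \<in> mor D S X" "\<forall>C\<in>cpt. \<forall>x\<in>mor D C S. \<phi> C x = g \<bullet> x"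
    by (rule sum_realize[OF S X \<phi>])
  obtain K f h where T: "Tri D K S X f g h" by (rule Tri_second[OF SO X g(1)])
  have O: "ShO D K \<in> Ob D" and h: "h \<in> mor D X (ShO D K)"
    using Tri_typed[OF T] Tri_ob[OF T] by auto
  have "pure_triangle R \<kappa> D K S X f g h"
  proof (rule pure_triangleI[OF T])
    fix C z assume C: "C \<in> cpt" and "z \<in> mor D C X"
    then have "z \<in> \<phi> C ` mor D C S" using surj by simp
    then obtain y where y: "y \<in> mor D C S" "z = g \<bullet> y" using g(2) C by auto
    then show "h \<bullet> z = zer C (ShO D K)"
      using assoc[OF y(1) g(1) h compact_Ob[OF C] SO X O] Tri_comp_zer2[OF T]
        Cmp_zero_left[OF y(1) compact_Ob[OF C] SO O] by simp
  qed
  with compact_sum_in_Add[OF S] show ?thesis by (rule that)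
qed

text \<open>A natural transformation out of \<open>\<^bold>yX\<close> is the same as one out of \<open>\<^bold>yP\<close> that kills \<open>\<^bold>yK\<close>.\<close>

lemma factor_through_pure_epi:
  assumes T: "pure_triangle R \<kappa> D K P X f g h" and Y: "Y \<in> Ob D" and t: "t \<in> mor D P Y"
    and kill: "\<And>C k. \<lbrakk>C \<in> cpt; k \<in> mor D C K\<rbrakk> \<Longrightarrow> t \<bullet> f \<bullet> k = zer C Y"
  obtains \<psi> where "\<psi> \<in> Nat (yoneda D X) (yoneda D Y)" "\<forall>C\<in>cpt. \<forall>p\<in>mor D C P. \<psi> C (g \<bullet> p) = t \<bullet> p"
proof -
  note T' = pure_triangleD(1)[OF T]
  have O: "K \<in> Ob D" "P \<in> Ob D" "X \<in> Ob D" and f: "f \<in> mor D K P" and g: "g \<in> mor D P X"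
    using Tri_typed[OF T'] by auto
  have surj: "yoneda_map \<kappa> D P g C ` carrier (Val (yoneda D P) C) = carrier (Val (yoneda D X) C)"
    if "C \<in> cpt" for C
    using T that by (simp add: pure_triangle_def dmod_short_exact_def short_exact_def)
  have ker: "yoneda_map \<kappa> D P t C x = \<zero>\<^bsub>Val (yoneda D Y) C\<^esub>"
    if C: "C \<in> cpt" and x: "x \<in> carrier (Val (yoneda D P) C)"
      and "yoneda_map \<kappa> D P g C x = \<zero>\<^bsub>Val (yoneda D X) C\<^esub>" for C x
  proof -
    have x: "x \<in> mor D C P" "g \<bullet> x = zer C X" using that by simp_all
    obtain k where k: "k \<in> mor D C K" "f \<bullet> k = x" by (rule Tri_lift[OF T' compact_Ob[OF C] x])
    then have "t \<bullet> x = zer C Y" using kill[OF C k(1)] assoc[OF k(1) f t compact_Ob[OF C] O(1,2) Y] by simp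
    then show ?thesis using C x by simp
  qed
  obtain \<psi> where \<psi>: "\<psi> \<in> Nat (yoneda D X) (yoneda D Y)"
    "\<forall>C\<in>cpt. \<forall>x\<in>carrier (Val (yoneda D P) C). \<psi> C (yoneda_map \<kappa> D P g C x) = yoneda_map \<kappa> D P t C x"
    by (rule nat_factor[OF yoneda_dmod[OF O(2)] yoneda_dmod[OF O(3)] yoneda_dmod[OF Y]
          yoneda_map_nat[OF O(2,3) g] yoneda_map_nat[OF O(2) Y t] surj ker])
  then have "\<forall>C\<in>cpt. \<forall>p\<in>mor D C P. \<psi> C (g \<bullet> p) = t \<bullet> p" by simp
  with \<psi>(1) show ?thesis by (rule that)
qed

text \<open>Lifts along a pure epimorphism are chosen on the compact summands and assembled by the universal
  property. Injectivity holds because maps out of \<open>P\<close> are determined on compact objects.\<close>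

lemma Add_pure_projective:
  assumes P: "in_Add P"
  shows "pure_projective R \<kappa> D P"
  unfolding pure_projective_def
proof (intro conjI allI impI)
  obtain I V S \<iota> r s where PO: "P \<in> Ob D" and S: "compact_sum I V S \<iota>" and SO: "S \<in> Ob D"
    and r: "r \<in> mor D S P" and s: "s \<in> mor D P S" and rs: "r \<bullet> s = Idn D P"
    by (rule in_AddE[OF P])
  note sD = compact_sumD[OF S]
  show "P \<in> Ob D" by fact
  fix X Y Z f g h assume T: "pure_triangle R \<kappa> D X Y Z f g h"
  note T' = pure_triangleD(1)[OF T]
  have O: "X \<in> Ob D" "Y \<in> Ob D" "Z \<in> Ob D" and f: "f \<in> mor D X Y" and g: "g \<in> mor D Y Z"
    using Tri_typed[OF T'] by auto
  show "short_exact (Hom D P X) (Hom D P Y) (Hom D P Z) (\<lambda>x. f \<bullet> x) (\<lambda>y. g \<bullet> y)"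
    unfolding short_exact_def
  proof (intro conjI)
    show "inj_on (\<lambda>x. f \<bullet> x) (mor D P X)"
    proof (rule inj_onI)
      fix x x' assume x: "x \<in> mor D P X" and x': "x' \<in> mor D P X" and eq: "f \<bullet> x = f \<bullet> x'"
      show "x = x'"
      proof (rule Add_faithful[OF P O(1) x x'])
        fix C c assume C: "C \<in> cpt" and c: "c \<in> mor D C P"
        note CO = compact_Ob[OF C]
        show "x \<bullet> c = x' \<bullet> c"
        proof (rule pure_triangle_inj[OF T C])
          show "x \<bullet> c \<in> mor D C X" "x' \<bullet> c \<in> mor D C X"
            using Cmp_closed[OF c x CO PO O(1)] Cmp_closed[OF c x' CO PO O(1)] .
          show "f \<bullet> (x \<bullet> c) = f \<bullet> (x' \<bullet> c)"
            unfolding assoc[OF c x f CO PO O(1,2)] assoc[OF c x' f CO PO O(1,2)] eq ..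
        qed
      qed
    qed
    show "(\<lambda>x. f \<bullet> x) ` mor D P X = {y \<in> mor D P Y. g \<bullet> y = zer P Z}"
    proof (intro equalityI subsetI)
      fix y assume "y \<in> (\<lambda>x. f \<bullet> x) ` mor D P X"
      then obtain x where x: "x \<in> mor D P X" "y = f \<bullet> x" by blast
      have "g \<bullet> (f \<bullet> x) = zer P Z"
        using assoc[OF x(1) f g PO O] Tri_comp_zer[OF T'] Cmp_zero_left[OF x(1) PO O(1,3)] by simp
      then show "y \<in> {y \<in> mor D P Y. g \<bullet> y = zer P Z}"
        using x(2) Cmp_closed[OF x(1) f PO O(1,2)] by simp
    next
      fix y assume "y \<in> {y \<in> mor D P Y. g \<bullet> y = zer P Z}"
      then have y: "y \<in> mor D P Y" "g \<bullet> y = zer P Z" by auto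
      obtain x where x: "x \<in> mor D P X" "f \<bullet> x = y" by (rule Tri_lift[OF T' PO y])
      then show "y \<in> (\<lambda>x. f \<bullet> x) ` mor D P X" by blast
    qed
    show "(\<lambda>y. g \<bullet> y) ` mor D P Y = mor D P Z"
    proof (intro equalityI subsetI)
      fix z assume "z \<in> (\<lambda>y. g \<bullet> y) ` mor D P Y"
      then show "z \<in> mor D P Z" using Cmp_closed[OF _ g PO O(2,3)] by blast
    next
      fix z assume z: "z \<in> mor D P Z"
      have zr: "z \<bullet> r \<in> mor D S Z" using r z SO PO O(3) by (rule Cmp_closed)
      have "\<exists>y\<in>mor D (V i) Y. g \<bullet> y = z \<bullet> r \<bullet> \<iota> i" if i: "i \<in> I" for i
        by (rule pure_triangle_surj[OF T sD(4)[OF i] Cmp_closed[OF sD(6)[OF i] zr sD(5)[OF i] SO O(3)]])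
      then obtain y where y: "\<And>i. i \<in> I \<Longrightarrow> y i \<in> mor D (V i) Y" "\<And>i. i \<in> I \<Longrightarrow> g \<bullet> y i = z \<bullet> r \<bullet> \<iota> i"
        by metis
      obtain k where k: "k \<in> mor D S Y" "\<forall>i\<in>I. k \<bullet> \<iota> i = y i"
        by (rule coproduct_map[where f = y, OF sD(2) O(2) y(1)])
      have "g \<bullet> k = z \<bullet> r"
      proof (rule coproduct_ext[OF sD(2) O(3) sD(5) _ zr])
        show "g \<bullet> k \<in> mor D S Z" using k(1) g SO O(2,3) by (rule Cmp_closed)
        fix i assume i: "i \<in> I"
        show "g \<bullet> k \<bullet> \<iota> i = z \<bullet> r \<bullet> \<iota> i"
          using assoc[OF sD(6)[OF i] k(1) g sD(5)[OF i] SO O(2,3)] k(2) y(2)[OF i] i by simp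
      qed
      then have "g \<bullet> (k \<bullet> s) = z \<bullet> (r \<bullet> s)"
        using assoc[OF s k(1) g PO SO O(2,3)] assoc[OF s r z PO SO PO O(3)] by simp
      then have "z = g \<bullet> (k \<bullet> s)" using rs Cmp_Idn[OF z PO O(3)] by simp
      then show "z \<in> (\<lambda>y. g \<bullet> y) ` mor D P Y" using Cmp_closed[OF s k(1) PO SO O(2)] by blast
    qed
  qed
qed

text \<open>A pure cover of a pure projective object splits.\<close>

lemma pure_projective_iff_Add: "pure_projective R \<kappa> D P \<longleftrightarrow> in_Add P"
proof
  assume P: "pure_projective R \<kappa> D P"
  then have PO: "P \<in> Ob D" by (simp add: pure_projective_def)
  obtain K Q f g h where Q: "in_Add Q" and T: "pure_triangle R \<kappa> D K Q P f g h" by (rule pure_cover[OF PO])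
  have g: "g \<in> mor D Q P" using Tri_typed[OF pure_triangleD(1)[OF T]] by blast
  have "(\<lambda>y. g \<bullet> y) ` mor D P Q = mor D P P"
    using P T unfolding pure_projective_def short_exact_def by blast
  then obtain s where s: "s \<in> mor D P Q" "g \<bullet> s = Idn D P" using Idn_closed[OF PO] by (metis imageE)
  show "in_Add P" by (rule Add_retract[OF Q PO g s])
qed (rule Add_pure_projective)

section \<open>Projective dimension at most one and fullness\<close>

lemma yoneda_surj_iff:
  assumes X: "X \<in> Ob D" and Y: "Y \<in> Ob D"
  shows "yoneda_surj R \<kappa> D X Y \<longleftrightarrow>
    (\<forall>\<phi>\<in>Nat (yoneda D X) (yoneda D Y). \<exists>u\<in>mor D X Y. \<forall>C\<in>cpt. \<forall>x\<in>mor D C X. \<phi> C x = u \<bullet> x)"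
    (is "_ = ?R")
proof
  assume s: "yoneda_surj R \<kappa> D X Y"
  show ?R
  proof
    fix \<phi> assume "\<phi> \<in> Nat (yoneda D X) (yoneda D Y)"
    then have "\<phi> \<in> yoneda_map \<kappa> D X ` mor D X Y" using s by (simp add: yoneda_surj_def)
    then show "\<exists>u\<in>mor D X Y. \<forall>C\<in>cpt. \<forall>x\<in>mor D C X. \<phi> C x = u \<bullet> x" by auto
  qed
next
  assume R: ?R
  show "yoneda_surj R \<kappa> D X Y"
    unfolding yoneda_surj_def
  proof (intro equalityI subsetI)
    fix \<phi> assume "\<phi> \<in> yoneda_map \<kappa> D X ` mor D X Y"
    then show "\<phi> \<in> Nat (yoneda D X) (yoneda D Y)" using yoneda_map_nat[OF X Y] by blast
  next
    fix \<phi> assume \<phi>: "\<phi> \<in> Nat (yoneda D X) (yoneda D Y)"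
    then obtain u where u: "u \<in> mor D X Y" "\<forall>C\<in>cpt. \<forall>x\<in>mor D C X. \<phi> C x = u \<bullet> x" using R by blast
    have "\<phi> = yoneda_map \<kappa> D X u"
      by (rule nat_ext[OF \<phi> yoneda_map_nat[OF X Y u(1)]]) (use u(2) in simp)
    then show "\<phi> \<in> yoneda_map \<kappa> D X ` mor D X Y" using u(1) by blast
  qed
qed

text \<open>Compose \<open>\<phi>\<close> with \<open>\<^bold>yg : \<^bold>yP0 \<rightarrow> \<^bold>yX\<close> and realise the result by \<open>t : P0 \<rightarrow> Y\<close>. Then \<open>t f\<close> vanishes
  on compact objects, hence vanishes since it starts in \<open>Add(D\<^sup>c)\<close>, so that \<open>t\<close> factors through \<open>g\<close>.\<close>

lemma ppdim_le1_yoneda_surj: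
  assumes X: "ppdim_le1 R \<kappa> D X" and Y: "Y \<in> Ob D"
  shows "yoneda_surj R \<kappa> D X Y"
proof -
  obtain P1 P0 f g h where P1: "in_Add P1" and P0: "in_Add P0" and T: "pure_triangle R \<kappa> D P1 P0 X f g h"
    using X unfolding ppdim_le1_def pure_projective_iff_Add by blast
  note T' = pure_triangleD(1)[OF T]
  have O: "P1 \<in> Ob D" "P0 \<in> Ob D" "X \<in> Ob D" and f: "f \<in> mor D P1 P0" and g: "g \<in> mor D P0 X"
    using Tri_typed[OF T'] by auto
  have "\<exists>u\<in>mor D X Y. \<forall>C\<in>cpt. \<forall>x\<in>mor D C X. \<phi> C x = u \<bullet> x"
    if \<phi>: "\<phi> \<in> Nat (yoneda D X) (yoneda D Y)" for \<phi>
  proof -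
    obtain \<psi> where \<psi>: "\<psi> \<in> Nat (yoneda D P0) (yoneda D Y)"
      "\<forall>C\<in>cpt. \<forall>x\<in>carrier (Val (yoneda D P0) C). \<psi> C x = \<phi> C (yoneda_map \<kappa> D P0 g C x)"
      by (rule nat_comp[OF yoneda_dmod[OF O(2)] yoneda_map_nat[OF O(2,3) g] \<phi>])
    obtain t where t: "t \<in> mor D P0 Y" "\<forall>C\<in>cpt. \<forall>x\<in>mor D C P0. \<psi> C x = t \<bullet> x"
      by (rule Add_realize[OF P0 Y \<psi>(1)])
    have tg: "t \<bullet> x = \<phi> C (g \<bullet> x)" if "C \<in> cpt" "x \<in> mor D C P0" for C x
      using \<psi>(2) t(2) that by simp
    have "t \<bullet> f = zer P1 Y"
    proof (rule Add_faithful[OF P1 Y Cmp_closed[OF f t(1) O(1,2) Y] zer_closed[OF O(1) Y]])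
      fix C x assume C: "C \<in> cpt" and x: "x \<in> mor D C P1"
      note CO = compact_Ob[OF C]
      have "t \<bullet> f \<bullet> x = t \<bullet> (f \<bullet> x)" using assoc[OF x f t(1) CO O(1,2) Y] by simp
      also have "\<dots> = \<phi> C (g \<bullet> (f \<bullet> x))" by (rule tg[OF C Cmp_closed[OF x f CO O(1,2)]])
      also have "g \<bullet> (f \<bullet> x) = zer C X"
        using assoc[OF x f g CO O] Tri_comp_zer[OF T'] Cmp_zero_left[OF x CO O(1,3)] by simp
      also have "\<phi> C (zer C X) = zer C Y"
        using nat_zero[OF yoneda_dmod[OF O(3)] yoneda_dmod[OF Y] \<phi> C] by simp
      finally show "t \<bullet> f \<bullet> x = zer P1 Y \<bullet> x" using Cmp_zero_left[OF x CO O(1) Y] by simp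
    qed
    then obtain u where u: "u \<in> mor D X Y" "u \<bullet> g = t" by (rule Tri_extend[OF T' Y t(1)])
    have "\<phi> C x = u \<bullet> x" if C: "C \<in> cpt" and x: "x \<in> mor D C X" for C x
    proof -
      obtain y where y: "y \<in> mor D C P0" "g \<bullet> y = x" using pure_triangle_surj[OF T C x] by blast
      then show ?thesis using tg[OF C y(1)] assoc[OF y(1) g u(1) compact_Ob[OF C] O(2,3) Y] u(2) by simp
    qed
    then show ?thesis using u(1) by blast
  qed
  then show ?thesis using yoneda_surj_iff[OF O(3) Y] by blast
qed

text \<open>The cone of \<open>e\<close> receives no nonzero map from a compact object, so it vanishes.\<close>

lemma right_inverse_if_yoneda_identity:
  assumes X: "X \<in> Ob D" and e: "e \<in> mor D X X"
    and id: "\<And>C x. \<lbrakk>C \<in> cpt; x \<in> mor D C X\<rbrakk> \<Longrightarrow> e \<bullet> x = x"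
  obtains s where "s \<in> mor D X X" "e \<bullet> s = Idn D X"
proof -
  obtain Z a b where T: "Tri D X X Z e a b" using Tri_cone[OF X X e] by blast
  have Z: "Z \<in> Ob D" and a: "a \<in> mor D X Z" using Tri_typed[OF T] by auto
  have inj: "x = zer C X" if "C \<in> cpt" "x \<in> mor D C X" "e \<bullet> x = zer C X" for C x
    using that id[OF that(1,2)] by simp
  have "mor D C Z = {zer C Z}" if C: "C \<in> cpt" for C
  proof (intro equalityI subsetI)
    note CO = compact_Ob[OF C]
    fix z assume z: "z \<in> mor D C Z"
    have "b \<bullet> z = zer C (ShO D X)" by (rule connecting_zero_if_inj[OF T inj C z])
    then obtain y where y: "y \<in> mor D C X" "a \<bullet> y = z" by (rule Tri_lift2[OF T CO z])
    have "z = a \<bullet> (e \<bullet> y)" using y id[OF C y(1)] by simp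
    also have "\<dots> = zer C Z"
      using assoc[OF y(1) e a CO X X Z] Tri_comp_zer[OF T] Cmp_zero_left[OF y(1) CO X Z] by simp
    finally show "z \<in> {zer C Z}" by simp
  next
    fix z assume "z \<in> {zer C Z}"
    then show "z \<in> mor D C Z" using zer_closed[OF compact_Ob[OF C] Z] by simp
  qed
  then have "is_zero_obj D Z" by (rule compacts_generate[OF Z])
  then have "a = zer X Z" using X a by (rule mor_into_zero_obj)
  then have "a \<bullet> Idn D X = zer X Z" using Cmp_Idn[OF a X Z] by simp
  then obtain s where "s \<in> mor D X X" "e \<bullet> s = Idn D X" by (rule Tri_lift[OF T X Idn_closed[OF X]])
  then show ?thesis by (rule that)
qed

text \<open>The heart of the converse. Let \<open>w\<close> be a map out of \<open>K\<close> with \<open>\<^bold>yw = 0\<close>. Pushing the pure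
  triangle out along \<open>w\<close> gives a triangle \<open>V \<rightarrow>q E \<rightarrow>p X\<close> and a map \<open>b : P \<rightarrow> E\<close> over \<open>X\<close>. As
  \<open>\<^bold>y(b f) = \<^bold>y(q w) = 0\<close>, the map \<open>\<^bold>yb\<close> descends to a section of \<open>\<^bold>yp\<close>; by hypothesis it comes from
  \<open>\<sigma> : X \<rightarrow> E\<close>, so \<open>p\<close> is a split epimorphism and \<open>w\<close> extends to \<open>v : P \<rightarrow> V\<close>. Now \<open>\<^bold>yv\<close> descends
  to \<open>\<^bold>yX\<close> and comes from some \<open>\<tau>\<close>; then \<open>v = \<tau> g\<close>, because maps out of \<open>P\<close> are determined on compact
  objects, and \<open>w = \<tau> g f = 0\<close>.\<close>

lemma phantom_out_of_kernel_zero: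
  assumes P: "in_Add P" and T: "pure_triangle R \<kappa> D K P X f g h"
    and full: "\<And>Y. Y \<in> Ob D \<Longrightarrow> yoneda_surj R \<kappa> D X Y"
    and V: "V \<in> Ob D" and w: "w \<in> mor D K V"
    and phantom: "\<And>C k. \<lbrakk>C \<in> cpt; k \<in> mor D C K\<rbrakk> \<Longrightarrow> w \<bullet> k = zer C V"
  shows "w = zer K V"
proof -
  note T' = pure_triangleD(1)[OF T]
  have O: "K \<in> Ob D" "P \<in> Ob D" "X \<in> Ob D" "ShO D K \<in> Ob D"
    and f: "f \<in> mor D K P" and g: "g \<in> mor D P X" and h: "h \<in> mor D X (ShO D K)"
    using Tri_typed[OF T'] Tri_ob[OF T'] by auto
  have sV: "ShO D V \<in> Ob D" using V by (rule shift_closed)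
  have sw: "ShM D w \<in> mor D (ShO D K) (ShO D V)" using w O(1) V by (rule shift_mor)
  define k where "k = ShM D w \<bullet> h"
  have k: "k \<in> mor D X (ShO D V)" unfolding k_def using h sw O(3,4) sV by (rule Cmp_closed)
  obtain E q p where E: "Tri D V E X q p k" by (rule Tri_connecting[OF V O(3) k])
  have EO: "E \<in> Ob D" and q: "q \<in> mor D V E" and p: "p \<in> mor D E X" using Tri_typed[OF E] by auto
  have "ShM D w \<bullet> h = k \<bullet> Idn D X" using Cmp_Idn[OF k O(3) sV] by (simp add: k_def)
  then obtain b where b: "b \<in> mor D P E" "b \<bullet> f = q \<bullet> w" "p \<bullet> b = Idn D X \<bullet> g"
    by (rule Tri_morphism_middle[OF T' E w Idn_closed[OF O(3)]])
  have pb: "p \<bullet> b = g" using b(3) Idn_Cmp[OF g O(2,3)] by simp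
  have "b \<bullet> f \<bullet> c = zer C E" if C: "C \<in> cpt" and c: "c \<in> mor D C K" for C c
  proof -
    have "b \<bullet> f \<bullet> c = q \<bullet> (w \<bullet> c)" using b(2) assoc[OF c w q compact_Ob[OF C] O(1) V EO] by simp
    then show ?thesis using phantom[OF C c] Cmp_zero_right[OF q compact_Ob[OF C] V EO] by simp
  qed
  then obtain \<psi> where \<psi>: "\<psi> \<in> Nat (yoneda D X) (yoneda D E)"
    "\<forall>C\<in>cpt. \<forall>c\<in>mor D C P. \<psi> C (g \<bullet> c) = b \<bullet> c"
    by (rule factor_through_pure_epi[OF T EO b(1)])
  obtain \<sigma> where \<sigma>: "\<sigma> \<in> mor D X E" "\<forall>C\<in>cpt. \<forall>x\<in>mor D C X. \<psi> C x = \<sigma> \<bullet> x"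
    using full[OF EO] \<psi>(1) unfolding yoneda_surj_iff[OF O(3) EO] by blast
  have p\<sigma>: "p \<bullet> \<sigma> \<in> mor D X X" using \<sigma>(1) p O(3) EO O(3) by (rule Cmp_closed)
  have "p \<bullet> \<sigma> \<bullet> x = x" if C: "C \<in> cpt" and x: "x \<in> mor D C X" for C x
  proof -
    note CO = compact_Ob[OF C]
    obtain c where c: "c \<in> mor D C P" "g \<bullet> c = x" using pure_triangle_surj[OF T C x] by blast
    have "p \<bullet> \<sigma> \<bullet> x = p \<bullet> (\<sigma> \<bullet> x)" using assoc[OF x \<sigma>(1) p CO O(3) EO O(3)] by simp
    also have "\<sigma> \<bullet> x = b \<bullet> c"
      using \<sigma>(2)[rule_format, OF C x] \<psi>(2)[rule_format, OF C c(1)] c(2) by simp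
    also have "p \<bullet> (b \<bullet> c) = x" using assoc[OF c(1) b(1) p CO O(2) EO O(3)] pb c(2) by simp
    finally show ?thesis .
  qed
  then obtain s where s: "s \<in> mor D X X" "p \<bullet> \<sigma> \<bullet> s = Idn D X"
    by (rule right_inverse_if_yoneda_identity[OF O(3) p\<sigma>])
  have \<sigma>s: "\<sigma> \<bullet> s \<in> mor D X E" using s(1) \<sigma>(1) O(3) O(3) EO by (rule Cmp_closed)
  have "k = k \<bullet> (p \<bullet> (\<sigma> \<bullet> s))"
    using assoc[OF s(1) \<sigma>(1) p O(3) O(3) EO O(3)] s(2) Cmp_Idn[OF k O(3) sV] by simp
  also have "\<dots> = k \<bullet> p \<bullet> (\<sigma> \<bullet> s)" by (rule assoc[OF \<sigma>s p k O(3) EO O(3) sV])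
  also have "\<dots> = zer X (ShO D V)" using Tri_comp_zer2[OF E] Cmp_zero_left[OF \<sigma>s O(3) EO sV] by simp
  finally have "ShM D w \<bullet> h = zer X (ShO D V)" by (simp add: k_def)
  then obtain v where v: "v \<in> mor D P V" "v \<bullet> f = w" by (rule Tri_extend3[OF T' V w])
  have "v \<bullet> f \<bullet> c = zer C V" if "C \<in> cpt" "c \<in> mor D C K" for C c
    using phantom[OF that] v(2) by simp
  then obtain \<chi> where \<chi>: "\<chi> \<in> Nat (yoneda D X) (yoneda D V)"
    "\<forall>C\<in>cpt. \<forall>c\<in>mor D C P. \<chi> C (g \<bullet> c) = v \<bullet> c"
    by (rule factor_through_pure_epi[OF T V v(1)])
  obtain \<tau> where \<tau>: "\<tau> \<in> mor D X V" "\<forall>C\<in>cpt. \<forall>x\<in>mor D C X. \<chi> C x = \<tau> \<bullet> x"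
    using full[OF V] \<chi>(1) unfolding yoneda_surj_iff[OF O(3) V] by blast
  have "v = \<tau> \<bullet> g"
  proof (rule Add_faithful[OF P V v(1) Cmp_closed[OF g \<tau>(1) O(2,3) V]])
    fix C c assume C: "C \<in> cpt" and c: "c \<in> mor D C P"
    note CO = compact_Ob[OF C]
    have "v \<bullet> c = \<tau> \<bullet> (g \<bullet> c)"
      using \<chi>(2)[rule_format, OF C c] \<tau>(2)[rule_format, OF C Cmp_closed[OF c g CO O(2,3)]] by simp
    then show "v \<bullet> c = \<tau> \<bullet> g \<bullet> c" using assoc[OF c g \<tau>(1) CO O(2,3) V] by simp
  qed
  then have "w = \<tau> \<bullet> (g \<bullet> f)" using v(2) assoc[OF f g \<tau>(1) O(1-3) V] by simp
  then show ?thesis using Tri_comp_zer[OF T'] Cmp_zero_right[OF \<tau>(1) O(1,3) V] by simp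
qed

text \<open>The kernel \<open>K\<close> of a pure cover of \<open>X\<close> has a pure cover of its own, whose connecting map vanishes on
  compact objects. It starts in \<open>K\<close>, so it is zero, and \<open>K\<close> is a retract of its cover.\<close>

lemma yoneda_surj_ppdim_le1:
  assumes X: "X \<in> Ob D" and full: "\<And>Y. Y \<in> Ob D \<Longrightarrow> yoneda_surj R \<kappa> D X Y"
  shows "ppdim_le1 R \<kappa> D X"
proof -
  obtain K P f g h where P: "in_Add P" and T: "pure_triangle R \<kappa> D K P X f g h" by (rule pure_cover[OF X])
  have K: "K \<in> Ob D" using Tri_typed[OF pure_triangleD(1)[OF T]] by blast
  obtain L Q f' g' h' where Q: "in_Add Q" and T2: "pure_triangle R \<kappa> D L Q K f' g' h'"
    by (rule pure_cover[OF K])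
  note T2' = pure_triangleD(1)[OF T2]
  have g': "g' \<in> mor D Q K" and h': "h' \<in> mor D K (ShO D L)" and sL: "ShO D L \<in> Ob D"
    using Tri_typed[OF T2'] Tri_ob[OF T2'] by auto
  have "h' = zer K (ShO D L)"
    by (rule phantom_out_of_kernel_zero[OF P T full sL h']) (auto intro: pure_triangle_connecting[OF T2])
  then have "h' \<bullet> Idn D K = zer K (ShO D L)" using Cmp_Idn[OF h' K sL] by simp
  then obtain s where s: "s \<in> mor D K Q" "g' \<bullet> s = Idn D K"
    by (rule Tri_lift2[OF T2' K Idn_closed[OF K]])
  have "in_Add K" by (rule Add_retract[OF Q K g' s])
  then show ?thesis using P T unfolding ppdim_le1_def pure_projective_iff_Add by blast
qed

section \<open>The essential image\<close>

text \<open>A projective module splits off a free cover \<open>\<^bold>yS\<close>. The corresponding idempotent of \<open>\<^bold>yS\<close> comes from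
  one of \<open>S\<close>, which splits in \<open>D\<close>.\<close>

lemma projective_dmod_representable:
  assumes P: "dmod_projective R \<kappa> D P"
  obtains T \<alpha> \<beta> where "in_Add T" "\<alpha> \<in> Nat P (yoneda D T)" "\<beta> \<in> Nat (yoneda D T) P"
    "\<forall>C\<in>cpt. \<forall>x\<in>carrier (Val P C). \<beta> C (\<alpha> C x) = x" "\<forall>C\<in>cpt. \<forall>y\<in>mor D C T. \<alpha> C (\<beta> C y) = y"
proof -
  have PM: "P \<in> dmods" using P by (simp add: dmod_projective_def)
  obtain I X S \<iota> \<phi> where S: "compact_sum I X S \<iota>" and \<phi>: "\<phi> \<in> Nat (yoneda D S) P"
    and surj: "\<forall>C\<in>cpt. \<phi> C ` mor D C S = carrier (Val P C)"
    by (rule free_cover[OF PM])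
  note SO = compact_sumD(3)[OF S] and SA = compact_sum_in_Add[OF S]
  obtain \<iota>d where \<iota>d: "\<iota>d \<in> Nat P P" "\<forall>C\<in>cpt. \<forall>x\<in>carrier (Val P C). \<iota>d C x = x"
    by (rule nat_exists[OF PM, of P "\<lambda>C x. x"]) (auto simp: linear_map_def)
  have "\<exists>\<sigma>\<in>Nat P (yoneda D S). \<forall>C\<in>cpt. \<forall>x\<in>carrier (Val P C). \<phi> C (\<sigma> C x) = \<iota>d C x"
    using P yoneda_dmod[OF SO] PM \<phi> \<iota>d(1) surj unfolding dmod_projective_def by simp
  then obtain \<sigma> where \<sigma>: "\<sigma> \<in> Nat P (yoneda D S)" "\<forall>C\<in>cpt. \<forall>x\<in>carrier (Val P C). \<phi> C (\<sigma> C x) = x"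
    using \<iota>d(2) by auto
  have \<sigma>c: "\<sigma> C x \<in> mor D C S" if "C \<in> cpt" "x \<in> carrier (Val P C)" for C x
    using nat_closed[OF \<sigma>(1) that] by simp
  have \<phi>c: "\<phi> C y \<in> carrier (Val P C)" if "C \<in> cpt" "y \<in> mor D C S" for C y
    using nat_closed[OF \<phi> that(1), of y] that(2) by simp
  obtain \<epsilon> where \<epsilon>: "\<epsilon> \<in> Nat (yoneda D S) (yoneda D S)"
    "\<forall>C\<in>cpt. \<forall>x\<in>carrier (Val (yoneda D S) C). \<epsilon> C x = \<sigma> C (\<phi> C x)"
    by (rule nat_comp[OF yoneda_dmod[OF SO] \<phi> \<sigma>(1)])
  obtain e where e: "e \<in> mor D S S" "\<forall>C\<in>cpt. \<forall>x\<in>mor D C S. \<epsilon> C x = e \<bullet> x"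
    by (rule Add_realize[OF SA SO \<epsilon>(1)])
  have ex: "e \<bullet> x = \<sigma> C (\<phi> C x)" if "C \<in> cpt" "x \<in> mor D C S" for C x
    using \<epsilon>(2) e(2) that by simp
  have "e \<bullet> e = e"
  proof (rule Add_faithful[OF SA SO Cmp_closed[OF e(1) e(1) SO SO SO] e(1)])
    fix C x assume C: "C \<in> cpt" and x: "x \<in> mor D C S"
    have "e \<bullet> e \<bullet> x = e \<bullet> (e \<bullet> x)" using assoc[OF x e(1) e(1) compact_Ob[OF C] SO SO SO] by simp
    also have "\<dots> = e \<bullet> \<sigma> C (\<phi> C x)" by (simp only: ex[OF C x])
    also have "\<dots> = \<sigma> C (\<phi> C (\<sigma> C (\<phi> C x)))" by (rule ex[OF C \<sigma>c[OF C \<phi>c[OF C x]]])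
    also have "\<dots> = e \<bullet> x" using \<sigma>(2) C \<phi>c[OF C x] ex[OF C x] by simp
    finally show "e \<bullet> e \<bullet> x = e \<bullet> x" .
  qed
  then obtain T r s where T: "T \<in> Ob D" "r \<in> mor D S T" "s \<in> mor D T S" "r \<bullet> s = Idn D T" "s \<bullet> r = e"
    by (rule idempotents_split[OF SO e(1)])
  have TA: "in_Add T" by (rule Add_retract[OF SA T(1-4)])
  obtain \<alpha> where \<alpha>: "\<alpha> \<in> Nat P (yoneda D T)"
    "\<forall>C\<in>cpt. \<forall>x\<in>carrier (Val P C). \<alpha> C x = yoneda_map \<kappa> D S r C (\<sigma> C x)"
    by (rule nat_comp[OF PM \<sigma>(1) yoneda_map_nat[OF SO T(1,2)]])
  obtain \<beta> where \<beta>: "\<beta> \<in> Nat (yoneda D T) P"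
    "\<forall>C\<in>cpt. \<forall>x\<in>carrier (Val (yoneda D T) C). \<beta> C x = \<phi> C (yoneda_map \<kappa> D T s C x)"
    by (rule nat_comp[OF yoneda_dmod[OF T(1)] yoneda_map_nat[OF T(1) SO T(3)] \<phi>])
  have \<alpha>x: "\<alpha> C x = r \<bullet> \<sigma> C x" if "C \<in> cpt" "x \<in> carrier (Val P C)" for C x
    using \<alpha>(2) that \<sigma>c[OF that] by simp
  have \<beta>y: "\<beta> C y = \<phi> C (s \<bullet> y)" if "C \<in> cpt" "y \<in> mor D C T" for C y
    using \<beta>(2) that by simp
  have "\<beta> C (\<alpha> C x) = x" if C: "C \<in> cpt" and x: "x \<in> carrier (Val P C)" for C x
  proof -
    note CO = compact_Ob[OF C] and \<sigma>x = \<sigma>c[OF C x]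
    have "\<beta> C (\<alpha> C x) = \<phi> C (s \<bullet> (r \<bullet> \<sigma> C x))"
      using \<alpha>x[OF C x] \<beta>y[OF C Cmp_closed[OF \<sigma>x T(2) CO SO T(1)]] by simp
    also have "s \<bullet> (r \<bullet> \<sigma> C x) = e \<bullet> \<sigma> C x" using assoc[OF \<sigma>x T(2,3) CO SO T(1) SO] T(5) by simp
    also have "\<dots> = \<sigma> C x" using ex[OF C \<sigma>x] \<sigma>(2) C x by simp
    finally show ?thesis using \<sigma>(2) C x by simp
  qed
  then have "\<forall>C\<in>cpt. \<forall>x\<in>carrier (Val P C). \<beta> C (\<alpha> C x) = x" by blast
  moreover have "\<alpha> C (\<beta> C y) = y" if C: "C \<in> cpt" and y: "y \<in> mor D C T" for C y
  proof -
    note CO = compact_Ob[OF C]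
    have sy: "s \<bullet> y \<in> mor D C S" using y T(3) CO T(1) SO by (rule Cmp_closed)
    have "\<alpha> C (\<beta> C y) = r \<bullet> (e \<bullet> (s \<bullet> y))"
      using \<beta>y[OF C y] \<alpha>x[OF C \<phi>c[OF C sy]] ex[OF C sy] by simp
    also have "e \<bullet> (s \<bullet> y) = s \<bullet> (r \<bullet> (s \<bullet> y))" using assoc[OF sy T(2,3) CO SO T(1) SO] T(5) by simp
    also have "r \<bullet> (s \<bullet> y) = y" using assoc[OF y T(3,2) CO T(1) SO T(1)] T(4) Idn_Cmp[OF y CO T(1)] by simp
    finally show ?thesis using \<open>r \<bullet> (s \<bullet> y) = y\<close> by simp
  qed
  then have "\<forall>C\<in>cpt. \<forall>y\<in>mor D C T. \<alpha> C (\<beta> C y) = y" by blast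
  ultimately show ?thesis by (rule that[OF TA \<alpha>(1) \<beta>(1)])
qed

text \<open>Transport the exact sequence of a pure triangle along the isomorphism from \<open>\<^bold>yX\<close> to \<open>M\<close>.\<close>

lemma ess_image_pdim_le1:
  assumes M: "M \<in> dmods" and X: "ppdim_le1 R \<kappa> D X" and iso: "dmod_isomorphic R \<kappa> D M (yoneda D X)"
  shows "dmod_pdim_le1 R \<kappa> D M"
proof -
  obtain P1 P0 f g h where P1: "in_Add P1" and P0: "in_Add P0" and T: "pure_triangle R \<kappa> D P1 P0 X f g h"
    using X unfolding ppdim_le1_def pure_projective_iff_Add by blast
  note T' = pure_triangleD(1)[OF T]
  have O: "P1 \<in> Ob D" "P0 \<in> Ob D" "X \<in> Ob D" and g: "g \<in> mor D P0 X"
    using Tri_typed[OF T'] by auto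
  obtain \<alpha> \<beta> where \<alpha>: "\<alpha> \<in> Nat M (yoneda D X)" and \<beta>: "\<beta> \<in> Nat (yoneda D X) M"
    and \<beta>\<alpha>: "\<forall>C\<in>cpt. \<forall>x\<in>carrier (Val M C). \<beta> C (\<alpha> C x) = x"
    and \<alpha>\<beta>: "\<forall>C\<in>cpt. \<forall>y\<in>mor D C X. \<alpha> C (\<beta> C y) = y"
    using iso unfolding dmod_isomorphic_def by auto
  obtain \<gamma> where \<gamma>: "\<gamma> \<in> Nat (yoneda D P0) M"
    "\<forall>C\<in>cpt. \<forall>x\<in>carrier (Val (yoneda D P0) C). \<gamma> C x = \<beta> C (yoneda_map \<kappa> D P0 g C x)"
    by (rule nat_comp[OF yoneda_dmod[OF O(2)] yoneda_map_nat[OF O(2,3) g] \<beta>])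
  have \<gamma>x: "\<gamma> C x = \<beta> C (g \<bullet> x)" if "C \<in> cpt" "x \<in> mor D C P0" for C x
    using \<gamma>(2) that by simp
  have "dmod_short_exact R \<kappa> D (yoneda D P1) (yoneda D P0) M (yoneda_map \<kappa> D P1 f) \<gamma>"
    unfolding dmod_short_exact_def
  proof (intro conjI ballI \<gamma>(1))
    show "yoneda_map \<kappa> D P1 f \<in> Nat (yoneda D P1) (yoneda D P0)"
      using T by (simp add: pure_triangle_def dmod_short_exact_def)
    fix C assume C: "C \<in> cpt"
    have se: "short_exact (Val (yoneda D P1) C) (Val (yoneda D P0) C) (Val (yoneda D X) C)
        (yoneda_map \<kappa> D P1 f C) (yoneda_map \<kappa> D P0 g C)"
      using T C by (simp add: pure_triangle_def dmod_short_exact_def)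
    have zero: "\<gamma> C x = \<zero>\<^bsub>Val M C\<^esub> \<longleftrightarrow> yoneda_map \<kappa> D P0 g C x = \<zero>\<^bsub>Val (yoneda D X) C\<^esub>"
      if "x \<in> carrier (Val (yoneda D P0) C)" for x
    proof -
      have x: "x \<in> mor D C P0" using that by simp
      have gx: "g \<bullet> x \<in> mor D C X" using Cmp_closed[OF x g compact_Ob[OF C] O(2,3)] .
      have "\<beta> C (g \<bullet> x) = \<zero>\<^bsub>Val M C\<^esub> \<longleftrightarrow> g \<bullet> x = zer C X"
      proof
        assume "\<beta> C (g \<bullet> x) = \<zero>\<^bsub>Val M C\<^esub>"
        then have "\<alpha> C (\<beta> C (g \<bullet> x)) = zer C X" using nat_zero[OF M yoneda_dmod[OF O(3)] \<alpha> C] by simp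
        then show "g \<bullet> x = zer C X" using \<alpha>\<beta> C gx by simp
      next
        assume "g \<bullet> x = zer C X"
        then show "\<beta> C (g \<bullet> x) = \<zero>\<^bsub>Val M C\<^esub>" using nat_zero[OF yoneda_dmod[OF O(3)] M \<beta> C] by simp
      qed
      then show ?thesis using \<gamma>x[OF C x] C x by simp
    qed
    have "\<gamma> C ` carrier (Val (yoneda D P0) C) = carrier (Val M C)"
    proof (intro equalityI subsetI)
      fix m assume "m \<in> \<gamma> C ` carrier (Val (yoneda D P0) C)"
      then show "m \<in> carrier (Val M C)" using nat_closed[OF \<gamma>(1) C] by blast
    next
      fix m assume m: "m \<in> carrier (Val M C)"
      have "\<alpha> C m \<in> mor D C X" using nat_closed[OF \<alpha> C m] by simp
      then obtain y where y: "y \<in> mor D C P0" "g \<bullet> y = \<alpha> C m" using pure_triangle_surj[OF T C] by blast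
      then have "m = \<gamma> C y" using \<gamma>x[OF C y(1)] \<beta>\<alpha> C m by simp
      then show "m \<in> \<gamma> C ` carrier (Val (yoneda D P0) C)" using y(1) by simp
    qed
    then show "short_exact (Val (yoneda D P1) C) (Val (yoneda D P0) C) (Val M C) (yoneda_map \<kappa> D P1 f C) (\<gamma> C)"
      using se zero unfolding short_exact_def by auto
  qed
  then show ?thesis unfolding dmod_pdim_le1_def using Add_projective[OF P1] Add_projective[OF P0] by blast
qed

text \<open>A projective presentation \<open>P1 \<rightarrow> P0\<close> of \<open>M\<close> is realised by a map \<open>f\<close> between objects of
  \<open>Add(D\<^sup>c)\<close>. As \<open>\<^bold>yf\<close> is injective, the triangle on \<open>f\<close> is pure, so its third object has the same
  cokernel presentation as \<open>M\<close>.\<close>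

lemma pdim_le1_ess_image:
  assumes M: "M \<in> dmods" and pd: "dmod_pdim_le1 R \<kappa> D M"
  obtains X where "X \<in> Ob D" "ppdim_le1 R \<kappa> D X" "dmod_isomorphic R \<kappa> D M (yoneda D X)"
proof -
  obtain P1 P0 \<alpha> \<beta> where P1: "dmod_projective R \<kappa> D P1" and P0: "dmod_projective R \<kappa> D P0"
    and se: "dmod_short_exact R \<kappa> D P1 P0 M \<alpha> \<beta>"
    using pd unfolding dmod_pdim_le1_def by blast
  have P1M: "P1 \<in> dmods" and P0M: "P0 \<in> dmods" using P1 P0 by (auto simp: dmod_projective_def)
  have \<alpha>: "\<alpha> \<in> Nat P1 P0" and \<beta>: "\<beta> \<in> Nat P0 M" using se by (auto simp: dmod_short_exact_def)
  have \<alpha>inj: "inj_on (\<alpha> C) (carrier (Val P1 C))"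
    and \<alpha>\<beta>: "\<alpha> C ` carrier (Val P1 C) = {x \<in> carrier (Val P0 C). \<beta> C x = \<zero>\<^bsub>Val M C\<^esub>}"
    and \<beta>surj: "\<beta> C ` carrier (Val P0 C) = carrier (Val M C)" if "C \<in> cpt" for C
    using se that by (auto simp: dmod_short_exact_def short_exact_def)
  obtain T1 i1 j1 where T1: "in_Add T1" and i1: "i1 \<in> Nat P1 (yoneda D T1)" and j1: "j1 \<in> Nat (yoneda D T1) P1"
    and ji1: "\<forall>C\<in>cpt. \<forall>x\<in>carrier (Val P1 C). j1 C (i1 C x) = x"
    and ij1: "\<forall>C\<in>cpt. \<forall>y\<in>mor D C T1. i1 C (j1 C y) = y"
    by (rule projective_dmod_representable[OF P1])
  obtain T0 i0 j0 where T0: "in_Add T0" and i0: "i0 \<in> Nat P0 (yoneda D T0)" and j0: "j0 \<in> Nat (yoneda D T0) P0"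
    and ji0: "\<forall>C\<in>cpt. \<forall>x\<in>carrier (Val P0 C). j0 C (i0 C x) = x"
    and ij0: "\<forall>C\<in>cpt. \<forall>y\<in>mor D C T0. i0 C (j0 C y) = y"
    by (rule projective_dmod_representable[OF P0])
  have T1O: "T1 \<in> Ob D" and T0O: "T0 \<in> Ob D" using T1 T0 by (auto simp: in_Add_def)
  note y1 = yoneda_dmod[OF T1O] and y0 = yoneda_dmod[OF T0O]
  have j1c: "j1 C x \<in> carrier (Val P1 C)" if "C \<in> cpt" "x \<in> mor D C T1" for C x
    using nat_closed[OF j1 that(1), of x] that(2) by simp
  have j0c: "j0 C x \<in> carrier (Val P0 C)" if "C \<in> cpt" "x \<in> mor D C T0" for C x
    using nat_closed[OF j0 that(1), of x] that(2) by simp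
  have i0c: "i0 C x \<in> mor D C T0" if "C \<in> cpt" "x \<in> carrier (Val P0 C)" for C x
    using nat_closed[OF i0 that] by simp
  have i1c: "i1 C x \<in> mor D C T1" if "C \<in> cpt" "x \<in> carrier (Val P1 C)" for C x
    using nat_closed[OF i1 that] by simp
  obtain \<xi>' where \<xi>': "\<xi>' \<in> Nat (yoneda D T1) P0"
    "\<forall>C\<in>cpt. \<forall>x\<in>carrier (Val (yoneda D T1) C). \<xi>' C x = \<alpha> C (j1 C x)"
    by (rule nat_comp[OF y1 j1 \<alpha>])
  obtain \<xi> where \<xi>: "\<xi> \<in> Nat (yoneda D T1) (yoneda D T0)"
    "\<forall>C\<in>cpt. \<forall>x\<in>carrier (Val (yoneda D T1) C). \<xi> C x = i0 C (\<xi>' C x)"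
    by (rule nat_comp[OF y1 \<xi>'(1) i0])
  obtain f where f: "f \<in> mor D T1 T0" "\<forall>C\<in>cpt. \<forall>x\<in>mor D C T1. \<xi> C x = f \<bullet> x"
    by (rule Add_realize[OF T1 T0O \<xi>(1)])
  have fx: "f \<bullet> x = i0 C (\<alpha> C (j1 C x))" if "C \<in> cpt" "x \<in> mor D C T1" for C x
    using f(2) \<xi>(2) \<xi>'(2) that by simp
  have j0f: "j0 C (f \<bullet> x) = \<alpha> C (j1 C x)" if "C \<in> cpt" "x \<in> mor D C T1" for C x
    using fx[OF that] ji0 that(1) nat_closed[OF \<alpha> that(1) j1c[OF that]] by simp
  have f_inj: "x = zer C T1" if C: "C \<in> cpt" and x: "x \<in> mor D C T1" and f0: "f \<bullet> x = zer C T0" for C x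
  proof -
    have "\<alpha> C (j1 C x) = \<zero>\<^bsub>Val P0 C\<^esub>" using j0f[OF C x] f0 nat_zero[OF y0 P0M j0 C] by simp
    also have "\<dots> = \<alpha> C \<zero>\<^bsub>Val P1 C\<^esub>" using nat_zero[OF P1M P0M \<alpha> C] by simp
    finally have "j1 C x = \<zero>\<^bsub>Val P1 C\<^esub>"
    proof (rule inj_onD[OF \<alpha>inj[OF C] _ j1c[OF C x]])
      interpret A: abelian_group "Val P1 C" using module_abelian_group[OF dmod_module[OF P1M C]] .
      show "\<zero>\<^bsub>Val P1 C\<^esub> \<in> carrier (Val P1 C)" by simp
    qed
    then have "i1 C (j1 C x) = zer C T1" using nat_zero[OF P1M y1 i1 C] by simp
    then show ?thesis using ij1 C x by simp
  qed
  obtain X g h where T: "Tri D T1 T0 X f g h" using Tri_cone[OF T1O T0O f(1)] by blast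
  have X: "X \<in> Ob D" and g: "g \<in> mor D T0 X" using Tri_typed[OF T] by auto
  have pure: "pure_triangle R \<kappa> D T1 T0 X f g h"
    by (rule pure_triangleI[OF T connecting_zero_if_inj[OF T f_inj]])
  then have pp: "ppdim_le1 R \<kappa> D X"
    using T1 T0 unfolding ppdim_le1_def pure_projective_iff_Add by blast
  obtain \<gamma> where \<gamma>: "\<gamma> \<in> Nat (yoneda D T0) M"
    "\<forall>C\<in>cpt. \<forall>x\<in>carrier (Val (yoneda D T0) C). \<gamma> C x = \<beta> C (j0 C x)"
    by (rule nat_comp[OF y0 j0 \<beta>])
  have \<gamma>surj: "\<gamma> C ` carrier (Val (yoneda D T0) C) = carrier (Val M C)" if C: "C \<in> cpt" for C
  proof (intro equalityI subsetI)
    fix m assume "m \<in> \<gamma> C ` carrier (Val (yoneda D T0) C)"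
    then show "m \<in> carrier (Val M C)" using nat_closed[OF \<gamma>(1) C] by blast
  next
    fix m assume "m \<in> carrier (Val M C)"
    then obtain x where x: "x \<in> carrier (Val P0 C)" "m = \<beta> C x" using \<beta>surj[OF C] by blast
    have "m = \<gamma> C (i0 C x)" using \<gamma>(2) C i0c[OF C x(1)] ji0 x by simp
    then show "m \<in> \<gamma> C ` carrier (Val (yoneda D T0) C)" using i0c[OF C x(1)] by simp
  qed
  have gsurj: "yoneda_map \<kappa> D T0 g C ` carrier (Val (yoneda D T0) C) = carrier (Val (yoneda D X) C)"
    if "C \<in> cpt" for C
    using pure that by (simp add: pure_triangle_def dmod_short_exact_def short_exact_def)
  have ker1: "yoneda_map \<kappa> D T0 g C t = \<zero>\<^bsub>Val (yoneda D X) C\<^esub>"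
    if C: "C \<in> cpt" and t: "t \<in> carrier (Val (yoneda D T0) C)" and 0: "\<gamma> C t = \<zero>\<^bsub>Val M C\<^esub>" for C t
  proof -
    note CO = compact_Ob[OF C]
    have t: "t \<in> mor D C T0" using t by simp
    have "j0 C t \<in> \<alpha> C ` carrier (Val P1 C)" unfolding \<alpha>\<beta>[OF C] using j0c[OF C t] 0 \<gamma>(2) C t by simp
    then obtain x where x: "x \<in> carrier (Val P1 C)" "j0 C t = \<alpha> C x" by blast
    have "f \<bullet> i1 C x = i0 C (j0 C t)" using fx[OF C i1c[OF C x(1)]] ji1 C x by simp
    then have "t = f \<bullet> i1 C x" using ij0 C t by simp
    then have "g \<bullet> t = zer C X"
      using assoc[OF i1c[OF C x(1)] f(1) g CO T1O T0O X] Tri_comp_zer[OF T]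
        Cmp_zero_left[OF i1c[OF C x(1)] CO T1O X] by simp
    then show ?thesis using C t by simp
  qed
  have ker2: "\<gamma> C t = \<zero>\<^bsub>Val M C\<^esub>"
    if C: "C \<in> cpt" and t: "t \<in> carrier (Val (yoneda D T0) C)"
      and 0: "yoneda_map \<kappa> D T0 g C t = \<zero>\<^bsub>Val (yoneda D X) C\<^esub>" for C t
  proof -
    have t: "t \<in> mor D C T0" using t by simp
    have "g \<bullet> t = zer C X" using 0 C t by simp
    then obtain x where x: "x \<in> mor D C T1" "f \<bullet> x = t" by (rule Tri_lift[OF T compact_Ob[OF C] t])
    have "j0 C t = \<alpha> C (j1 C x)" using j0f[OF C x(1)] x(2) by simp
    then have "j0 C t \<in> \<alpha> C ` carrier (Val P1 C)" using j1c[OF C x(1)] by simp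
    then show ?thesis unfolding \<alpha>\<beta>[OF C] using \<gamma>(2) C t by simp
  qed
  note yX = yoneda_dmod[OF X] and gN = yoneda_map_nat[OF T0O X g]
  obtain \<delta> where \<delta>: "\<delta> \<in> Nat M (yoneda D X)"
    "\<forall>C\<in>cpt. \<forall>x\<in>carrier (Val (yoneda D T0) C). \<delta> C (\<gamma> C x) = yoneda_map \<kappa> D T0 g C x"
    by (rule nat_factor[OF y0 M yX \<gamma>(1) gN \<gamma>surj ker1])
  obtain \<delta>' where \<delta>': "\<delta>' \<in> Nat (yoneda D X) M"
    "\<forall>C\<in>cpt. \<forall>x\<in>carrier (Val (yoneda D T0) C). \<delta>' C (yoneda_map \<kappa> D T0 g C x) = \<gamma> C x"
    by (rule nat_factor[OF y0 yX M gN \<gamma>(1) gsurj ker2])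
  have "\<delta>' C (\<delta> C m) = m" if C: "C \<in> cpt" and m: "m \<in> carrier (Val M C)" for C m
  proof -
    obtain t where t: "t \<in> carrier (Val (yoneda D T0) C)" "m = \<gamma> C t" using \<gamma>surj[OF C] m by blast
    then show ?thesis using \<delta>(2)[rule_format, OF C t(1)] \<delta>'(2)[rule_format, OF C t(1)] by simp
  qed
  moreover have "\<delta> C (\<delta>' C y) = y" if C: "C \<in> cpt" and y: "y \<in> carrier (Val (yoneda D X) C)" for C y
  proof -
    obtain t where t: "t \<in> carrier (Val (yoneda D T0) C)" "y = yoneda_map \<kappa> D T0 g C t"
      using gsurj[OF C] y by blast
    then show ?thesis using \<delta>(2)[rule_format, OF C t(1)] \<delta>'(2)[rule_format, OF C t(1)] by simp
  qed
  ultimately have "dmod_isomorphic R \<kappa> D M (yoneda D X)"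
    unfolding dmod_isomorphic_def using \<delta>(1) \<delta>'(1) by blast
  with X pp show ?thesis by (rule that)
qed

end

theorem proposition3p2:
  fixes R :: "('r, 's) ring_scheme"
    and \<kappa> :: "'k rel"
    and D :: "('r, 'o, 'm, 'z) tricat_scheme"
  assumes "compactly_generated R \<kappa> D"
  shows "(\<forall>X\<in>Ob D. ppdim_le1 R \<kappa> D X \<longleftrightarrow> (\<forall>Y\<in>Ob D. yoneda_surj R \<kappa> D X Y)) \<and>
    yoneda_full_on R \<kappa> D (ppdim_le1_objs R \<kappa> D) \<and>
    yoneda_ess_image R \<kappa> D (ppdim_le1_objs R \<kappa> D) =
      {M \<in> dmod_objs R \<kappa> D. dmod_pdim_le1 R \<kappa> D M}"
proof -
  interpret compactly_generated R \<kappa> D by fact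
  have "\<forall>X\<in>Ob D. ppdim_le1 R \<kappa> D X \<longleftrightarrow> (\<forall>Y\<in>Ob D. yoneda_surj R \<kappa> D X Y)"
    using ppdim_le1_yoneda_surj yoneda_surj_ppdim_le1 by blast
  moreover have "yoneda_full_on R \<kappa> D (ppdim_le1_objs R \<kappa> D)"
    unfolding yoneda_full_on_def ppdim_le1_objs_def using ppdim_le1_yoneda_surj by blast
  moreover have "yoneda_ess_image R \<kappa> D (ppdim_le1_objs R \<kappa> D) = {M \<in> dmods. dmod_pdim_le1 R \<kappa> D M}"
  proof (intro equalityI subsetI)
    fix M assume "M \<in> yoneda_ess_image R \<kappa> D (ppdim_le1_objs R \<kappa> D)"
    then show "M \<in> {M \<in> dmods. dmod_pdim_le1 R \<kappa> D M}"
      unfolding yoneda_ess_image_def ppdim_le1_objs_def using ess_image_pdim_le1 by blast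
  next
    fix M assume "M \<in> {M \<in> dmods. dmod_pdim_le1 R \<kappa> D M}"
    then have M: "M \<in> dmods" "dmod_pdim_le1 R \<kappa> D M" by auto
    obtain X where "X \<in> Ob D" "ppdim_le1 R \<kappa> D X" "dmod_isomorphic R \<kappa> D M (yoneda D X)"
      by (rule pdim_le1_ess_image[OF M])
    with M(1) show "M \<in> yoneda_ess_image R \<kappa> D (ppdim_le1_objs R \<kappa> D)"
      unfolding yoneda_ess_image_def ppdim_le1_objs_def by blast
  qed
  ultimately show ?thesis by blast
qed

end
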